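(* Let $(X,d,A)$ be a metric pair with $A\neq\emptyset$ and $(X,d)$ complete, separable and boundedly compact. Let $T$ be an element of the sequentially order continuous dual of $\mathrm{Lip}(X,A)$. Then $T$ is represented by some $\mu\in\mathcal{M}_1(X,A)$, i.e. $T(f)=\mu^+(f)-\mu^-(f)$ for all $f\in\mathrm{Lip}(X,A)$. Furthermore, $\|T\|_{\mathrm{op}}=W_1(\mu^+,\mu^-)$.
   Context: A metric pair $(X,d,A)$ is a metric space $(X,d)$ with a closed subset $A\subset X$; $d_A(x)=\inf_{a\in A}d(x,a)$. $X$ is boundedly compact if every closed bounded subset is compact. Measures take values in $[0,\infty]$. Let $\mathcal{B}^+(X)$ be the commutative monoid of Borel measures on $X$ and $\mathcal{B}^+(X,A)=\mathcal{B}^+(X)/\mathcal{B}^+(A)$ the quotient monoid: $\mu\sim\nu$ iff $\mu+\sigma=\nu+\tau$ for some Borel measures $\sigma,\tau$ concentrated on $A$; equivalently $\mu,\nu$ agree on Borel subsets of $X\setminus A$, so relative Borel measures correspond bijectively to Borel measures on $X\setminus A$. For $f$ vanishing on $A$, $\mu(f)=\int_X f\,d\mu$ is well defined. $\mu$ is tight if $\mu(E)=\sup\{\mu(K): K\subset E \text{ compact}\}$ for every Borel $E\subset X\setminus A$. $\mathcal{M}_1^+(X,A)$ is the set of tight $\mu\in\mathcal{B}^+(X,A)$ with $\mu(d_A)<\infty$. $\mathcal{M}_1(X,A)$ is its Grothendieck group (formal differences), a Riesz space (vector lattice) with positive cone $\mathcal{M}_1^+(X,A)$; each $\mu\in\mathcal{M}_1(X,A)$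 is uniquely $\mu=\mu^+-\mu^-$ with $\mu^\pm\in\mathcal{M}_1^+(X,A)$ and $\mu^+\wedge\mu^-=0$. $\mathrm{Lip}(X,A)$ is the Riesz space of Lipschitz functions $f:X\to\mathbb{R}$ with $f|_A=0$, ordered pointwise and normed by the Lipschitz number $L(f)$ (least Lipschitz constant); $\|\cdot\|_{\mathrm{op}}$ is the operator norm with respect to $L$. In a Riesz space $E$, $x_n\xrightarrow{o}0$ means there is a decreasing sequence $(y_n)$ in $E$ with infimum $0$ in $E$ and $|x_n|\le y_n$. The sequentially order continuous dual of $E$ consists of the order bounded linear functionals $T$ (mapping order intervals to bounded sets) such that $x_n\xrightarrow{o}0$ implies $T(x_n)\to0$. The product pair is $(X\times X,d+d,A\times A)$, with $\mathcal{B}^+(X^2,A^2)$ defined in the same way. $\Pi(\mu,\nu)$ is the set of $\pi\in\mathcal{B}^+(X^2,A^2)$ whose pushforwards under the two projections $X^2\to X$ are $\mu$ and $\nu$ in $\mathcal{B}^+(X,A)$. With $\bar d(x,y)=\min(d(x,y),d_A(x)+d_A(y))$, $W_1(\mu,\nu)=\inf_{\pi\in\Pi(\mu,\nu)}\int_{X\times X}\bar d\,d\pi$. *)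

theory Defs
  imports "HOL-Analysis.Analysis"
begin

section \<open>Relative Borel measures\<close>

definition borel_measures :: "'a::topological_space measure set" where
  "borel_measures = {\<mu>. sets \<mu> = sets borel}"

definition measure_add :: "'a::topological_space measure \<Rightarrow> 'a measure \<Rightarrow> 'a measure" where
  "measure_add \<mu> \<nu> = measure_of UNIV (sets borel) (\<lambda>E. emeasure \<mu> E + emeasure \<nu> E)"

text \<open>The Borel measures on a closed set \<open>A\<close>, regarded as a submonoid of the Borel measures on
  the whole space.\<close>

definition concentrated_on :: "'a::topological_space set \<Rightarrow> 'a measure set" where
  "concentrated_on A = {\<sigma> \<in> borel_measures. emeasure \<sigma> (- A) = 0}"

definition rel_eq :: "'a::topological_space set \<Rightarrow> ('a measure \<times> 'a measure) set" where
  "rel_eq A = {(\<mu>, \<nu>). \<mu> \<in> borel_measures \<and> \<nu> \<in> borel_measures \<and>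
     (\<exists>\<sigma>\<in>concentrated_on A. \<exists>\<tau>\<in>concentrated_on A. measure_add \<mu> \<sigma> = measure_add \<nu> \<tau>)}"

text \<open>The quotient monoid. Its elements are equivalence classes; operations are
  lifted as in \<^theory>\<open>HOL.Equiv_Relations\<close>, and quantities that do not depend on the representative
  are extracted with \<^const>\<open>the_elem\<close>.\<close>

definition rel_measures :: "'a::topological_space set \<Rightarrow> 'a measure set set" where
  "rel_measures A = borel_measures // rel_eq A"

definition rel_add :: "'a::topological_space set \<Rightarrow> 'a measure set \<Rightarrow> 'a measure set \<Rightarrow> 'a measure set" where
  "rel_add A M N = (\<Union>\<mu>\<in>M. \<Union>\<nu>\<in>N. rel_eq A `` {measure_add \<mu> \<nu>})"

definition rel_zero :: "'a::topological_space set \<Rightarrow> 'a measure set" where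
  "rel_zero A = rel_eq A `` {null_measure borel}"

text \<open>Pushforward along a map of pairs from \<open>(X, A)\<close> to \<open>(Y, B)\<close>; the argument is the subset \<open>B\<close>
  of the target.\<close>

definition rel_push ::
    "'b::topological_space set \<Rightarrow> ('a::topological_space \<Rightarrow> 'b) \<Rightarrow> 'a measure set \<Rightarrow> 'b measure set" where
  "rel_push B g M = (\<Union>\<mu>\<in>M. rel_eq B `` {distr \<mu> borel g})"

text \<open>Integrals of functions vanishing on \<open>A\<close>, with values in \<open>[0, \<infinity>]\<close> and in the reals.\<close>

definition rel_nn_integral :: "'a::topological_space measure set \<Rightarrow> ('a \<Rightarrow> ennreal) \<Rightarrow> ennreal" where
  "rel_nn_integral M f = the_elem ((\<lambda>\<mu>. \<integral>\<^sup>+x. f x \<partial>\<mu>) ` M)"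

definition rel_integral :: "'a::topological_space measure set \<Rightarrow> ('a \<Rightarrow> real) \<Rightarrow> real" where
  "rel_integral M f = the_elem ((\<lambda>\<mu>. \<integral>x. f x \<partial>\<mu>) ` M)"

text \<open>The value of a class on a Borel set disjoint from \<open>A\<close>.\<close>

definition rel_emeasure :: "'a::topological_space measure set \<Rightarrow> 'a set \<Rightarrow> ennreal" where
  "rel_emeasure M E = the_elem ((\<lambda>\<mu>. emeasure \<mu> E) ` M)"

definition rel_tight :: "'a::topological_space set \<Rightarrow> 'a measure set \<Rightarrow> bool" where
  "rel_tight A M \<longleftrightarrow> (\<forall>E\<in>sets borel. E \<subseteq> - A \<longrightarrow>
     rel_emeasure M E = (SUP K\<in>{K. compact K \<and> K \<subseteq> E}. rel_emeasure M K))"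

definition M1plus :: "'a::metric_space set \<Rightarrow> 'a measure set set" where
  "M1plus A = {M \<in> rel_measures A. rel_tight A M \<and> rel_nn_integral M (\<lambda>x. ennreal (infdist x A)) < \<infinity>}"

section \<open>The Grothendieck group of \<open>M1plus A\<close>\<close>

definition groth_eq ::
    "'a::metric_space set \<Rightarrow> (('a measure set \<times> 'a measure set) \<times> ('a measure set \<times> 'a measure set)) set" where
  "groth_eq A = {((M, N), (M', N')).
     M \<in> M1plus A \<and> N \<in> M1plus A \<and> M' \<in> M1plus A \<and> N' \<in> M1plus A \<and>
     (\<exists>K\<in>M1plus A. rel_add A (rel_add A M N') K = rel_add A (rel_add A M' N) K)}"

definition M1 :: "'a::metric_space set \<Rightarrow> ('a measure set \<times> 'a measure set) set set" where
  "M1 A = (M1plus A \<times> M1plus A) // groth_eq A"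

text \<open>The formal difference \<open>M - N\<close>.\<close>

definition M1_diff ::
    "'a::metric_space set \<Rightarrow> 'a measure set \<Rightarrow> 'a measure set \<Rightarrow> ('a measure set \<times> 'a measure set) set" where
  "M1_diff A M N = groth_eq A `` {(M, N)}"

definition M1_of :: "'a::metric_space set \<Rightarrow> 'a measure set \<Rightarrow> ('a measure set \<times> 'a measure set) set" where
  "M1_of A M = M1_diff A M (rel_zero A)"

definition M1_zero :: "'a::metric_space set \<Rightarrow> ('a measure set \<times> 'a measure set) set" where
  "M1_zero A = M1_of A (rel_zero A)"

definition M1_add ::
    "'a::metric_space set \<Rightarrow> ('a measure set \<times> 'a measure set) set \<Rightarrow> ('a measure set \<times> 'a measure set) set
      \<Rightarrow> ('a measure set \<times> 'a measure set) set" where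
  "M1_add A \<mu> \<nu> = (\<Union>(M, N)\<in>\<mu>. \<Union>(M', N')\<in>\<nu>. M1_diff A (rel_add A M M') (rel_add A N N'))"

text \<open>The vector order with positive cone \<open>M1plus A\<close>.\<close>

definition M1_le ::
    "'a::metric_space set \<Rightarrow> ('a measure set \<times> 'a measure set) set \<Rightarrow> ('a measure set \<times> 'a measure set) set
      \<Rightarrow> bool" where
  "M1_le A \<mu> \<nu> \<longleftrightarrow> (\<exists>M\<in>M1plus A. \<nu> = M1_add A \<mu> (M1_of A M))"

definition is_M1_meet ::
    "'a::metric_space set \<Rightarrow> ('a measure set \<times> 'a measure set) set \<Rightarrow> ('a measure set \<times> 'a measure set) set
      \<Rightarrow> ('a measure set \<times> 'a measure set) set \<Rightarrow> bool" where
  "is_M1_meet A \<mu> \<nu> \<kappa> \<longleftrightarrow> \<kappa> \<in> M1 A \<and> M1_le A \<kappa> \<mu> \<and> M1_le A \<kappa> \<nu> \<and>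
     (\<forall>\<xi>\<in>M1 A. M1_le A \<xi> \<mu> \<and> M1_le A \<xi> \<nu> \<longrightarrow> M1_le A \<xi> \<kappa>)"

text \<open>\<open>is_decomposition A \<mu> M N\<close> states that \<open>M\<close> and \<open>N\<close> are the positive and negative parts
  of \<open>\<mu>\<close>, i.e. the unique pair in \<open>M1plus A\<close> with \<open>\<mu> = M - N\<close> and meet zero.\<close>

definition is_decomposition ::
    "'a::metric_space set \<Rightarrow> ('a measure set \<times> 'a measure set) set \<Rightarrow> 'a measure set \<Rightarrow> 'a measure set
      \<Rightarrow> bool" where
  "is_decomposition A \<mu> M N \<longleftrightarrow> M \<in> M1plus A \<and> N \<in> M1plus A \<and> \<mu> = M1_diff A M N \<and>
     is_M1_meet A (M1_of A M) (M1_of A N) (M1_zero A)"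

section \<open>The Wasserstein distance\<close>

text \<open>The metric on the product pair only enters through its Borel sets, which for \<open>d + d\<close> are those
  of the product topology.\<close>

definition couplings ::
    "'a::metric_space set \<Rightarrow> 'a measure set \<Rightarrow> 'a measure set \<Rightarrow> ('a \<times> 'a) measure set set" where
  "couplings A M N = {P \<in> rel_measures (A \<times> A). rel_push A fst P = M \<and> rel_push A snd P = N}"

definition quot_dist :: "'a::metric_space set \<Rightarrow> 'a \<Rightarrow> 'a \<Rightarrow> real" where
  "quot_dist A x y = min (dist x y) (infdist x A + infdist y A)"

definition W1 :: "'a::metric_space set \<Rightarrow> 'a measure set \<Rightarrow> 'a measure set \<Rightarrow> ennreal" where
  "W1 A M N = (INF P\<in>couplings A M N. rel_nn_integral P (\<lambda>(x, y). ennreal (quot_dist A x y)))"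

section \<open>Lipschitz functions and order continuous functionals\<close>

definition Lip :: "'a::metric_space set \<Rightarrow> ('a \<Rightarrow> real) set" where
  "Lip A = {f. (\<exists>C. C-lipschitz_on UNIV f) \<and> (\<forall>a\<in>A. f a = 0)}"

definition lip_number :: "('a::metric_space \<Rightarrow> real) \<Rightarrow> real" where
  "lip_number f = Inf {C. C-lipschitz_on UNIV f}"

text \<open>Riesz spaces of real functions are represented by their carriers \<open>E\<close>; functionals are functions
  on the whole type of which only the values on \<open>E\<close> matter.\<close>

definition linear_functional_on :: "('a \<Rightarrow> real) set \<Rightarrow> (('a \<Rightarrow> real) \<Rightarrow> real) \<Rightarrow> bool" where
  "linear_functional_on E T \<longleftrightarrow>
     (\<forall>f\<in>E. \<forall>g\<in>E. T (\<lambda>x. f x + g x) = T f + T g) \<and>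
     (\<forall>c. \<forall>f\<in>E. T (\<lambda>x. c * f x) = c * T f)"

definition order_bounded_on :: "('a \<Rightarrow> real) set \<Rightarrow> (('a \<Rightarrow> real) \<Rightarrow> real) \<Rightarrow> bool" where
  "order_bounded_on E T \<longleftrightarrow> (\<forall>g\<in>E. \<forall>h\<in>E. bounded (T ` {f \<in> E. g \<le> f \<and> f \<le> h}))"

text \<open>The infimum is taken in \<open>E\<close>; it need not be the pointwise one.\<close>

definition is_infimum_in :: "('a \<Rightarrow> real) set \<Rightarrow> ('a \<Rightarrow> real) set \<Rightarrow> ('a \<Rightarrow> real) \<Rightarrow> bool" where
  "is_infimum_in E S g \<longleftrightarrow> g \<in> E \<and> (\<forall>f\<in>S. g \<le> f) \<and> (\<forall>h\<in>E. (\<forall>f\<in>S. h \<le> f) \<longrightarrow> h \<le> g)"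

definition order_null_seq :: "('a \<Rightarrow> real) set \<Rightarrow> (nat \<Rightarrow> 'a \<Rightarrow> real) \<Rightarrow> bool" where
  "order_null_seq E f \<longleftrightarrow> range f \<subseteq> E \<and>
     (\<exists>g. range g \<subseteq> E \<and> decseq g \<and> is_infimum_in E (range g) (\<lambda>_. 0) \<and> (\<forall>n. (\<lambda>x. \<bar>f n x\<bar>) \<le> g n))"

definition seq_order_continuous_dual :: "('a \<Rightarrow> real) set \<Rightarrow> (('a \<Rightarrow> real) \<Rightarrow> real) set" where
  "seq_order_continuous_dual E = {T. linear_functional_on E T \<and> order_bounded_on E T \<and>
     (\<forall>f. order_null_seq E f \<longrightarrow> (\<lambda>n. T (f n)) \<longlonglongrightarrow> 0)}"

definition op_norm :: "'a::metric_space set \<Rightarrow> (('a \<Rightarrow> real) \<Rightarrow> real) \<Rightarrow> ennreal" where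
  "op_norm A T = (SUP f\<in>{f \<in> Lip A. lip_number f \<le> 1}. ennreal \<bar>T f\<bar>)"

end

theory Submission
  imports Defs
begin

text \<open>Infima in \<open>Lip A\<close> are not pointwise: a decreasing sequence of nonnegative functions that
  vanishes in the limit on a dense set has infimum \<open>0\<close>. Order continuity of \<open>T\<close> therefore forces
  \<open>T f = (\<Sum>x. c x * f x)\<close>, where \<open>x\<close> ranges over the isolated points outside \<open>A\<close> and
  \<open>c x = T (indicator {x})\<close>; order boundedness gives \<open>(\<Sum>x. \<bar>c x\<bar> * infdist x A) < \<infinity>\<close>.
  The positive and negative parts of \<open>c\<close> are the two measures.

  A coupling bounds the operator norm by integration. Conversely, finite Kantorovich duality
  for \<open>quot_dist\<close> on a finite set of isolated points together with one point \<open>a0\<close> of \<open>A\<close> gives a plan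
  that is optimal there, and sending the remaining mass to \<open>a0\<close> costs at most the tail of the series.\<close>

section \<open>Relative measures as measures off the subset\<close>

text \<open>\<open>T\<close> is not positive, so a bump at a non-isolated point with small
  \<open>T\<close> value is of no use: after truncation against \<open>f\<close>, only domination by
  the bump is known. The bumps are therefore controlled by the modulus of \<open>T\<close>, whose
  finiteness is order boundedness. Their moduli can be kept below a geometric series, which makes
  all non-isolated points of a dense sequence negligible at once. On the measure side the obstacle
  is infinite mass: a finite first moment permits infinite measure near \<open>A\<close>, so neither
  subtraction of measures nor cancellation in the Grothendieck group is available directly.
  Cancellation is done on sets at positive distance from \<open>A\<close>, where masses are finite,
  and subtraction after multiplying by \<open>infdist x A\<close>, which makes the measures finite.
  The two measures need not have equal mass off \<open>A\<close>. The point \<open>a0\<close>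
  absorbs the difference: marginals are prescribed only modulo measures on \<open>A\<close>, and the
  distance to \<open>A\<close> is exactly what \<open>quot_dist\<close> charges for such a
  move.\<close>

lemma mem_borel_measures: "\<mu> \<in> borel_measures \<longleftrightarrow> sets \<mu> = sets borel"
  by (simp add: borel_measures_def)

lemma space_borel_measures: "\<mu> \<in> borel_measures \<Longrightarrow> space \<mu> = UNIV"
  by (metis mem_borel_measures sets_eq_imp_space_eq space_borel)

lemma distr_borel_measures [simp]: "distr \<mu> borel g \<in> borel_measures"
  by (simp add: mem_borel_measures)

lemma sets_measure_add [simp, measurable_cong]: "sets (measure_add \<mu> \<nu>) = sets borel"
  unfolding measure_add_def
  by (metis sets.sigma_sets_eq sets.space_closed sets_measure_of space_borel)

lemma measure_add_borel [simp]: "measure_add \<mu> \<nu> \<in> borel_measures"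
  by (simp add: mem_borel_measures)

lemma emeasure_measure_add:
  assumes "\<mu> \<in> borel_measures" "\<nu> \<in> borel_measures" "E \<in> sets borel"
  shows "emeasure (measure_add \<mu> \<nu>) E = emeasure \<mu> E + emeasure \<nu> E"
  unfolding measure_add_def
proof (rule emeasure_measure_of_sigma)
  show "sigma_algebra UNIV (sets (borel :: 'a measure))"
    by (metis sets.sigma_algebra_axioms space_borel)
  show "positive (sets borel) (\<lambda>E. emeasure \<mu> E + emeasure \<nu> E)"
    by (simp add: positive_def)
  show "countably_additive (sets borel) (\<lambda>E. emeasure \<mu> E + emeasure \<nu> E)"
  proof (rule countably_additiveI)
    fix F :: "nat \<Rightarrow> 'a set"
    assume F: "range F \<subseteq> sets borel" "disjoint_family F" "\<Union> (range F) \<in> sets borel"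
    have "(\<Sum>i. emeasure \<mu> (F i) + emeasure \<nu> (F i)) = (\<Sum>i. emeasure \<mu> (F i)) + (\<Sum>i. emeasure \<nu> (F i))"
      by (intro suminf_add[symmetric]) auto
    then show "(\<Sum>i. emeasure \<mu> (F i) + emeasure \<nu> (F i)) = emeasure \<mu> (\<Union> (range F)) + emeasure \<nu> (\<Union> (range F))"
      using assms F by (simp add: suminf_emeasure mem_borel_measures)
  qed
qed (use assms in auto)

lemma nn_integral_measure_add:
  assumes \<mu>: "\<mu> \<in> borel_measures" and \<nu>: "\<nu> \<in> borel_measures" and f: "f \<in> borel_measurable borel"
  shows "(\<integral>\<^sup>+x. f x \<partial>measure_add \<mu> \<nu>) = (\<integral>\<^sup>+x. f x \<partial>\<mu>) + (\<integral>\<^sup>+x. f x \<partial>\<nu>)"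
  using f
proof (induction rule: borel_measurable_induct)
  have [measurable_cong]: "sets \<mu> = sets borel" "sets \<nu> = sets borel"
    using \<mu> \<nu> by (auto simp: mem_borel_measures)
  {
    case (cong f g)
    then show ?case by (auto simp: space_borel_measures[OF \<mu>] space_borel_measures[OF \<nu>] 
          space_borel_measures[OF measure_add_borel] cong: nn_integral_cong_simp)
  next
    case (set A)
    then show ?case
      using \<mu> \<nu> by (simp add: emeasure_measure_add mem_borel_measures)
  next
    case (mult u c)
    then show ?case
      by (simp add: nn_integral_cmult distrib_left)
  next
    case (add u v)
    then show ?case
      by (simp add: nn_integral_add algebra_simps)
  next
    case (seq U)
    have mu: "incseq (\<lambda>i. \<integral>\<^sup>+x. U i x \<partial>\<mu>)" "incseq (\<lambda>i. \<integral>\<^sup>+x. U i x \<partial>\<nu>)"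
      using seq(3) by (auto simp: incseq_def le_fun_def intro!: nn_integral_mono)
    have "(\<integral>\<^sup>+x. (SUP i. U i) x \<partial>\<rho>) = (SUP i. \<integral>\<^sup>+x. U i x \<partial>\<rho>)"
      if [measurable_cong]: "sets \<rho> = sets borel" for \<rho> :: "'a measure"
      unfolding SUP_apply using seq(1,3) by (intro nn_integral_monotone_convergence_SUP) (auto simp: measurable_def)
    with mu seq show ?case
      by (simp add: ennreal_SUP_add mem_borel_measures \<open>sets \<mu> = _\<close> \<open>sets \<nu> = _\<close>)
  }
qed

text \<open>The canonical representative of a class: erasing the mass on \<open>A\<close> leaves
  exactly the information that the quotient retains, so equality of classes becomes equality of
  measures.\<close>

definition off :: "'a::topological_space set \<Rightarrow> 'a measure \<Rightarrow> 'a measure" where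
  "off A \<mu> = density \<mu> (indicator (- A))"

lemma sets_off [simp, measurable_cong]: "sets (off A \<mu>) = sets \<mu>"
  by (simp add: off_def)

lemma emeasure_off:
  assumes "closed A" "\<mu> \<in> borel_measures" "E \<in> sets borel"
  shows "emeasure (off A \<mu>) E = emeasure \<mu> (E - A)"
proof -
  have "emeasure (off A \<mu>) E = (\<integral>\<^sup>+x. indicator (- A) x * indicator E x \<partial>\<mu>)"
    unfolding off_def using assms by (intro emeasure_density) (auto simp: mem_borel_measures)
  also have "\<dots> = (\<integral>\<^sup>+x. indicator (E - A) x \<partial>\<mu>)"
    by (intro nn_integral_cong) (auto split: split_indicator)
  finally show ?thesis
    using assms by (simp add: mem_borel_measures)
qed

lemma off_eq_iff:
  assumes "closed A" "\<mu> \<in> borel_measures" "\<nu> \<in> borel_measures"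
  shows "off A \<mu> = off A \<nu> \<longleftrightarrow> (\<forall>E\<in>sets borel. E \<subseteq> - A \<longrightarrow> emeasure \<mu> E = emeasure \<nu> E)"
proof safe
  fix E assume "off A \<mu> = off A \<nu>" "E \<in> sets borel" "E \<subseteq> - A"
  then show "emeasure \<mu> E = emeasure \<nu> E"
    using emeasure_off[of A _ E] assms by (metis Diff_triv inf_shunt double_compl)
next
  assume H: "\<forall>E\<in>sets borel. E \<subseteq> - A \<longrightarrow> emeasure \<mu> E = emeasure \<nu> E"
  show "off A \<mu> = off A \<nu>"
  proof (rule measure_eqI)
    fix E assume "E \<in> sets (off A \<mu>)"
    then have E: "E \<in> sets borel" using assms by (simp add: mem_borel_measures)
    then have "E - A \<in> sets borel" using assms by auto
    then have "emeasure \<mu> (E - A) = emeasure \<nu> (E - A)" using H by blast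
    with E show "emeasure (off A \<mu>) E = emeasure (off A \<nu>) E"
      using assms by (simp add: emeasure_off)
  qed (use assms in \<open>simp add: mem_borel_measures\<close>)
qed

text \<open>Summands concentrated on \<open>A\<close> are invisible to Borel sets off
  \<open>A\<close>. For the converse no subtraction is possible, as masses may be infinite; each
  measure instead receives the part of the other one on \<open>A\<close>.\<close>

lemma rel_eq_iff:
  assumes A: "closed A"
  shows "(\<mu>, \<nu>) \<in> rel_eq A \<longleftrightarrow> \<mu> \<in> borel_measures \<and> \<nu> \<in> borel_measures \<and> off A \<mu> = off A \<nu>"
proof safe
  assume R: "(\<mu>, \<nu>) \<in> rel_eq A"
  then show B: "\<mu> \<in> borel_measures" "\<nu> \<in> borel_measures"
    by (auto simp: rel_eq_def)
  from R obtain \<sigma> \<tau> where st: "\<sigma> \<in> concentrated_on A" "\<tau> \<in> concentrated_on A"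
      "measure_add \<mu> \<sigma> = measure_add \<nu> \<tau>"
    by (auto simp: rel_eq_def)
  have null: "emeasure \<rho> E = 0" if "\<rho> \<in> concentrated_on A" "E \<in> sets borel" "E \<subseteq> - A" for \<rho> E
    using that A emeasure_mono[of E "- A" \<rho>]
    by (auto simp: concentrated_on_def mem_borel_measures)
  show "off A \<mu> = off A \<nu>"
    unfolding off_eq_iff[OF A B]
  proof safe
    fix E assume E: "E \<in> sets borel" "E \<subseteq> - A"
    have "emeasure (measure_add \<mu> \<sigma>) E = emeasure (measure_add \<nu> \<tau>) E" using st by simp
    then show "emeasure \<mu> E = emeasure \<nu> E"
      using st(1,2) B null[OF st(1) E] null[OF st(2) E]
      by (simp add: emeasure_measure_add E(1) concentrated_on_def)
  qed
next
  assume B: "\<mu> \<in> borel_measures" "\<nu> \<in> borel_measures" and eq: "off A \<mu> = off A \<nu>"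
  \<comment> \<open>The part of a measure on \<open>A\<close>, obtained by erasing the complement.
    The complement need not be closed, so \<open>emeasure_off\<close> does not apply and the formula
    is derived separately.\<close>
  define on where "on \<rho> = off (- A) \<rho>" for \<rho> :: "'a measure"
  have on: "on \<rho> \<in> borel_measures" "emeasure (on \<rho>) E = emeasure \<rho> (E \<inter> A)"
    if "\<rho> \<in> borel_measures" "E \<in> sets borel" for \<rho> E
  proof -
    show "on \<rho> \<in> borel_measures" using that by (simp add: mem_borel_measures on_def)
    have "emeasure (on \<rho>) E = (\<integral>\<^sup>+x. indicator A x * indicator E x \<partial>\<rho>)"
    proof -
      have "A \<in> sets \<rho>" using that A by (simp add: mem_borel_measures)
      then have "(indicator A :: 'a \<Rightarrow> ennreal) \<in> borel_measurable \<rho>" by (rule borel_measurable_indicator)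
      then show ?thesis
        unfolding off_def on_def using that by (simp add: emeasure_density mem_borel_measures)
    qed
    also have "\<dots> = (\<integral>\<^sup>+x. indicator (E \<inter> A) x \<partial>\<rho>)"
      by (intro nn_integral_cong) (auto split: split_indicator)
    finally show "emeasure (on \<rho>) E = emeasure \<rho> (E \<inter> A)"
      using that A by (simp add: mem_borel_measures)
  qed
  have c: "on \<rho> \<in> concentrated_on A" if "\<rho> \<in> borel_measures" for \<rho>
    using on[OF that, of "- A"] A by (simp add: concentrated_on_def)
  have split: "emeasure \<rho> E = emeasure \<rho> (E - A) + emeasure \<rho> (E \<inter> A)"
    if "\<rho> \<in> borel_measures" "E \<in> sets borel" for \<rho> E
  proof -
    have "emeasure \<rho> (E - A) + emeasure \<rho> (E \<inter> A) = emeasure \<rho> ((E - A) \<union> (E \<inter> A))"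
      using that A by (intro plus_emeasure) (auto simp: mem_borel_measures)
    then show ?thesis by (simp add: Un_Diff_Int)
  qed
  \<comment> \<open>Both sides are the common part off \<open>A\<close> plus the two parts on
    \<open>A\<close>.\<close>
  have "measure_add \<mu> (on \<nu>) = measure_add \<nu> (on \<mu>)"
  proof (rule measure_eqI)
    fix E assume "E \<in> sets (measure_add \<mu> (on \<nu>))"
    then have E: "E \<in> sets borel" by simp
    have "emeasure \<mu> (E - A) = emeasure \<nu> (E - A)"
      using eq emeasure_off[OF A _ E] B by metis
    then show "emeasure (measure_add \<mu> (on \<nu>)) E = emeasure (measure_add \<nu> (on \<mu>)) E"
      using B E on split[of \<mu> E] split[of \<nu> E] by (simp add: emeasure_measure_add algebra_simps)
  qed simp
  then show "(\<mu>, \<nu>) \<in> rel_eq A"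
    using B c by (auto simp: rel_eq_def)
qed

lemma equiv_rel_eq: "closed A \<Longrightarrow> equiv borel_measures (rel_eq A)"
  by (rule equivI) (auto intro!: refl_onI symI transI simp: rel_eq_iff)

abbreviation rel_class :: "'a::topological_space set \<Rightarrow> 'a measure \<Rightarrow> 'a measure set" where
  "rel_class A \<mu> \<equiv> rel_eq A `` {\<mu>}"

lemma rel_class_eq_iff:
  assumes "closed A" "\<mu> \<in> borel_measures" "\<nu> \<in> borel_measures"
  shows "rel_class A \<mu> = rel_class A \<nu> \<longleftrightarrow> (\<forall>E\<in>sets borel. E \<subseteq> - A \<longrightarrow> emeasure \<mu> E = emeasure \<nu> E)"
  using assms by (simp add: eq_equiv_class_iff[OF equiv_rel_eq] rel_eq_iff off_eq_iff)

section \<open>Evaluating quotient quantities on representatives\<close>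

lemma rel_measures_cases:
  assumes "M \<in> rel_measures A"
  obtains \<mu> where "\<mu> \<in> borel_measures" "M = rel_class A \<mu>"
  using assms by (auto simp: rel_measures_def elim!: quotientE)

lemma rel_class_in_rel_measures: "\<mu> \<in> borel_measures \<Longrightarrow> rel_class A \<mu> \<in> rel_measures A"
  by (auto simp: rel_measures_def intro: quotientI)

text \<open>This is what gives \<open>the_elem\<close> its meaning in every quotient quantity: a
  function of the part off \<open>A\<close> has a singleton image on a class.\<close>

lemma the_elem_rel_class:
  assumes "closed A" "\<mu> \<in> borel_measures"
    and "\<And>\<nu>. \<nu> \<in> borel_measures \<Longrightarrow> off A \<nu> = off A \<mu> \<Longrightarrow> g \<nu> = g \<mu>"
  shows "the_elem (g ` rel_class A \<mu>) = g \<mu>"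
proof -
  have "g ` rel_class A \<mu> = {g \<mu>}"
  proof -
    have "\<mu> \<in> rel_class A \<mu>" using assms by (auto simp: rel_eq_iff)
    moreover have "g \<nu> = g \<mu>" if "\<nu> \<in> rel_class A \<mu>" for \<nu>
      using that assms(1) by (intro assms(3)) (auto simp: rel_eq_iff)
    ultimately show ?thesis by blast
  qed
  then show ?thesis by simp
qed

lemma nn_integral_off:
  assumes "closed A" "\<mu> \<in> borel_measures" "f \<in> borel_measurable borel" "\<And>x. x \<in> A \<Longrightarrow> f x = 0"
  shows "(\<integral>\<^sup>+x. f x \<partial>off A \<mu>) = (\<integral>\<^sup>+x. f x \<partial>\<mu>)"
proof -
  have [measurable_cong]: "sets \<mu> = sets borel" using assms by (simp add: mem_borel_measures)
  have "(\<integral>\<^sup>+x. f x \<partial>off A \<mu>) = (\<integral>\<^sup>+x. indicator (- A) x * f x \<partial>\<mu>)"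
    unfolding off_def using assms by (intro nn_integral_density) auto
  also have "\<dots> = (\<integral>\<^sup>+x. f x \<partial>\<mu>)"
    using assms(4) by (intro nn_integral_cong) (auto split: split_indicator)
  finally show ?thesis .
qed

lemma integral_off:
  fixes f :: "'a::topological_space \<Rightarrow> real"
  assumes "closed A" "\<mu> \<in> borel_measures" "f \<in> borel_measurable borel" "\<And>x. x \<in> A \<Longrightarrow> f x = 0"
  shows "(\<integral>x. f x \<partial>off A \<mu>) = (\<integral>x. f x \<partial>\<mu>)"
proof -
  have [measurable_cong]: "sets \<mu> = sets borel" using assms by (simp add: mem_borel_measures)
  have "off A \<mu> = density \<mu> (\<lambda>x. ennreal (indicator (- A) x))"
    by (simp add: off_def ennreal_indicator)
  then have "(\<integral>x. f x \<partial>off A \<mu>) = (\<integral>x. indicator (- A) x *\<^sub>R f x \<partial>\<mu>)"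
    using assms by (simp add: integral_density)
  also have "\<dots> = (\<integral>x. f x \<partial>\<mu>)"
    using assms(4) by (intro Bochner_Integration.integral_cong) (auto split: split_indicator)
  finally show ?thesis .
qed

lemma rel_nn_integral_class:
  assumes "closed A" "\<mu> \<in> borel_measures" "f \<in> borel_measurable borel" "\<And>x. x \<in> A \<Longrightarrow> f x = 0"
  shows "rel_nn_integral (rel_class A \<mu>) f = (\<integral>\<^sup>+x. f x \<partial>\<mu>)"
  unfolding rel_nn_integral_def
  by (rule the_elem_rel_class) (use assms nn_integral_off[of A _ f] in metis)+

lemma rel_integral_class:
  assumes "closed A" "\<mu> \<in> borel_measures" "f \<in> borel_measurable borel" "\<And>x. x \<in> A \<Longrightarrow> f x = 0"
  shows "rel_integral (rel_class A \<mu>) f = (\<integral>x. f x \<partial>\<mu>)"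
  unfolding rel_integral_def
  by (rule the_elem_rel_class) (use assms integral_off[of A _ f] in metis)+

lemma rel_emeasure_class:
  assumes "closed A" "\<mu> \<in> borel_measures" "E \<in> sets borel" "E \<subseteq> - A"
  shows "rel_emeasure (rel_class A \<mu>) E = emeasure \<mu> E"
  unfolding rel_emeasure_def
  by (rule the_elem_rel_class) (use assms in \<open>auto simp: off_eq_iff\<close>)

lemma rel_add_class:
  assumes "closed A" "\<mu> \<in> borel_measures" "\<nu> \<in> borel_measures"
  shows "rel_add A (rel_class A \<mu>) (rel_class A \<nu>) = rel_class A (measure_add \<mu> \<nu>)"
proof -
  have "rel_class A (measure_add \<mu>' \<nu>') = rel_class A (measure_add \<mu> \<nu>)"
    if "\<mu>' \<in> rel_class A \<mu>" "\<nu>' \<in> rel_class A \<nu>" for \<mu>' \<nu>'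
  proof -
    have "\<mu>' \<in> borel_measures" "\<nu>' \<in> borel_measures" "off A \<mu> = off A \<mu>'" "off A \<nu> = off A \<nu>'"
      using that assms by (auto simp: rel_eq_iff)
    then show ?thesis
      using assms by (simp add: rel_class_eq_iff off_eq_iff emeasure_measure_add)
  qed
  moreover have "\<mu> \<in> rel_class A \<mu>" "\<nu> \<in> rel_class A \<nu>"
    using assms by (auto simp: rel_eq_iff)
  ultimately show ?thesis
    unfolding rel_add_def by blast
qed

text \<open>Since \<open>g\<close> maps \<open>A\<close> into \<open>B\<close>, the preimage of a
  set off \<open>B\<close> lies off \<open>A\<close>, where all representatives agree.\<close>

lemma rel_push_class:
  fixes g :: "'a::topological_space \<Rightarrow> 'b::topological_space"
  assumes "closed A" "closed B" "\<mu> \<in> borel_measures" "g \<in> borel_measurable borel" "g ` A \<subseteq> B"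
  shows "rel_push B g (rel_class A \<mu>) = rel_class B (distr \<mu> borel g)"
proof -
  have "rel_class B (distr \<mu>' borel g) = rel_class B (distr \<mu> borel g)"
    if "\<mu>' \<in> rel_class A \<mu>" for \<mu>'
  proof -
    have m: "\<mu>' \<in> borel_measures" "off A \<mu> = off A \<mu>'"
      using that assms by (auto simp: rel_eq_iff)
    have meas: "g \<in> measurable \<rho> borel" if "\<rho> \<in> borel_measures" for \<rho>
      using assms(4) that measurable_cong_sets[of \<rho> borel] by (simp add: mem_borel_measures)
    have "emeasure (distr \<mu>' borel g) E = emeasure (distr \<mu> borel g) E"
      if E: "E \<in> sets borel" "E \<subseteq> - B" for E
    proof -
      have "g -` E \<in> sets borel" 
        using measurable_sets[OF assms(4) E(1)] by simp
      moreover have "g -` E \<subseteq> - A" using assms(5) E by auto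
      ultimately have "emeasure \<mu> (g -` E) = emeasure \<mu>' (g -` E)"
        using m assms off_eq_iff[of A \<mu> \<mu>'] by auto
      then show ?thesis
        using E meas m(1) assms(3) by (simp add: emeasure_distr space_borel_measures)
    qed
    then show ?thesis
      using m assms by (simp add: rel_class_eq_iff mem_borel_measures)
  qed
  moreover have "\<mu> \<in> rel_class A \<mu>"
    using assms by (auto simp: rel_eq_iff)
  ultimately show ?thesis
    unfolding rel_push_def by blast
qed

section \<open>Measures of finite first moment\<close>

lemma infdist_borel_measurable [measurable]: "(\<lambda>x. infdist x A) \<in> borel_measurable borel"
  by (intro borel_measurable_continuous_onI continuous_intros)

lemma infdist_pos: "closed A \<Longrightarrow> A \<noteq> {} \<Longrightarrow> x \<notin> A \<Longrightarrow> 0 < infdist x A"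
  using in_closed_iff_infdist_zero[of A x] infdist_nonneg[of x A] by linarith

abbreviation moment :: "'a::metric_space set \<Rightarrow> 'a measure \<Rightarrow> ennreal" where
  "moment A \<mu> \<equiv> \<integral>\<^sup>+x. ennreal (infdist x A) \<partial>\<mu>"

text \<open>Markov's inequality with threshold \<open>e\<close>. It supplies finiteness at positive
  distance from \<open>A\<close>, where summands can be cancelled.\<close>

lemma emeasure_away_finite:
  assumes "\<mu> \<in> borel_measures" "moment A \<mu> < \<infinity>" "e > 0" "\<And>x. x \<in> E \<Longrightarrow> e \<le> infdist x A" "E \<in> sets borel"
  shows "emeasure \<mu> E < \<infinity>"
proof -
  have "ennreal e * emeasure \<mu> E = (\<integral>\<^sup>+x. ennreal e * indicator E x \<partial>\<mu>)"
    using assms by (simp add: nn_integral_cmult_indicator mem_borel_measures)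
  also have "\<dots> \<le> moment A \<mu>"
    using assms(4) by (intro nn_integral_mono) (auto split: split_indicator intro: ennreal_leI)
  finally have "ennreal e * emeasure \<mu> E < \<infinity>" using assms(2) by auto
  then show ?thesis
    using assms(3) by (auto simp: ennreal_mult_less_top)
qed

text \<open>Continuity from below: as \<open>A\<close> is closed, every point off \<open>A\<close>
  has positive distance to \<open>A\<close>, so the thresholds \<open>1 / Suc n\<close> exhaust
  \<open>E\<close>.\<close>

lemma emeasure_eq_SUP_away:
  assumes "closed A" "A \<noteq> {}" "\<mu> \<in> borel_measures" "E \<in> sets borel" "E \<subseteq> - A"
  shows "emeasure \<mu> E = (SUP n. emeasure \<mu> (E \<inter> {x. 1 / Suc n \<le> infdist x A}))"
proof -
  define F where "F n = E \<inter> {x. 1 / Suc n \<le> infdist x A}" for n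
  have "E = (\<Union>n. F n)"
  proof (intro equalityI subsetI)
    fix x assume x: "x \<in> E"
    then obtain n where "1 / Suc n < infdist x A"
      using infdist_pos[OF assms(1,2)] assms(5) nat_approx_posE[of "infdist x A"] by auto
    with x show "x \<in> (\<Union>n. F n)" by (auto simp: F_def intro!: exI[of _ n])
  qed (auto simp: F_def)
  moreover have "incseq F"
  proof (rule incseq_SucI)
    fix n
    have "1 / real (Suc (Suc n)) \<le> 1 / real (Suc n)" by (simp add: field_simps)
    then show "F n \<le> F (Suc n)" unfolding F_def by (auto simp del: of_nat_Suc)
  qed
  moreover have "range F \<subseteq> sets \<mu>"
    using assms by (auto simp: F_def mem_borel_measures)
  ultimately show ?thesis
    using SUP_emeasure_incseq[of F \<mu>] by (simp add: F_def)
qed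

text \<open>Lets an inequality between measures be verified only where a first moment guarantees
  finite mass.\<close>

lemma emeasure_le_from_away:
  assumes "closed A" "A \<noteq> {}" "\<mu> \<in> borel_measures" "\<nu> \<in> borel_measures"
    and away: "\<And>e E. e > 0 \<Longrightarrow> E \<in> sets borel \<Longrightarrow> (\<And>x. x \<in> E \<Longrightarrow> e \<le> infdist x A) \<Longrightarrow> emeasure \<mu> E \<le> emeasure \<nu> E"
    and E: "E \<in> sets borel" "E \<subseteq> - A"
  shows "emeasure \<mu> E \<le> emeasure \<nu> E"
  unfolding emeasure_eq_SUP_away[OF assms(1-3) E] emeasure_eq_SUP_away[OF assms(1,2,4) E]
proof (rule SUP_mono)
  fix n :: nat
  have "emeasure \<mu> (E \<inter> {x. 1 / Suc n \<le> infdist x A}) \<le> emeasure \<nu> (E \<inter> {x. 1 / Suc n \<le> infdist x A})"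
    by (rule away[of "1 / Suc n"]) (use E in auto)
  then show "\<exists>m\<in>UNIV. emeasure \<mu> (E \<inter> {x. 1 / Suc n \<le> infdist x A}) \<le> emeasure \<nu> (E \<inter> {x. 1 / Suc m \<le> infdist x A})"
    by blast
qed

text \<open>Finite Borel measures on a Polish space are inner regular. This applies to the
  restriction of \<open>\<mu>\<close> to points at distance at least \<open>1 / Suc n\<close> from
  \<open>A\<close>, and the supremum over \<open>n\<close> recovers \<open>E\<close>.\<close>

lemma rel_tight_class:
  fixes A :: "'a::polish_space set"
  assumes "closed A" "A \<noteq> {}" "\<mu> \<in> borel_measures" "moment A \<mu> < \<infinity>"
  shows "rel_tight A (rel_class A \<mu>)"
  unfolding rel_tight_def
proof safe
  fix E :: "'a set" assume E: "E \<in> sets borel" "E \<subseteq> - A"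
  note [measurable_cong] = assms(3)[unfolded mem_borel_measures]
  have K: "rel_emeasure (rel_class A \<mu>) K = emeasure \<mu> K" if "compact K" "K \<subseteq> E" for K
    using that assms E by (intro rel_emeasure_class) (auto intro: borel_compact)
  have "emeasure \<mu> E = (SUP K\<in>{K. compact K \<and> K \<subseteq> E}. emeasure \<mu> K)"
  proof (rule antisym)
    show "emeasure \<mu> E \<le> (SUP K\<in>{K. compact K \<and> K \<subseteq> E}. emeasure \<mu> K)"
      unfolding emeasure_eq_SUP_away[OF assms(1-3) E]
    proof (rule SUP_least)
      fix n
      define F where "F = {x. 1 / Suc n \<le> infdist x A}"
      have [measurable]: "F \<in> sets borel" "E \<in> sets borel" using E by (auto simp: F_def)
      define \<nu> where "\<nu> = density \<mu> (indicator F)"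
      have s: "sets \<nu> = sets borel" by (simp add: \<nu>_def assms(3)[unfolded mem_borel_measures])
      have \<nu>: "emeasure \<nu> B = emeasure \<mu> (F \<inter> B)" if [measurable]: "B \<in> sets borel" for B
      proof -
        have "emeasure \<nu> B = (\<integral>\<^sup>+x. indicator F x * indicator B x \<partial>\<mu>)"
          unfolding \<nu>_def by (intro emeasure_density) measurable
        also have "\<dots> = (\<integral>\<^sup>+x. indicator (F \<inter> B) x \<partial>\<mu>)"
          by (intro nn_integral_cong) (auto split: split_indicator)
        finally show ?thesis by simp
      qed
      have "emeasure \<mu> F < \<infinity>"
        using assms by (intro emeasure_away_finite[of \<mu> A "1 / Suc n"]) (auto simp: F_def)
      then have fin: "emeasure \<nu> (space \<nu>) \<noteq> \<infinity>"
        using \<nu>[of UNIV] sets_eq_imp_space_eq[OF s] by simp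
      have "emeasure \<mu> (E \<inter> F) = emeasure \<nu> (E \<inter> F)"
        by (simp add: \<nu> Int_commute Int_left_commute)
      also have "\<dots> = (SUP K\<in>{K. K \<subseteq> E \<inter> F \<and> compact K}. emeasure \<nu> K)"
        by (rule inner_regular[OF s fin]) measurable
      also have "\<dots> \<le> (SUP K\<in>{K. compact K \<and> K \<subseteq> E}. emeasure \<mu> K)"
      proof (rule SUP_mono)
        fix K assume K: "K \<in> {K. K \<subseteq> E \<inter> F \<and> compact K}"
        then have "F \<inter> K = K" by blast
        then have "emeasure \<nu> K \<le> emeasure \<mu> K" using K \<nu>[of K] borel_compact[of K] by simp
        with K show "\<exists>L\<in>{K. compact K \<and> K \<subseteq> E}. emeasure \<nu> K \<le> emeasure \<mu> L" by blast
      qed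
      finally show "emeasure \<mu> (E \<inter> {x. 1 / Suc n \<le> infdist x A}) \<le> (SUP K\<in>{K. compact K \<and> K \<subseteq> E}. emeasure \<mu> K)"
        by (simp add: F_def)
    qed
  qed (use E assms(3) in \<open>auto intro!: SUP_least emeasure_mono simp: mem_borel_measures\<close>)
  moreover have "(SUP K\<in>{K. compact K \<and> K \<subseteq> E}. rel_emeasure (rel_class A \<mu>) K) = (SUP K\<in>{K. compact K \<and> K \<subseteq> E}. emeasure \<mu> K)"
    using K by (intro SUP_cong) auto
  ultimately show "rel_emeasure (rel_class A \<mu>) E = (SUP K\<in>{K. compact K \<and> K \<subseteq> E}. rel_emeasure (rel_class A \<mu>) K)"
    using rel_emeasure_class[OF assms(1,3) E] by simp
qed

lemma M1plus_class_iff: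
  fixes A :: "'a::polish_space set"
  assumes "closed A" "A \<noteq> {}" "\<mu> \<in> borel_measures"
  shows "rel_class A \<mu> \<in> M1plus A \<longleftrightarrow> moment A \<mu> < \<infinity>"
proof -
  have "rel_nn_integral (rel_class A \<mu>) (\<lambda>x. ennreal (infdist x A)) = moment A \<mu>"
    using assms by (intro rel_nn_integral_class) auto
  then show ?thesis
    using rel_tight_class[OF assms] rel_class_in_rel_measures[OF assms(3)] by (auto simp: M1plus_def)
qed

lemma M1plus_cases:
  fixes A :: "'a::polish_space set"
  assumes "closed A" "A \<noteq> {}" "M \<in> M1plus A"
  obtains \<mu> where "\<mu> \<in> borel_measures" "moment A \<mu> < \<infinity>" "M = rel_class A \<mu>"
proof -
  have "M \<in> rel_measures A" using assms(3) by (simp add: M1plus_def)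
  then obtain \<mu> where "\<mu> \<in> borel_measures" "M = rel_class A \<mu>" by (rule rel_measures_cases)
  then show ?thesis using M1plus_class_iff[OF assms(1,2), of \<mu>] assms(3) that by blast
qed

lemma rel_zero_M1plus:
  fixes A :: "'a::polish_space set"
  assumes "closed A" "A \<noteq> {}"
  shows "rel_zero A \<in> M1plus A"
  unfolding rel_zero_def using assms by (subst M1plus_class_iff) (auto simp: mem_borel_measures)

lemma rel_add_M1plus:
  fixes A :: "'a::polish_space set"
  assumes "closed A" "A \<noteq> {}" "M \<in> M1plus A" "N \<in> M1plus A"
  shows "rel_add A M N \<in> M1plus A"
proof -
  obtain \<mu> where \<mu>: "\<mu> \<in> borel_measures" "moment A \<mu> < \<infinity>" "M = rel_class A \<mu>"
    using M1plus_cases[OF assms(1-3)] by blast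
  obtain \<nu> where \<nu>: "\<nu> \<in> borel_measures" "moment A \<nu> < \<infinity>" "N = rel_class A \<nu>"
    using M1plus_cases[OF assms(1,2,4)] by blast
  show ?thesis
    using assms \<mu> \<nu> by (simp add: rel_add_class M1plus_class_iff nn_integral_measure_add)
qed

section \<open>The Grothendieck group and its order\<close>

lemma measure_add_commute: "measure_add \<mu> \<nu> = measure_add \<nu> \<mu>"
  by (simp add: measure_add_def add.commute)

lemma measure_add_assoc:
  assumes "\<mu> \<in> borel_measures" "\<nu> \<in> borel_measures" "\<rho> \<in> borel_measures"
  shows "measure_add (measure_add \<mu> \<nu>) \<rho> = measure_add \<mu> (measure_add \<nu> \<rho>)"
  using assms by (intro measure_eqI) (auto simp: emeasure_measure_add add.assoc)

lemma measure_add_null: "\<mu> \<in> borel_measures \<Longrightarrow> measure_add \<mu> (null_measure borel) = \<mu>"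
  by (intro measure_eqI) (auto simp: emeasure_measure_add mem_borel_measures)

context
  fixes A :: "'a::polish_space set"
  assumes A: "closed A" "A \<noteq> {}"
begin

lemma rel_add_commute:
  assumes "M \<in> M1plus A" "N \<in> M1plus A"
  shows "rel_add A M N = rel_add A N M"
  by (rule M1plus_cases[OF A assms(1)], rule M1plus_cases[OF A assms(2)])
    (simp add: rel_add_class[OF A(1)] measure_add_commute)

lemma rel_add_assoc:
  assumes "M \<in> M1plus A" "N \<in> M1plus A" "K \<in> M1plus A"
  shows "rel_add A (rel_add A M N) K = rel_add A M (rel_add A N K)"
  by (rule M1plus_cases[OF A assms(1)], rule M1plus_cases[OF A assms(2)], rule M1plus_cases[OF A assms(3)])
    (simp add: rel_add_class[OF A(1)] measure_add_assoc)

lemma rel_add_zero: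
  assumes "M \<in> M1plus A"
  shows "rel_add A M (rel_zero A) = M" "rel_add A (rel_zero A) M = M"
proof -
  have n: "null_measure borel \<in> borel_measures" by (simp add: mem_borel_measures)
  show "rel_add A M (rel_zero A) = M"
    by (rule M1plus_cases[OF A assms]) (simp add: rel_zero_def rel_add_class[OF A(1)] measure_add_null n)
  then show "rel_add A (rel_zero A) M = M"
    by (metis rel_add_commute assms rel_zero_M1plus A)
qed

lemma rel_add_left_commute:
  assumes "M \<in> M1plus A" "N \<in> M1plus A" "K \<in> M1plus A"
  shows "rel_add A M (rel_add A N K) = rel_add A N (rel_add A M K)"
  using assms by (metis rel_add_assoc rel_add_commute)

lemmas rel_add_ac = rel_add_assoc rel_add_commute rel_add_left_commute rel_add_M1plus[OF A]

lemma equiv_groth_eq: "equiv (M1plus A \<times> M1plus A) (groth_eq A)"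
proof (rule equivI)
  show "groth_eq A \<subseteq> (M1plus A \<times> M1plus A) \<times> (M1plus A \<times> M1plus A)"
    by (auto simp: groth_eq_def)
  show "refl_on (M1plus A \<times> M1plus A) (groth_eq A)"
    using rel_zero_M1plus[OF A] by (auto simp: refl_on_def groth_eq_def)
  show "sym (groth_eq A)"
    by (rule symI) (auto simp: groth_eq_def intro: sym)
  show "trans (groth_eq A)"
  proof (rule transI, clarify)
    fix M N M' N' M'' N''
    assume *: "((M, N), (M', N')) \<in> groth_eq A" "((M', N'), (M'', N'')) \<in> groth_eq A"
    then obtain K K' where K: "K \<in> M1plus A" "K' \<in> M1plus A"
      and e: "rel_add A (rel_add A M N') K = rel_add A (rel_add A M' N) K"
        "rel_add A (rel_add A M' N'') K' = rel_add A (rel_add A M'' N') K'"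
      by (auto simp: groth_eq_def)
    have m: "M \<in> M1plus A" "N \<in> M1plus A" "M' \<in> M1plus A" "N' \<in> M1plus A" "M'' \<in> M1plus A" "N'' \<in> M1plus A"
      using * by (auto simp: groth_eq_def)
    \<comment> \<open>Both cancelling summands together with the middle term \<open>N'\<close>, so
      that each of the two equations can be applied once.\<close>
    define Z where "Z = rel_add A N' (rel_add A K K')"
    have Z: "Z \<in> M1plus A" using m K by (simp add: Z_def rel_add_ac)
    have "rel_add A (rel_add A M N'') Z = rel_add A (rel_add A (rel_add A M N') K) (rel_add A N'' K')"
      using m K by (simp add: Z_def rel_add_ac)
    also have "\<dots> = rel_add A (rel_add A (rel_add A M' N'') K') (rel_add A N K)"
      using m K unfolding e(1) by (simp add: rel_add_ac)
    also have "\<dots> = rel_add A (rel_add A M'' N) Z"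
      using m K unfolding e(2) by (simp add: Z_def rel_add_ac)
    finally show "((M, N), (M'', N'')) \<in> groth_eq A"
      using m Z by (auto simp: groth_eq_def)
  qed
qed

lemma M1_diff_eq_iff:
  assumes "M \<in> M1plus A" "N \<in> M1plus A" "M' \<in> M1plus A" "N' \<in> M1plus A"
  shows "M1_diff A M N = M1_diff A M' N' \<longleftrightarrow>
    (\<exists>K\<in>M1plus A. rel_add A (rel_add A M N') K = rel_add A (rel_add A M' N) K)"
  unfolding M1_diff_def using assms
  by (subst eq_equiv_class_iff[OF equiv_groth_eq]) (auto simp: groth_eq_def)

lemma M1_diff_in_M1: "M \<in> M1plus A \<Longrightarrow> N \<in> M1plus A \<Longrightarrow> M1_diff A M N \<in> M1 A"
  by (auto simp: M1_def M1_diff_def intro!: quotientI)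

lemma M1_cases:
  assumes "\<xi> \<in> M1 A"
  obtains K L where "K \<in> M1plus A" "L \<in> M1plus A" "\<xi> = M1_diff A K L"
  using assms by (auto simp: M1_def M1_diff_def elim!: quotientE)

lemma M1_add_diff:
  assumes m: "K \<in> M1plus A" "L \<in> M1plus A" "P \<in> M1plus A" "Q \<in> M1plus A"
  shows "M1_add A (M1_diff A K L) (M1_diff A P Q) = M1_diff A (rel_add A K P) (rel_add A L Q)"
proof -
  have "M1_diff A (rel_add A K' P') (rel_add A L' Q') = M1_diff A (rel_add A K P) (rel_add A L Q)"
    if *: "(K', L') \<in> M1_diff A K L" "(P', Q') \<in> M1_diff A P Q" for K' L' P' Q'
  proof -
    have m': "K' \<in> M1plus A" "L' \<in> M1plus A" "P' \<in> M1plus A" "Q' \<in> M1plus A"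
      using * by (auto simp: M1_diff_def groth_eq_def)
    obtain Z W where Z: "Z \<in> M1plus A" "W \<in> M1plus A"
      and e: "rel_add A (rel_add A K L') Z = rel_add A (rel_add A K' L) Z"
        "rel_add A (rel_add A P Q') W = rel_add A (rel_add A P' Q) W"
      using * by (auto simp: M1_diff_def groth_eq_def)
    have "rel_add A (rel_add A (rel_add A K' P') (rel_add A L Q)) (rel_add A Z W)
        = rel_add A (rel_add A (rel_add A K' L) Z) (rel_add A (rel_add A P' Q) W)"
      using m m' Z by (simp add: rel_add_ac)
    also have "\<dots> = rel_add A (rel_add A (rel_add A K P) (rel_add A L' Q')) (rel_add A Z W)"
      using m m' Z unfolding e[symmetric] by (simp add: rel_add_ac)
    finally show ?thesis
      using m m' Z by (subst M1_diff_eq_iff) (auto simp: rel_add_M1plus[OF A])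
  qed
  moreover have "(K, L) \<in> M1_diff A K L" "(P, Q) \<in> M1_diff A P Q"
    using m equiv_groth_eq by (auto simp: M1_diff_def equiv_def refl_on_def)
  ultimately show ?thesis
    unfolding M1_add_def by blast
qed

text \<open>Unfolding the order of the group leaves an auxiliary summand \<open>\<zeta>\<close> on
  both sides. It has finite mass away from \<open>A\<close> and is cancelled there; the inequality
  then extends to all Borel sets off \<open>A\<close>.\<close>

lemma M1_le_of_imp:
  assumes m: "\<kappa> \<in> borel_measures" "\<eta> \<in> borel_measures" "\<mu> \<in> borel_measures"
    and M1: "rel_class A \<kappa> \<in> M1plus A" "rel_class A \<eta> \<in> M1plus A" "rel_class A \<mu> \<in> M1plus A"
    and le: "M1_le A (M1_diff A (rel_class A \<kappa>) (rel_class A \<eta>)) (M1_of A (rel_class A \<mu>))"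
    and E: "E \<in> sets borel" "E \<subseteq> - A"
  shows "emeasure \<kappa> E \<le> emeasure \<mu> E + emeasure \<eta> E"
proof -
  obtain P where P: "P \<in> M1plus A"
    "M1_of A (rel_class A \<mu>) = M1_add A (M1_diff A (rel_class A \<kappa>) (rel_class A \<eta>)) (M1_of A P)"
    using le by (auto simp: M1_le_def)
  have "M1_diff A (rel_class A \<mu>) (rel_zero A) = M1_diff A (rel_add A (rel_class A \<kappa>) P) (rel_class A \<eta>)"
    using P(2) P(1) M1 by (simp add: M1_of_def M1_add_diff rel_zero_M1plus[OF A] rel_add_zero)
  then obtain Z where Z: "Z \<in> M1plus A"
    "rel_add A (rel_add A (rel_class A \<mu>) (rel_class A \<eta>)) Z = rel_add A (rel_add A (rel_class A \<kappa>) P) Z"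
    using P(1) M1 by (auto simp: M1_diff_eq_iff rel_add_M1plus[OF A] rel_zero_M1plus[OF A] rel_add_zero)
  obtain \<rho> where \<rho>: "\<rho> \<in> borel_measures" "P = rel_class A \<rho>" using M1plus_cases[OF A P(1)] by blast
  obtain \<zeta> where \<zeta>: "\<zeta> \<in> borel_measures" "moment A \<zeta> < \<infinity>" "Z = rel_class A \<zeta>"
    using M1plus_cases[OF A Z(1)] by blast
  have *: "emeasure \<kappa> E + emeasure \<rho> E + emeasure \<zeta> E = emeasure \<mu> E + emeasure \<eta> E + emeasure \<zeta> E"
    if "E \<in> sets borel" "E \<subseteq> - A" for E
  proof -
    have "rel_class A (measure_add (measure_add \<mu> \<eta>) \<zeta>) = rel_class A (measure_add (measure_add \<kappa> \<rho>) \<zeta>)"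
      using Z(2) m \<rho> \<zeta> A by (simp add: rel_add_class)
    then have "emeasure (measure_add (measure_add \<mu> \<eta>) \<zeta>) E = emeasure (measure_add (measure_add \<kappa> \<rho>) \<zeta>) E"
      using that A by (simp add: rel_class_eq_iff)
    then show ?thesis using m \<rho> \<zeta> that by (auto simp: emeasure_measure_add)
  qed
  have "emeasure \<kappa> E \<le> emeasure (measure_add \<mu> \<eta>) E"
  proof (rule emeasure_le_from_away[OF A m(1) measure_add_borel _ E])
    fix e :: real and F :: "'a set" assume F: "e > 0" "F \<in> sets borel" "\<And>x. x \<in> F \<Longrightarrow> e \<le> infdist x A"
    have "emeasure \<zeta> F < \<infinity>"
      using emeasure_away_finite[OF \<zeta>(1,2) F(1,3,2)] by blast
    moreover have "F \<subseteq> - A" using F by fastforce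
    ultimately have "emeasure \<kappa> F + emeasure \<rho> F = emeasure \<mu> F + emeasure \<eta> F"
      using *[OF F(2)] by (auto simp: add.commute)
    moreover have "emeasure \<kappa> F \<le> emeasure \<kappa> F + emeasure \<rho> F" by simp
    ultimately show "emeasure \<kappa> F \<le> emeasure (measure_add \<mu> \<eta>) F"
      using m F by (simp add: emeasure_measure_add)
  qed
  then show ?thesis using m E by (simp add: emeasure_measure_add)
qed

text \<open>Finite measures can be subtracted, and multiplying by the density
  \<open>infdist x A\<close> makes both measures finite by the moment assumptions. The difference is
  formed there and divided by the same density.\<close>

lemma difference_measure:
  assumes m: "\<kappa> \<in> borel_measures" "\<eta> \<in> borel_measures" "moment A \<kappa> < \<infinity>" "moment A \<eta> < \<infinity>"
    and le: "\<And>E. E \<in> sets borel \<Longrightarrow> E \<subseteq> - A \<Longrightarrow> emeasure \<kappa> E \<le> emeasure \<eta> E"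
  obtains \<rho> where "\<rho> \<in> borel_measures" "moment A \<rho> < \<infinity>"
    "\<And>E. E \<in> sets borel \<Longrightarrow> E \<subseteq> - A \<Longrightarrow> emeasure \<eta> E = emeasure \<kappa> E + emeasure \<rho> E"
proof -
  note [measurable_cong] = m(1,2)[unfolded mem_borel_measures]
  let ?d = "\<lambda>x. ennreal (infdist x A)"
  define \<kappa>' where "\<kappa>' = density \<kappa> ?d"
  define \<eta>' where "\<eta>' = density \<eta> ?d"
  have s: "sets \<kappa>' = sets borel" "sets \<eta>' = sets borel"
    using m by (auto simp: \<kappa>'_def \<eta>'_def mem_borel_measures)
  have sp: "space \<kappa>' = UNIV" "space \<eta>' = UNIV" using s by (metis sets_eq_imp_space_eq space_borel)+
  have em: "emeasure \<kappa>' UNIV = moment A \<kappa>" "emeasure \<eta>' UNIV = moment A \<eta>"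
    unfolding \<kappa>'_def \<eta>'_def by (subst emeasure_density; simp add: m[unfolded mem_borel_measures])+
  interpret k: finite_measure \<kappa>' by standard (use em m sp in auto)
  interpret l: finite_measure \<eta>' by standard (use em m sp in auto)
  have offle: "off A \<kappa> \<le> off A \<eta>"
  proof (subst le_measure)
    show "sets (off A \<kappa>) = sets (off A \<eta>)" using m by (simp add: mem_borel_measures)
    show "\<forall>E\<in>sets (off A \<kappa>). emeasure (off A \<kappa>) E \<le> emeasure (off A \<eta>) E"
    proof
      fix E assume "E \<in> sets (off A \<kappa>)"
      then have E: "E \<in> sets borel" using m by (simp add: mem_borel_measures)
      then have "E - A \<in> sets borel" using A by simp
      then have "emeasure \<kappa> (E - A) \<le> emeasure \<eta> (E - A)" by (rule le) auto
      then show "emeasure (off A \<kappa>) E \<le> emeasure (off A \<eta>) E"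
        using A m E by (simp add: emeasure_off)
    qed
  qed
  \<comment> \<open>The weight \<open>infdist x A\<close> vanishes on \<open>A\<close>, so both
    integrals may be taken over the parts off \<open>A\<close>, where the comparison is
    known.\<close>
  have le': "emeasure \<kappa>' E \<le> emeasure \<eta>' E" if [measurable]: "E \<in> sets borel" for E
  proof -
    have "emeasure \<kappa>' E = (\<integral>\<^sup>+x. ?d x * indicator E x \<partial>\<kappa>)"
      unfolding \<kappa>'_def by (intro emeasure_density) measurable
    also have "\<dots> = (\<integral>\<^sup>+x. ?d x * indicator E x \<partial>off A \<kappa>)"
      using m A by (intro nn_integral_off[symmetric]) auto
    also have "\<dots> \<le> (\<integral>\<^sup>+x. ?d x * indicator E x \<partial>off A \<eta>)"
      using offle m by (intro nn_integral_mono_measure) (auto simp: mem_borel_measures)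
    also have "\<dots> = (\<integral>\<^sup>+x. ?d x * indicator E x \<partial>\<eta>)"
      using m A by (intro nn_integral_off) auto
    also have "\<dots> = emeasure \<eta>' E"
      unfolding \<eta>'_def by (intro emeasure_density[symmetric]) measurable
    finally show ?thesis .
  qed
  define \<delta> where "\<delta> = diff_measure \<eta>' \<kappa>'"
  have sd [measurable_cong]: "sets \<delta> = sets borel" by (simp add: \<delta>_def s)
  have \<delta>b: "\<delta> \<in> borel_measures" "\<kappa>' \<in> borel_measures" using sd s by (auto simp: mem_borel_measures)
  have ed: "emeasure \<delta> E = emeasure \<eta>' E - emeasure \<kappa>' E" if "E \<in> sets borel" for E
    unfolding \<delta>_def using that s le'
    by (intro emeasure_diff_measure l.finite_measure_axioms k.finite_measure_axioms) auto
  have add: "measure_add \<delta> \<kappa>' = \<eta>'"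
  proof (rule measure_eqI)
    fix E assume "E \<in> sets (measure_add \<delta> \<kappa>')"
    then have E: "E \<in> sets borel" by simp
    then show "emeasure (measure_add \<delta> \<kappa>') E = emeasure \<eta>' E"
      using \<delta>b le'[OF E] by (simp add: emeasure_measure_add ed diff_add_cancel_ennreal)
  qed (simp add: s)
  \<comment> \<open>At points of \<open>A\<close> the convention \<open>1 / 0 = 0\<close> applies,
    so \<open>\<rho>\<close> has no mass there.\<close>
  define \<rho> where "\<rho> = density \<delta> (\<lambda>x. ennreal (1 / infdist x A))"
  have \<rho>b: "\<rho> \<in> borel_measures" by (simp add: \<rho>_def mem_borel_measures sd)
  have one: "?d x * (ennreal (1 / infdist x A) * c) = c" if "x \<notin> A" for x c
  proof -
    have "?d x * ennreal (1 / infdist x A) = 1"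
      using infdist_pos[OF A that] by (simp flip: ennreal_mult')
    then show ?thesis by (simp add: mult.assoc[symmetric])
  qed
  show ?thesis
  proof (rule that[OF \<rho>b])
    have "moment A \<rho> = (\<integral>\<^sup>+x. ennreal (1 / infdist x A) * ?d x \<partial>\<delta>)"
      unfolding \<rho>_def by (intro nn_integral_density) measurable
    also have "\<dots> \<le> (\<integral>\<^sup>+x. 1 \<partial>\<delta>)"
    proof (intro nn_integral_mono)
      fix x
      show "ennreal (1 / infdist x A) * ?d x \<le> 1"
        using one[of x 1] A by (cases "x \<in> A") (auto simp: mult.commute)
    qed
    also have "\<dots> = emeasure \<delta> UNIV"
      using space_borel_measures[OF \<delta>b(1)] by simp
    also have "\<dots> \<le> emeasure \<eta>' UNIV" by (simp add: ed diff_le_self_ennreal)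
    also have "\<dots> < \<infinity>" using em m by simp
    finally show "moment A \<rho> < \<infinity>" .
  next
    fix E :: "'a set" assume E [measurable]: "E \<in> sets borel" and EA: "E \<subseteq> - A"
    let ?g = "\<lambda>x. ennreal (1 / infdist x A) * indicator E x"
    have dens: "(\<integral>\<^sup>+x. ?g x \<partial>density \<sigma> ?d) = emeasure \<sigma> E" if "\<sigma> \<in> borel_measures" for \<sigma>
    proof -
      note [measurable_cong] = that[unfolded mem_borel_measures]
      have "(\<integral>\<^sup>+x. ?g x \<partial>density \<sigma> ?d) = (\<integral>\<^sup>+x. ?d x * ?g x \<partial>\<sigma>)"
        by (intro nn_integral_density) measurable
      also have "\<dots> = (\<integral>\<^sup>+x. indicator E x \<partial>\<sigma>)"
        using EA by (intro nn_integral_cong) (use one[of _ 1] in \<open>auto split: split_indicator\<close>)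
      finally show ?thesis by simp
    qed
    have "emeasure \<eta> E = (\<integral>\<^sup>+x. ?g x \<partial>measure_add \<delta> \<kappa>')"
      using dens[OF m(2)] by (simp add: add \<eta>'_def)
    also have "\<dots> = (\<integral>\<^sup>+x. ?g x \<partial>\<delta>) + (\<integral>\<^sup>+x. ?g x \<partial>\<kappa>')"
      using \<delta>b by (intro nn_integral_measure_add) auto
    also have "(\<integral>\<^sup>+x. ?g x \<partial>\<delta>) = emeasure \<rho> E"
      unfolding \<rho>_def by (intro emeasure_density[symmetric]) measurable
    also have "(\<integral>\<^sup>+x. ?g x \<partial>\<kappa>') = emeasure \<kappa> E" using dens[OF m(1)] by (simp add: \<kappa>'_def)
    finally show "emeasure \<eta> E = emeasure \<kappa> E + emeasure \<rho> E" by (simp add: add.commute)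
  qed
qed

lemma M1_le_zeroI:
  assumes m: "\<kappa> \<in> borel_measures" "\<eta> \<in> borel_measures" "moment A \<kappa> < \<infinity>" "moment A \<eta> < \<infinity>"
    and le: "\<And>E. E \<in> sets borel \<Longrightarrow> E \<subseteq> - A \<Longrightarrow> emeasure \<kappa> E \<le> emeasure \<eta> E"
  shows "M1_le A (M1_diff A (rel_class A \<kappa>) (rel_class A \<eta>)) (M1_zero A)"
proof -
  obtain \<rho> where \<rho>: "\<rho> \<in> borel_measures" "moment A \<rho> < \<infinity>"
    "\<And>E. E \<in> sets borel \<Longrightarrow> E \<subseteq> - A \<Longrightarrow> emeasure \<eta> E = emeasure \<kappa> E + emeasure \<rho> E"
    using difference_measure[OF assms] by metis
  have P: "rel_class A \<rho> \<in> M1plus A" "rel_class A \<kappa> \<in> M1plus A" "rel_class A \<eta> \<in> M1plus A"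
    using \<rho> m A by (auto simp: M1plus_class_iff)
  have "rel_add A (rel_class A \<kappa>) (rel_class A \<rho>) = rel_class A \<eta>"
    using \<rho> m A by (simp add: rel_add_class rel_class_eq_iff emeasure_measure_add)
  then have "M1_zero A = M1_add A (M1_diff A (rel_class A \<kappa>) (rel_class A \<eta>)) (M1_of A (rel_class A \<rho>))"
    using P rel_zero_M1plus[OF A]
    by (auto simp: M1_zero_def M1_of_def M1_add_diff M1_diff_eq_iff rel_add_zero rel_add_M1plus[OF A])
  then show ?thesis using P by (auto simp: M1_le_def)
qed

lemma M1_le_zero_of:
  assumes "M \<in> M1plus A"
  shows "M1_le A (M1_zero A) (M1_of A M)"
  using assms rel_zero_M1plus[OF A]
  by (auto simp: M1_le_def M1_zero_def M1_of_def M1_add_diff rel_add_zero intro!: bexI[of _ M])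

text \<open>A common lower bound has the form \<open>\<kappa> - \<eta>\<close>. On \<open>S\<close>
  the measure \<open>\<nu>\<close> vanishes and on its complement \<open>\<mu>\<close> does, so off
  \<open>A\<close> one of the two bounds gives \<open>\<kappa> \<le> \<eta>\<close> on each piece,
  and the meet is zero.\<close>

lemma is_decomposition_singular:
  assumes m: "\<mu> \<in> borel_measures" "\<nu> \<in> borel_measures" "moment A \<mu> < \<infinity>" "moment A \<nu> < \<infinity>"
    and S: "S \<in> sets borel" "emeasure \<mu> (- S) = 0" "emeasure \<nu> S = 0"
  shows "is_decomposition A (M1_diff A (rel_class A \<mu>) (rel_class A \<nu>)) (rel_class A \<mu>) (rel_class A \<nu>)"
proof -
  have P: "rel_class A \<mu> \<in> M1plus A" "rel_class A \<nu> \<in> M1plus A"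
    using m A by (auto simp: M1plus_class_iff)
  have "M1_le A \<xi> (M1_zero A)"
    if \<xi>: "\<xi> \<in> M1 A" "M1_le A \<xi> (M1_of A (rel_class A \<mu>))" "M1_le A \<xi> (M1_of A (rel_class A \<nu>))" for \<xi>
  proof -
    obtain K L where KL: "K \<in> M1plus A" "L \<in> M1plus A" "\<xi> = M1_diff A K L" using M1_cases[OF \<xi>(1)] by blast
    obtain \<kappa> where \<kappa>: "\<kappa> \<in> borel_measures" "moment A \<kappa> < \<infinity>" "K = rel_class A \<kappa>"
      using M1plus_cases[OF A KL(1)] by blast
    obtain \<eta> where \<eta>: "\<eta> \<in> borel_measures" "moment A \<eta> < \<infinity>" "L = rel_class A \<eta>"
      using M1plus_cases[OF A KL(2)] by blast
    show ?thesis
      unfolding KL(3) \<kappa>(3) \<eta>(3)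
    proof (rule M1_le_zeroI[OF \<kappa>(1) \<eta>(1) \<kappa>(2) \<eta>(2)])
      fix E :: "'a set" assume E: "E \<in> sets borel" "E \<subseteq> - A"
      have le: "emeasure \<kappa> F \<le> emeasure \<mu> F + emeasure \<eta> F" "emeasure \<kappa> F \<le> emeasure \<nu> F + emeasure \<eta> F"
        if "F \<in> sets borel" "F \<subseteq> - A" for F
        using M1_le_of_imp[OF \<kappa>(1) \<eta>(1) _ _ _ _ _ that] KL \<xi> \<kappa> \<eta> m P by auto
      have "emeasure \<nu> (E \<inter> S) \<le> emeasure \<nu> S" "emeasure \<mu> (E - S) \<le> emeasure \<mu> (- S)"
        using S(1) m(1,2) by (intro emeasure_mono; auto simp: mem_borel_measures)+
      then have "emeasure \<kappa> (E \<inter> S) \<le> emeasure \<eta> (E \<inter> S)" "emeasure \<kappa> (E - S) \<le> emeasure \<eta> (E - S)"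
        using le(2)[of "E \<inter> S"] le(1)[of "E - S"] E S by auto
      moreover have "emeasure \<sigma> E = emeasure \<sigma> (E \<inter> S) + emeasure \<sigma> (E - S)" if "\<sigma> \<in> borel_measures" for \<sigma>
      proof -
        have "E \<inter> S \<inter> (E - S) = {}" by blast
        then show ?thesis
          using plus_emeasure[of "E \<inter> S" \<sigma> "E - S"] that E S by (simp add: mem_borel_measures Int_Diff_Un)
      qed
      ultimately show "emeasure \<kappa> E \<le> emeasure \<eta> E"
        using \<kappa> \<eta> by (simp add: add_mono)
    qed
  qed
  then show ?thesis
    using P M1_le_zero_of rel_zero_M1plus[OF A]
    by (auto simp: is_decomposition_def is_M1_meet_def M1_zero_def M1_of_def intro!: M1_diff_in_M1)
qed

end

section \<open>Finite optimal transport\<close>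

definition sublinear :: "(('b \<Rightarrow> real) \<Rightarrow> real) \<Rightarrow> bool" where
  "sublinear p \<longleftrightarrow> (\<forall>f g. p (\<lambda>x. f x + g x) \<le> p f + p g) \<and> (\<forall>c\<ge>0. \<forall>f. p (\<lambda>x. c * f x) = c * p f)"

lemma sublinear_add: "sublinear p \<Longrightarrow> p (\<lambda>x. f x + g x) \<le> p f + p g"
  and sublinear_scale: "sublinear p \<Longrightarrow> 0 \<le> c \<Longrightarrow> p (\<lambda>x. c * f x) = c * p f"
  by (auto simp: sublinear_def)

lemma sublinear_uminus: "sublinear p \<Longrightarrow> 0 \<le> p f + p (\<lambda>x. - f x)"
  using sublinear_add[of p f "\<lambda>x. - f x"] sublinear_scale[of p 0 f] by simp

text \<open>The functional \<open>q f = inf {p (f + t u) - t p u | t \<ge> 0}\<close> lies below \<open>p\<close>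
  and is additive along \<open>u\<close>.\<close>

lemma sublinear_below_additive_along:
  assumes p: "sublinear p"
  obtains q where "sublinear q" "\<And>f. q f \<le> p f" "q (\<lambda>x. - u x) \<le> - p u"
proof -
  define S where "S f = {p (\<lambda>x. f x + t * u x) - t * p u |t. 0 \<le> t}" for f
  define q where "q f = Inf (S f)" for f
  \<comment> \<open>From \<open>t * p u = p (t * u) \<le> p (f + t * u) + p (- f)\<close>. The
    values that define \<open>q f\<close> are thus bounded below, so their infimum is
    meaningful.\<close>
  have lower: "- p (\<lambda>x. - f x) \<le> p (\<lambda>x. f x + t * u x) - t * p u" if "0 \<le> t" for f t
    using sublinear_add[OF p, of "\<lambda>x. f x + t * u x" "\<lambda>x. - f x"] sublinear_scale[OF p that, of u] by simp
  have bdd: "bdd_below (S f)" for f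
    unfolding S_def by (rule bdd_belowI[of _ "- p (\<lambda>x. - f x)"]) (use lower in auto)
  have ne: "S f \<noteq> {}" for f unfolding S_def by (auto intro: exI[of _ 0])
  have q_le: "q f \<le> p (\<lambda>x. f x + t * u x) - t * p u" if "0 \<le> t" for f t
    unfolding q_def using that by (intro cInf_lower bdd) (auto simp: S_def)
  have q_ge: "r \<le> q f" if "\<And>t. 0 \<le> t \<Longrightarrow> r \<le> p (\<lambda>x. f x + t * u x) - t * p u" for r f
    unfolding q_def using that ne by (intro cInf_greatest) (auto simp: S_def)
  \<comment> \<open>One inequality for all positive factors suffices; the reverse one follows with
    the factor \<open>1 / c\<close>.\<close>
  have scale: "q (\<lambda>x. c * f x) \<le> c * q f" if c: "0 < c" for c f
  proof -
    have "q (\<lambda>x. c * f x) / c \<le> q f"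
    proof (rule q_ge)
      fix t :: real assume t: "0 \<le> t"
      have "q (\<lambda>x. c * f x) \<le> p (\<lambda>x. c * f x + (c * t) * u x) - (c * t) * p u"
        using c t by (intro q_le) simp
      also have "(\<lambda>x. c * f x + (c * t) * u x) = (\<lambda>x. c * (f x + t * u x))"
        by (simp add: algebra_simps)
      finally show "q (\<lambda>x. c * f x) / c \<le> p (\<lambda>x. f x + t * u x) - t * p u"
        using c sublinear_scale[OF p, of c "\<lambda>x. f x + t * u x"] by (simp add: field_simps)
    qed
    then show ?thesis using c by (simp add: field_simps)
  qed
  have p0: "p (\<lambda>x. 0) = 0" using sublinear_scale[OF p, of 0 "\<lambda>_. 0"] by simp
  have "sublinear q"
    unfolding sublinear_def
  proof safe
    fix f g
    have sub: "q (\<lambda>x. f x + g x) \<le> p (\<lambda>x. f x + s * u x) - s * p u + (p (\<lambda>x. g x + t * u x) - t * p u)"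
      if "0 \<le> s" "0 \<le> t" for s t
    proof -
      have "q (\<lambda>x. f x + g x) \<le> p (\<lambda>x. f x + g x + (s + t) * u x) - (s + t) * p u"
        using that by (intro q_le) simp
      also have "(\<lambda>x. f x + g x + (s + t) * u x) = (\<lambda>x. (f x + s * u x) + (g x + t * u x))"
        by (simp add: algebra_simps)
      finally show ?thesis
        using sublinear_add[OF p, of "\<lambda>x. f x + s * u x" "\<lambda>x. g x + t * u x"]
        unfolding distrib_right[of s t "p u"] by linarith
    qed
    have "q (\<lambda>x. f x + g x) - (p (\<lambda>x. f x + s * u x) - s * p u) \<le> q g" if "0 \<le> s" for s
    proof (rule q_ge)
      fix t :: real assume "0 \<le> t"
      from sub[OF that this] show "q (\<lambda>x. f x + g x) - (p (\<lambda>x. f x + s * u x) - s * p u)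
          \<le> p (\<lambda>x. g x + t * u x) - t * p u" by linarith
    qed
    note sub' = this
    have "q (\<lambda>x. f x + g x) - q g \<le> q f"
    proof (rule q_ge)
      fix s :: real assume "0 \<le> s"
      from sub'[OF this] show "q (\<lambda>x. f x + g x) - q g \<le> p (\<lambda>x. f x + s * u x) - s * p u" by linarith
    qed
    then show "q (\<lambda>x. f x + g x) \<le> q f + q g" by simp
  next
    fix c :: real and f assume "0 \<le> c"
    then consider "c = 0" | "0 < c" by linarith
    then show "q (\<lambda>x. c * f x) = c * q f"
    proof cases
      case 1
      have "q (\<lambda>x. 0) \<le> 0" using q_le[of 0 "\<lambda>_. 0"] p0 by simp
      moreover have "0 \<le> q (\<lambda>x. 0)"
        using p0 lower[of _ "\<lambda>_. 0"] by (intro q_ge) auto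
      ultimately show ?thesis using 1 by simp
    next
      case 2
      have "q f \<le> 1 / c * q (\<lambda>x. c * f x)"
        using scale[of "1 / c" "\<lambda>x. c * f x"] 2 by simp
      then show ?thesis using scale[OF 2, of f] 2 by (simp add: field_simps)
    qed
  qed
  moreover have "q f \<le> p f" for f using q_le[of 0 f] by simp
  \<comment> \<open>The choice \<open>t = 1\<close> gives the value
    \<open>p 0 - p u\<close>.\<close>
  moreover have "q (\<lambda>x. - u x) \<le> - p u" using q_le[of 1 "\<lambda>x. - u x"] p0 by simp
  ultimately show ?thesis using that by blast
qed

text \<open>A Hahn-Banach argument in finitely many directions. Additivity along \<open>u\<close>
  survives passage to a smaller sublinear functional \<open>r\<close>: the sum
  \<open>r u + r (- u)\<close> is nonnegative by subadditivity and at most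
  \<open>q u + q (- u) = 0\<close>.\<close>

lemma sublinear_below_additive_along_finite:
  assumes "finite U" "sublinear p"
  shows "\<exists>q. sublinear q \<and> (\<forall>f. q f \<le> p f) \<and> (\<forall>u\<in>U. q (\<lambda>x. - u x) = - q u)"
  using assms(1)
proof induction
  case empty
  then show ?case using assms(2) by auto
next
  case (insert v U)
  then obtain q where q: "sublinear q" "\<And>f. q f \<le> p f" "\<And>u. u \<in> U \<Longrightarrow> q (\<lambda>x. - u x) = - q u" by auto
  obtain r where r: "sublinear r" "\<And>f. r f \<le> q f" "r (\<lambda>x. - v x) \<le> - q v"
    using sublinear_below_additive_along[OF q(1)] by blast
  have "r (\<lambda>x. - u x) = - r u" if "u \<in> insert v U" for u
  proof -
    have "r (\<lambda>x. - u x) + r u \<le> 0"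
      using that r(3) r(2)[of v] r(2)[of u] r(2)[of "\<lambda>x. - u x"] q(3)[of u] by auto
    then show ?thesis using sublinear_uminus[OF r(1), of u] by simp
  qed
  then show ?case using r q(2) by (meson order_trans)
qed

text \<open>Additivity along a vector gives homogeneity for negative factors as well. Adding a
  multiple of the vector and removing it again then forces equality in subadditivity.\<close>

lemma sublinear_additive_sum:
  assumes q: "sublinear q" and "finite S" and lin: "\<And>z. z \<in> S \<Longrightarrow> q (\<lambda>x. - u z x) = - q (u z)"
  shows "q (\<lambda>x. \<Sum>z\<in>S. h z * u z x) = (\<Sum>z\<in>S. h z * q (u z))"
  using assms(2) lin
proof induction
  case empty
  then show ?case using sublinear_scale[OF q, of 0 "\<lambda>_. 0"] by simp
next
  case (insert z S)
  have sc: "q (\<lambda>x. c * u z x) = c * q (u z)" for c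
    using sublinear_scale[OF q, of c "u z"] sublinear_scale[OF q, of "- c" "\<lambda>x. - u z x"] insert.prems[of z]
    by (cases "0 \<le> c") auto
  let ?f = "\<lambda>x. \<Sum>z\<in>S. h z * u z x"
  have "q (\<lambda>x. h z * u z x + ?f x) \<le> h z * q (u z) + q ?f"
    using sublinear_add[OF q, of "\<lambda>x. h z * u z x" ?f] by (simp add: sc)
  moreover have "q ?f \<le> q (\<lambda>x. h z * u z x + ?f x) + - h z * q (u z)"
    using sublinear_add[OF q, of "\<lambda>x. h z * u z x + ?f x" "\<lambda>x. - h z * u z x"] sc[of "- h z"] by simp
  ultimately show ?case using insert by simp
qed

text \<open>Kantorovich duality for finitely supported marginals. The functional \<open>p\<close> is the
  superhedging price, and a transport plan is a linear functional below it.\<close>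

lemma finite_kantorovich_duality:
  fixes V :: "'a set" and U :: "'b set" and c :: "'a \<times> 'b \<Rightarrow> real"
  assumes fin: "finite V" "finite U"
    and pos: "\<And>x. x \<in> V \<Longrightarrow> 0 \<le> \<mu> x" "\<And>y. y \<in> U \<Longrightarrow> 0 \<le> \<nu> y"
    and total: "sum \<mu> V = sum \<nu> U"
    and dual: "\<And>\<phi> \<psi>. (\<And>x y. x \<in> V \<Longrightarrow> y \<in> U \<Longrightarrow> \<phi> x + \<psi> y \<le> c (x, y)) \<Longrightarrow>
      (\<Sum>x\<in>V. \<phi> x * \<mu> x) + (\<Sum>y\<in>U. \<psi> y * \<nu> y) \<le> W"
  obtains \<pi> where "\<And>x y. x \<in> V \<Longrightarrow> y \<in> U \<Longrightarrow> 0 \<le> \<pi> (x, y)"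
    "\<And>x. x \<in> V \<Longrightarrow> (\<Sum>y\<in>U. \<pi> (x, y)) = \<mu> x" "\<And>y. y \<in> U \<Longrightarrow> (\<Sum>x\<in>V. \<pi> (x, y)) = \<nu> y"
    "(\<Sum>z\<in>V \<times> U. c z * \<pi> z) \<le> W"
proof -
  define m where "m = sum \<mu> V"
  define l where "l \<phi> \<psi> = (\<Sum>x\<in>V. \<phi> x * \<mu> x) + (\<Sum>y\<in>U. \<psi> y * \<nu> y)" for \<phi> \<psi>
  \<comment> \<open>A pair with \<open>h \<le> \<phi> + \<psi>\<close> superhedges \<open>h\<close>
    at the price \<open>l \<phi> \<psi>\<close>.\<close>
  define S where "S h = {l \<phi> \<psi> |\<phi> \<psi>. \<forall>x\<in>V. \<forall>y\<in>U. h (x, y) \<le> \<phi> x + \<psi> y}" for h :: "'a \<times> 'b \<Rightarrow> real"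
  define p where "p h = Inf (S h)" for h
  \<comment> \<open>The normalised product \<open>\<mu> x * \<nu> y / m\<close> is a plan, and it
    integrates \<open>\<phi> x + \<psi> y\<close> to its price; this bounds all prices from below.
    If \<open>m = 0\<close>, both marginals vanish and both sides are zero.\<close>
  have l_eq: "l \<phi> \<psi> = (\<Sum>x\<in>V. \<Sum>y\<in>U. (\<mu> x * \<nu> y) * (\<phi> x + \<psi> y)) / m" for \<phi> \<psi>
  proof (cases "m = 0")
    case True
    then have "\<And>x. x \<in> V \<Longrightarrow> \<mu> x = 0" "\<And>y. y \<in> U \<Longrightarrow> \<nu> y = 0"
      using fin pos total by (auto simp: m_def sum_nonneg_eq_0_iff)
    then show ?thesis by (simp add: l_def)
  next
    case False
    have "(\<Sum>x\<in>V. \<Sum>y\<in>U. (\<mu> x * \<nu> y) * (\<phi> x + \<psi> y))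
        = (\<Sum>x\<in>V. \<Sum>y\<in>U. (\<phi> x * \<mu> x) * \<nu> y) + (\<Sum>x\<in>V. \<Sum>y\<in>U. \<mu> x * (\<psi> y * \<nu> y))"
      by (simp add: sum.distrib algebra_simps)
    also have "\<dots> = (\<Sum>x\<in>V. \<phi> x * \<mu> x) * sum \<nu> U + sum \<mu> V * (\<Sum>y\<in>U. \<psi> y * \<nu> y)"
      by (simp add: sum_product)
    finally show ?thesis using False total by (simp add: l_def m_def field_simps)
  qed
  have m0: "0 \<le> m" using pos by (simp add: m_def sum_nonneg)
  have lower: "(\<Sum>x\<in>V. \<Sum>y\<in>U. (\<mu> x * \<nu> y) * h (x, y)) / m \<le> l \<phi> \<psi>"
    if "\<forall>x\<in>V. \<forall>y\<in>U. h (x, y) \<le> \<phi> x + \<psi> y" for h \<phi> \<psi>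
    unfolding l_eq using that m0 pos by (intro divide_right_mono sum_mono mult_left_mono) auto
  have bdd: "bdd_below (S h)" for h
    using lower[of h] by (intro bdd_belowI[of _ "(\<Sum>x\<in>V. \<Sum>y\<in>U. (\<mu> x * \<nu> y) * h (x, y)) / m"]) (auto simp: S_def)
  have ne: "S h \<noteq> {}" for h
  proof -
    have "h (x, y) \<le> (\<Sum>z\<in>V \<times> U. \<bar>h z\<bar>)" if "x \<in> V" "y \<in> U" for x y
      using member_le_sum[of "(x, y)" "V \<times> U" "\<lambda>z. \<bar>h z\<bar>"] that fin by auto
    then have "l (\<lambda>_. \<Sum>z\<in>V \<times> U. \<bar>h z\<bar>) (\<lambda>_. 0) \<in> S h"
      unfolding S_def by (intro CollectI exI[of _ "\<lambda>_. \<Sum>z\<in>V \<times> U. \<bar>h z\<bar>"] exI[of _ "\<lambda>_. 0"]) simp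
    then show ?thesis by blast
  qed
  have p_le: "p h \<le> l \<phi> \<psi>" if "\<And>x y. x \<in> V \<Longrightarrow> y \<in> U \<Longrightarrow> h (x, y) \<le> \<phi> x + \<psi> y" for h \<phi> \<psi>
    unfolding p_def using that by (intro cInf_lower bdd) (auto simp: S_def)
  have p_ge: "r \<le> p h" if "\<And>\<phi> \<psi>. \<forall>x\<in>V. \<forall>y\<in>U. h (x, y) \<le> \<phi> x + \<psi> y \<Longrightarrow> r \<le> l \<phi> \<psi>" for r h
    unfolding p_def using that ne by (intro cInf_greatest) (auto simp: S_def)
  have l_add: "l (\<lambda>x. \<phi> x + \<phi>' x) (\<lambda>x. \<psi> x + \<psi>' x) = l \<phi> \<psi> + l \<phi>' \<psi>'" for \<phi> \<phi>' \<psi> \<psi>'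
    by (simp add: l_def algebra_simps sum.distrib)
  have l_scale: "l (\<lambda>x. a * \<phi> x) (\<lambda>x. a * \<psi> x) = a * l \<phi> \<psi>" for a \<phi> \<psi>
    by (simp add: l_def algebra_simps sum_distrib_left)
  have scale: "p (\<lambda>z. a * h z) \<le> a * p h" if a: "0 < a" for a h
  proof -
    have "p (\<lambda>z. a * h z) / a \<le> p h"
    proof (rule p_ge)
      fix \<phi> \<psi> assume *: "\<forall>x\<in>V. \<forall>y\<in>U. h (x, y) \<le> \<phi> x + \<psi> y"
      have "p (\<lambda>z. a * h z) \<le> l (\<lambda>x. a * \<phi> x) (\<lambda>x. a * \<psi> x)"
        using * a by (intro p_le) (simp add: distrib_left[symmetric])
      then show "p (\<lambda>z. a * h z) / a \<le> l \<phi> \<psi>" using a by (simp add: l_scale field_simps)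
    qed
    then show ?thesis using a by (simp add: field_simps)
  qed
  have "sublinear p"
    unfolding sublinear_def
  proof safe
    fix f g
    have sub: "p (\<lambda>x. f x + g x) \<le> l \<phi> \<psi> + l \<phi>' \<psi>'"
      if *: "\<forall>x\<in>V. \<forall>y\<in>U. f (x, y) \<le> \<phi> x + \<psi> y" "\<forall>x\<in>V. \<forall>y\<in>U. g (x, y) \<le> \<phi>' x + \<psi>' y" for \<phi> \<psi> \<phi>' \<psi>'
      unfolding l_add[symmetric]
    proof (rule p_le)
      fix x y assume "x \<in> V" "y \<in> U"
      then have "f (x, y) \<le> \<phi> x + \<psi> y" "g (x, y) \<le> \<phi>' x + \<psi>' y" using * by blast+
      then show "f (x, y) + g (x, y) \<le> \<phi> x + \<phi>' x + (\<psi> y + \<psi>' y)" by linarith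
    qed
    have sub': "p (\<lambda>x. f x + g x) - l \<phi> \<psi> \<le> p g" if "\<forall>x\<in>V. \<forall>y\<in>U. f (x, y) \<le> \<phi> x + \<psi> y" for \<phi> \<psi>
    proof (rule p_ge)
      fix \<phi>' \<psi>' assume "\<forall>x\<in>V. \<forall>y\<in>U. g (x, y) \<le> \<phi>' x + \<psi>' y"
      from sub[OF that this] show "p (\<lambda>x. f x + g x) - l \<phi> \<psi> \<le> l \<phi>' \<psi>'" by linarith
    qed
    have "p (\<lambda>x. f x + g x) - p g \<le> p f"
    proof (rule p_ge)
      fix \<phi> \<psi> assume "\<forall>x\<in>V. \<forall>y\<in>U. f (x, y) \<le> \<phi> x + \<psi> y"
      from sub'[OF this] show "p (\<lambda>x. f x + g x) - p g \<le> l \<phi> \<psi>" by linarith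
    qed
    then show "p (\<lambda>x. f x + g x) \<le> p f + p g" by simp
  next
    fix a :: real and f assume "0 \<le> a"
    then consider "a = 0" | "0 < a" by linarith
    then show "p (\<lambda>x. a * f x) = a * p f"
    proof cases
      case 1
      have "p (\<lambda>x. 0) \<le> 0" using p_le[of "\<lambda>_. 0" "\<lambda>_. 0" "\<lambda>_. 0"] by (simp add: l_def)
      moreover have "0 \<le> p (\<lambda>x. 0)" using lower[of "\<lambda>_. 0"] by (intro p_ge) simp
      ultimately show ?thesis using 1 by simp
    next
      case 2
      have "p f \<le> 1 / a * p (\<lambda>x. a * f x)"
        using scale[of "1 / a" "\<lambda>x. a * f x"] 2 by simp
      then show ?thesis using scale[OF 2, of f] 2 by (simp add: field_simps)
    qed
  qed
  \<comment> \<open>Linearity is needed only on the span of these finitely many point functions;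
    \<open>ext\<close> cuts a function off outside \<open>V \<times> U\<close> by expanding it in
    them.\<close>
  define \<delta> where "\<delta> z = (\<lambda>z'. if z' = z then 1 else 0 :: real)" for z :: "'a \<times> 'b"
  define ext where "ext h = (\<lambda>x. \<Sum>z\<in>V \<times> U. h z * \<delta> z x)" for h
  have ext: "ext h z = (if z \<in> V \<times> U then h z else 0)" for h z
    unfolding ext_def \<delta>_def using fin by (simp add: if_distrib sum.delta cong: if_cong)
  \<comment> \<open>Descending along \<open>- c\<close> before all other directions fixes the value
    at the cost: \<open>q0 c \<le> - p (- c)\<close>, which is the dual optimum. A linear functional
    chosen arbitrarily below \<open>p\<close> would be a plan, but not necessarily an optimal
    one.\<close>
  obtain q0 where q0: "sublinear q0" "\<And>f. q0 f \<le> p f" "q0 (\<lambda>x. - (- ext c x)) \<le> - p (\<lambda>x. - ext c x)"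
  proof (rule sublinear_below_additive_along[OF \<open>sublinear p\<close>, of "\<lambda>x. - ext c x"])
    fix q assume "sublinear q" "\<And>f. q f \<le> p f" "q (\<lambda>x. - (- ext c x)) \<le> - p (\<lambda>x. - ext c x)"
    then show thesis by (rule that)
  qed
  have "finite (\<delta> ` (V \<times> U))" using fin by simp
  from sublinear_below_additive_along_finite[OF this q0(1)]
  obtain q where q: "sublinear q" "\<And>f. q f \<le> q0 f"
    and "\<forall>u\<in>\<delta> ` (V \<times> U). q (\<lambda>x. - u x) = - q u" by blast
  then have q_neg: "q (\<lambda>x. - \<delta> z x) = - q (\<delta> z)" if "z \<in> V \<times> U" for z using that by blast
  have qp: "q f \<le> p f" for f using q(2) q0(2) order_trans by blast
  define \<pi> where "\<pi> z = q (\<delta> z)" for z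
  have q_ext: "q (ext h) = (\<Sum>z\<in>V \<times> U. h z * \<pi> z)" for h
    unfolding ext_def \<pi>_def using fin by (intro sublinear_additive_sum q(1) q_neg) simp_all
  have upper: "(\<Sum>z\<in>V \<times> U. h z * \<pi> z) \<le> l \<phi> \<psi>"
    if "\<And>x y. x \<in> V \<Longrightarrow> y \<in> U \<Longrightarrow> h (x, y) \<le> \<phi> x + \<psi> y" for h \<phi> \<psi>
    using order_trans[OF qp p_le, of "ext h" \<phi> \<psi>] that by (simp add: ext q_ext)
  \<comment> \<open>The function \<open>\<phi> + \<psi>\<close> and its negative are superhedged
    exactly by themselves, so both inequalities hold. Indicator choices of \<open>\<phi>\<close> and
    \<open>\<psi>\<close> turn the equality into the marginal conditions.\<close>
  have mass: "(\<Sum>z\<in>V \<times> U. (\<phi> (fst z) + \<psi> (snd z)) * \<pi> z) = l \<phi> \<psi>" for \<phi> \<psi>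
  proof (rule antisym)
    show "(\<Sum>z\<in>V \<times> U. (\<phi> (fst z) + \<psi> (snd z)) * \<pi> z) \<le> l \<phi> \<psi>" by (rule upper) simp
    have "(\<Sum>z\<in>V \<times> U. - (\<phi> (fst z) + \<psi> (snd z)) * \<pi> z) \<le> l (\<lambda>x. - 1 * \<phi> x) (\<lambda>x. - 1 * \<psi> x)" by (rule upper) simp
    then show "l \<phi> \<psi> \<le> (\<Sum>z\<in>V \<times> U. (\<phi> (fst z) + \<psi> (snd z)) * \<pi> z)"
      unfolding l_scale by (simp only: mult_minus_left sum_negf mult_1 neg_le_iff_le)
  qed
  show ?thesis
  proof (rule that[of \<pi>])
    fix x y assume xy: "x \<in> V" "y \<in> U"
    \<comment> \<open>The function \<open>- \<delta> (x, y)\<close> is nonpositive, hence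
      superhedged at price zero.\<close>
    have "(\<Sum>z\<in>V \<times> U. - \<delta> (x, y) z * \<pi> z) \<le> l (\<lambda>_. 0) (\<lambda>_. 0)"
      by (rule upper) (simp add: \<delta>_def)
    moreover have "(\<Sum>z\<in>V \<times> U. - \<delta> (x, y) z * \<pi> z) = - \<pi> (x, y)"
      using fin xy by (simp add: \<delta>_def if_distrib if_distribR sum_negf cong: if_cong)
    ultimately show "0 \<le> \<pi> (x, y)" by (simp add: l_def)
  next
    fix x assume x: "x \<in> V"
    have "(\<Sum>y\<in>U. \<pi> (x, y)) = (\<Sum>x'\<in>V. \<Sum>y\<in>U. (if x' = x then 1 else 0) * \<pi> (x', y))"
      using fin x by (subst sum.swap) (simp add: mult_delta_left)
    also have "\<dots> = l (\<lambda>x'. if x' = x then 1 else 0) (\<lambda>_. 0)"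
      by (simp add: mass[symmetric] sum.cartesian_product case_prod_unfold)
    also have "\<dots> = \<mu> x" using fin x by (simp add: l_def mult_delta_left)
    finally show "(\<Sum>y\<in>U. \<pi> (x, y)) = \<mu> x" .
  next
    fix y assume y: "y \<in> U"
    have "(\<Sum>x\<in>V. \<pi> (x, y)) = (\<Sum>x\<in>V. \<Sum>y'\<in>U. (if y' = y then 1 else 0) * \<pi> (x, y'))"
      using fin y by (simp add: mult_delta_left)
    also have "\<dots> = l (\<lambda>_. 0) (\<lambda>y'. if y' = y then 1 else 0)"
      by (simp add: mass[symmetric] sum.cartesian_product case_prod_unfold)
    also have "\<dots> = \<nu> y" using fin y by (simp add: l_def mult_delta_left)
    finally show "(\<Sum>x\<in>V. \<pi> (x, y)) = \<nu> y" .
  next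
    \<comment> \<open>Changing signs turns a pair that dominates \<open>- c\<close> into an
      admissible dual pair for \<open>c\<close>.\<close>
    have "- W \<le> p (\<lambda>x. - ext c x)"
    proof (rule p_ge)
      fix \<phi> \<psi> assume *: "\<forall>x\<in>V. \<forall>y\<in>U. - ext c (x, y) \<le> \<phi> x + \<psi> y"
      have "l (\<lambda>x. - 1 * \<phi> x) (\<lambda>x. - 1 * \<psi> x) \<le> W"
        unfolding l_def using * by (intro dual) (force simp: ext)
      then show "- W \<le> l \<phi> \<psi>" unfolding l_scale by simp
    qed
    then show "(\<Sum>z\<in>V \<times> U. c z * \<pi> z) \<le> W"
      using q(2)[of "ext c"] q0(3) by (simp add: q_ext)
  qed
qed

section \<open>Order continuous functionals live on isolated points\<close>

lemma Lip_iff: "f \<in> Lip A \<longleftrightarrow> (\<exists>C\<ge>0. \<forall>x y. \<bar>f x - f y\<bar> \<le> C * dist x y) \<and> (\<forall>a\<in>A. f a = 0)"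
  by (auto simp: Lip_def lipschitz_on_def dist_real_def)

lemma Lip_zero_on: "f \<in> Lip A \<Longrightarrow> a \<in> A \<Longrightarrow> f a = 0"
  by (simp add: Lip_iff)

lemma Lip_constant:
  assumes "f \<in> Lip A"
  obtains C where "C \<ge> 0" "\<And>x y. \<bar>f x - f y\<bar> \<le> C * dist x y"
  using assms by (auto simp: Lip_iff)

text \<open>Sum, difference, minimum and maximum are all \<open>1\<close>-Lipschitz for the sum
  metric on pairs and vanish at the origin, so one estimate covers them.\<close>

lemma Lip_combine:
  assumes f: "f \<in> Lip A" and g: "g \<in> Lip A"
    and k: "\<And>a b c d. \<bar>k a b - k c d\<bar> \<le> \<bar>a - c\<bar> + \<bar>b - d :: real\<bar>" "k 0 0 = 0"
  shows "(\<lambda>x. k (f x) (g x)) \<in> Lip A"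
proof -
  obtain C where C: "C \<ge> 0" "\<And>x y. \<bar>f x - f y\<bar> \<le> C * dist x y" using Lip_constant[OF f] by blast
  obtain D where D: "D \<ge> 0" "\<And>x y. \<bar>g x - g y\<bar> \<le> D * dist x y" using Lip_constant[OF g] by blast
  have "\<bar>k (f x) (g x) - k (f y) (g y)\<bar> \<le> (C + D) * dist x y" for x y
    using k(1)[of "f x" "g x" "f y" "g y"] C(2)[of x y] D(2)[of x y] by (simp add: distrib_right)
  then show ?thesis
    using C(1) D(1) Lip_zero_on[OF f] Lip_zero_on[OF g] k(2) unfolding Lip_iff
    by (intro conjI exI[of _ "C + D"]) auto
qed

lemma Lip_zero: "(\<lambda>_. 0) \<in> Lip A"
  by (auto simp: Lip_iff intro: exI[of _ 0])

lemma Lip_cmult: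
  assumes "f \<in> Lip A"
  shows "(\<lambda>x. c * f x) \<in> Lip A"
proof -
  obtain C where C: "C \<ge> 0" "\<And>x y. \<bar>f x - f y\<bar> \<le> C * dist x y" using Lip_constant[OF assms] by blast
  have "\<bar>c * f x - c * f y\<bar> \<le> (\<bar>c\<bar> * C) * dist x y" for x y
    using mult_left_mono[OF C(2)[of x y], of "\<bar>c\<bar>"]
    by (simp add: abs_mult[symmetric] right_diff_distrib mult.assoc)
  then show ?thesis
    using C(1) Lip_zero_on[OF assms] unfolding Lip_iff by (intro conjI exI[of _ "\<bar>c\<bar> * C"]) auto
qed

lemma Lip_add: "f \<in> Lip A \<Longrightarrow> g \<in> Lip A \<Longrightarrow> (\<lambda>x. f x + g x) \<in> Lip A"
  by (rule Lip_combine) auto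

lemma Lip_diff: "f \<in> Lip A \<Longrightarrow> g \<in> Lip A \<Longrightarrow> (\<lambda>x. f x - g x) \<in> Lip A"
  by (rule Lip_combine) auto

lemma Lip_uminus: "f \<in> Lip A \<Longrightarrow> (\<lambda>x. - f x) \<in> Lip A"
  using Lip_diff[OF Lip_zero] by simp

lemma Lip_min: "f \<in> Lip A \<Longrightarrow> g \<in> Lip A \<Longrightarrow> (\<lambda>x. min (f x) (g x)) \<in> Lip A"
  by (rule Lip_combine) (auto simp: min_def)

lemma Lip_max: "f \<in> Lip A \<Longrightarrow> g \<in> Lip A \<Longrightarrow> (\<lambda>x. max (f x) (g x)) \<in> Lip A"
  by (rule Lip_combine) (auto simp: max_def)

lemma Lip_sum: "(\<And>k. k \<in> K \<Longrightarrow> f k \<in> Lip A) \<Longrightarrow> (\<lambda>x. \<Sum>k\<in>K. f k x) \<in> Lip A"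
  by (induction K rule: infinite_finite_induct) (auto intro: Lip_add Lip_zero)

lemma Lip_infdist: "(\<lambda>x. infdist x A) \<in> Lip A"
  using infdist_triangle_abs[of _ A] by (auto simp: Lip_iff intro!: exI[of _ 1])

lemma Lip_le_infdist:
  assumes "A \<noteq> {}" "a0 \<in> A" "\<And>a. a \<in> A \<Longrightarrow> f a = f a0" "\<And>x y. \<bar>f x - f y\<bar> \<le> C * dist x y" "C \<ge> 0"
  shows "\<bar>f x - f a0\<bar> \<le> C * infdist x A"
proof (cases "C = 0")
  case True
  then show ?thesis using assms(4)[of x a0] by simp
next
  case False
  then have C: "C > 0" using assms by simp
  have "\<bar>f x - f a0\<bar> / C \<le> infdist x A"
    unfolding infdist_notempty[OF assms(1)]
  proof (rule cINF_greatest[OF assms(1)])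
    fix a assume "a \<in> A"
    then show "\<bar>f x - f a0\<bar> / C \<le> dist x a"
      using assms(4)[of x a] assms(3)[of a] C by (simp add: field_simps)
  qed
  then show ?thesis using C by (simp add: field_simps)
qed

lemma Lip_dominated:
  assumes "A \<noteq> {}" "f \<in> Lip A"
  obtains C where "C \<ge> 0" "\<And>x. \<bar>f x\<bar> \<le> C * infdist x A"
proof -
  obtain a where "a \<in> A" using assms by blast
  obtain C where C: "C \<ge> 0" "\<And>x y. \<bar>f x - f y\<bar> \<le> C * dist x y" using Lip_constant[OF assms(2)] by blast
  have "\<bar>f x\<bar> \<le> C * infdist x A" for x
    using Lip_le_infdist[OF assms(1) \<open>a \<in> A\<close> _ C(2,1), of x] Lip_zero_on[OF assms(2)] \<open>a \<in> A\<close> by simp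
  then show ?thesis using C that by blast
qed

text \<open>The source of non-pointwise infima: a lower bound in \<open>Lip A\<close> is continuous,
  so it suffices to control it on a dense set.\<close>

lemma Lip_nonpos_if_dense:
  assumes f: "f \<in> Lip A" and dense: "\<And>x e. e > 0 \<Longrightarrow> \<exists>y. dist x y < e \<and> f y \<le> 0"
  shows "f x \<le> 0"
proof (rule ccontr)
  assume "\<not> f x \<le> 0"
  obtain C where C: "C \<ge> 0" "\<And>x y. \<bar>f x - f y\<bar> \<le> C * dist x y" using Lip_constant[OF f] by blast
  \<comment> \<open>The constant \<open>C\<close> may be zero; with \<open>C + 1\<close> the radius
    is still positive and the estimate strict.\<close>
  obtain y where y: "dist x y < f x / (C + 1)" "f y \<le> 0"
    using dense[of "f x / (C + 1)" x] \<open>\<not> f x \<le> 0\<close> C by auto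
  have "f x \<le> C * dist x y" using C(2)[of x y] y by linarith
  also have "\<dots> \<le> (C + 1) * dist x y" by (simp add: distrib_right)
  also have "\<dots> < f x" using y C by (simp add: field_simps)
  finally show False by simp
qed

definition isolated_off :: "'a::topological_space set \<Rightarrow> 'a set" where
  "isolated_off A = {x. x \<notin> A \<and> open {x}}"

text \<open>For a finite set of isolated points off \<open>A\<close> this is a combination of
  indicators in \<open>Lip A\<close>, so \<open>T\<close> can be evaluated on it by
  linearity.\<close>

definition restr :: "'a set \<Rightarrow> ('a \<Rightarrow> real) \<Rightarrow> 'a \<Rightarrow> real" where
  "restr F f = (\<lambda>x. if x \<in> F then f x else 0)"

text \<open>The values differ only between \<open>z\<close> and points outside its isolation radius
  \<open>e\<close>, whence the constant \<open>1 / e\<close>.\<close>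

lemma Lip_indicator_isolated:
  assumes "z \<in> isolated_off A"
  shows "(indicator {z} :: 'a::metric_space \<Rightarrow> real) \<in> Lip A"
proof -
  obtain e where e: "e > 0" "ball z e \<subseteq> {z}"
    using assms by (auto simp: isolated_off_def open_contains_ball)
  then have far: "e \<le> dist z y" if "y \<noteq> z" for y using that by (force simp: subset_eq not_less[symmetric])
  have "\<bar>indicator {z} x - indicator {z} y\<bar> \<le> (1 / e) * dist x y" for x y
    using far[of x] far[of y] e(1) by (auto simp: indicator_def dist_commute field_simps)
  then show ?thesis
    using e(1) assms unfolding Lip_iff by (intro conjI exI[of _ "1 / e"]) (auto simp: isolated_off_def indicator_def)
qed

lemma restr_insert:
  "z \<notin> F \<Longrightarrow> restr (insert z F) f = (\<lambda>x. restr F f x + f z * indicator {z} x)"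
  by (auto simp: restr_def indicator_def)

lemma Lip_restr: "finite F \<Longrightarrow> F \<subseteq> isolated_off A \<Longrightarrow> restr F f \<in> Lip A"
proof (induction F rule: finite_induct)
  case empty
  then show ?case by (simp add: restr_def Lip_zero)
next
  case (insert z F)
  then show ?case by (simp add: restr_insert Lip_add Lip_cmult Lip_indicator_isolated)
qed

section \<open>The modulus of the functional and approximation by isolated points\<close>

context
  fixes A :: "'a::polish_space set" and T :: "('a \<Rightarrow> real) \<Rightarrow> real"
  assumes A: "closed A" "A \<noteq> {}" and T: "T \<in> seq_order_continuous_dual (Lip A)"
begin

lemma dual_add: "f \<in> Lip A \<Longrightarrow> g \<in> Lip A \<Longrightarrow> T (\<lambda>x. f x + g x) = T f + T g"
  and dual_cmult: "f \<in> Lip A \<Longrightarrow> T (\<lambda>x. c * f x) = c * T f"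
  using T by (auto simp: seq_order_continuous_dual_def linear_functional_on_def)

lemma dual_uminus: "f \<in> Lip A \<Longrightarrow> T (\<lambda>x. - f x) = - T f"
  using dual_cmult[of f "- 1"] by simp

lemma dual_diff: "f \<in> Lip A \<Longrightarrow> g \<in> Lip A \<Longrightarrow> T (\<lambda>x. f x - g x) = T f - T g"
  using dual_add[of f "\<lambda>x. - g x"] by (simp add: dual_uminus Lip_uminus)

lemma dual_zero: "T (\<lambda>_. 0) = 0"
  using dual_cmult[OF Lip_zero, of 0] by simp

lemma dual_restr:
  "finite F \<Longrightarrow> F \<subseteq> isolated_off A \<Longrightarrow> T (restr F f) = (\<Sum>z\<in>F. f z * T (indicator {z}))"
proof (induction F rule: finite_induct)
  case empty
  then show ?case by (simp add: restr_def dual_zero)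
next
  case (insert z F)
  then show ?case
    by (simp add: restr_insert dual_add dual_cmult Lip_cmult Lip_indicator_isolated Lip_restr)
qed

text \<open>The value \<open>\<bar>T\<bar> h\<close> of the modulus of \<open>T\<close>, for \<open>h \<ge> 0\<close>.\<close>

definition modulus :: "('a \<Rightarrow> real) \<Rightarrow> real" where
  "modulus h = Sup ((\<lambda>g. \<bar>T g\<bar>) ` {g \<in> Lip A. \<forall>x. \<bar>g x\<bar> \<le> h x})"

text \<open>Order boundedness of \<open>T\<close> on the interval from \<open>- h\<close> to
  \<open>h\<close> makes the supremum in the modulus finite.\<close>

lemma modulus_ge:
  assumes "h \<in> Lip A" "g \<in> Lip A" "\<And>x. \<bar>g x\<bar> \<le> h x"
  shows "\<bar>T g\<bar> \<le> modulus h"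
proof -
  have "bounded (T ` {f \<in> Lip A. (\<lambda>x. - h x) \<le> f \<and> f \<le> h})"
    using T assms(1) Lip_uminus[OF assms(1)] unfolding seq_order_continuous_dual_def order_bounded_on_def by blast
  then obtain B where B: "\<And>f. f \<in> Lip A \<Longrightarrow> (\<lambda>x. - h x) \<le> f \<Longrightarrow> f \<le> h \<Longrightarrow> \<bar>T f\<bar> \<le> B"
    by (auto simp: bounded_iff)
  have "\<bar>T f\<bar> \<le> B" if "f \<in> Lip A" "\<forall>x. \<bar>f x\<bar> \<le> h x" for f
  proof (rule B[OF that(1)]; rule le_funI)
    fix x show "- h x \<le> f x" "f x \<le> h x" using that(2)[rule_format, of x] by (auto simp: abs_le_iff)
  qed
  then have "bdd_above ((\<lambda>g. \<bar>T g\<bar>) ` {g \<in> Lip A. \<forall>x. \<bar>g x\<bar> \<le> h x})"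
    by (intro bdd_aboveI[of _ B]) blast
  then show ?thesis
    unfolding modulus_def using assms by (intro cSup_upper) auto
qed

lemma modulus_le:
  assumes "\<And>x. 0 \<le> h x" "\<And>g. g \<in> Lip A \<Longrightarrow> (\<And>x. \<bar>g x\<bar> \<le> h x) \<Longrightarrow> \<bar>T g\<bar> \<le> r"
  shows "modulus h \<le> r"
  unfolding modulus_def using assms Lip_zero[of A] by (intro cSup_least) auto

lemma modulus_nonneg: "h \<in> Lip A \<Longrightarrow> (\<And>x. 0 \<le> h x) \<Longrightarrow> 0 \<le> modulus h"
  using modulus_ge[OF _ Lip_zero] by (simp add: dual_zero)

text \<open>Riesz decomposition: clipping \<open>g\<close> to the interval from \<open>- h\<close>
  to \<open>h\<close> leaves a remainder bounded by \<open>k\<close>.\<close>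

lemma modulus_add:
  assumes "h \<in> Lip A" "k \<in> Lip A" "\<And>x. 0 \<le> h x" "\<And>x. 0 \<le> k x"
  shows "modulus (\<lambda>x. h x + k x) \<le> modulus h + modulus k"
proof (rule modulus_le)
  fix g assume g: "g \<in> Lip A" "\<And>x. \<bar>g x\<bar> \<le> h x + k x"
  define g1 where "g1 x = max (- h x) (min (h x) (g x))" for x
  have L: "g1 \<in> Lip A" unfolding g1_def by (intro Lip_max Lip_min Lip_uminus assms g)
  have "\<bar>g1 x\<bar> \<le> h x" for x using assms(3)[of x] by (simp add: g1_def abs_le_iff)
  then have 1: "\<bar>T g1\<bar> \<le> modulus h" by (intro modulus_ge assms L)
  have "\<bar>g x - g1 x\<bar> \<le> k x" for x
    using assms(3)[of x] assms(4)[of x] g(2)[of x] by (auto simp: g1_def max_def min_def)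
  then have 2: "\<bar>T (\<lambda>x. g x - g1 x)\<bar> \<le> modulus k" by (intro modulus_ge assms Lip_diff g L)
  then show "\<bar>T g\<bar> \<le> modulus h + modulus k"
    using 1 by (simp add: dual_diff g L)
qed (use assms in \<open>simp add: add_nonneg_nonneg\<close>)

lemma modulus_sum:
  assumes "finite K" "\<And>k. k \<in> K \<Longrightarrow> h k \<in> Lip A" "\<And>k x. k \<in> K \<Longrightarrow> 0 \<le> h k x"
  shows "modulus (\<lambda>x. \<Sum>k\<in>K. h k x) \<le> (\<Sum>k\<in>K. modulus (h k))"
  using assms
proof (induction K rule: finite_induct)
  case empty
  have "modulus (\<lambda>_. 0) \<le> 0"
  proof (rule modulus_le)
    fix g :: "'a \<Rightarrow> real" assume "\<And>x. \<bar>g x\<bar> \<le> 0"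
    then have "g = (\<lambda>_. 0)" by fastforce
    then show "\<bar>T g\<bar> \<le> 0" by (simp add: dual_zero)
  qed simp
  then show ?case by simp
next
  case (insert k K)
  have "modulus (\<lambda>x. h k x + (\<Sum>k\<in>K. h k x)) \<le> modulus (h k) + modulus (\<lambda>x. \<Sum>k\<in>K. h k x)"
    using insert by (intro modulus_add Lip_sum sum_nonneg) auto
  then show ?case using insert by simp
qed

text \<open>Order continuity speaks of \<open>T\<close> along a sequence, whereas the modulus is a
  supremum. Nearly maximal \<open>g n\<close> below \<open>h n\<close>, with error
  \<open>1 / Suc n\<close>, form an order null sequence, along which \<open>T\<close> tends to
  zero.\<close>

lemma modulus_null:
  assumes h: "\<And>n. h n \<in> Lip A" "decseq h" "is_infimum_in (Lip A) (range h) (\<lambda>_. 0)"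
  shows "(\<lambda>n. modulus (h n)) \<longlonglongrightarrow> 0"
proof -
  have nn: "0 \<le> h n x" for n x using h(3) by (auto simp: is_infimum_in_def le_fun_def)
  have "\<exists>g\<in>Lip A. (\<forall>x. \<bar>g x\<bar> \<le> h n x) \<and> modulus (h n) \<le> \<bar>T g\<bar> + 1 / Suc n" for n
  proof (rule ccontr)
    assume *: "\<not> ?thesis"
    have "modulus (h n) \<le> modulus (h n) - 1 / Suc n"
    proof (rule modulus_le[OF nn])
      fix g assume "g \<in> Lip A" "\<And>x. \<bar>g x\<bar> \<le> h n x"
      then have "\<not> modulus (h n) \<le> \<bar>T g\<bar> + 1 / Suc n" using * by blast
      then show "\<bar>T g\<bar> \<le> modulus (h n) - 1 / Suc n" by linarith
    qed
    then show False by simp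
  qed
  then obtain g where g: "\<And>n. g n \<in> Lip A" "\<And>n x. \<bar>g n x\<bar> \<le> h n x"
    "\<And>n. modulus (h n) \<le> \<bar>T (g n)\<bar> + 1 / Suc n" by metis
  have "order_null_seq (Lip A) g"
    unfolding order_null_seq_def using g h by (auto simp: le_fun_def intro!: exI[of _ h])
  then have "(\<lambda>n. T (g n)) \<longlonglongrightarrow> 0"
    using T by (auto simp: seq_order_continuous_dual_def)
  then have "(\<lambda>n. \<bar>T (g n)\<bar> + 1 / Suc n) \<longlonglongrightarrow> 0 + 0"
    by (intro tendsto_add tendsto_rabs_zero LIMSEQ_Suc[OF lim_1_over_n])
  then have lim: "(\<lambda>n. \<bar>T (g n)\<bar> + 1 / Suc n) \<longlonglongrightarrow> 0" by simp
  show ?thesis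
    by (rule tendsto_sandwich[OF _ _ tendsto_const lim]) (use g nn h modulus_nonneg in auto)
qed

text \<open>Bumps shrinking to a non-isolated point decrease to the indicator of that point, and the only
  continuous function between \<open>0\<close> and this indicator is \<open>0\<close>.\<close>

lemma small_bump:
  assumes q: "q \<notin> A" "\<not> open {q}" and "c \<ge> 0" "e > 0"
  obtains h where "h \<in> Lip A" "\<And>x. 0 \<le> h x" "c \<le> h q" "modulus h \<le> e"
proof -
  define d where "d = infdist q A"
  have d: "d > 0" using infdist_pos[OF A q(1)] by (simp add: d_def)
  \<comment> \<open>A cone with apex \<open>q\<close> and height \<open>c\<close>. The slope
    \<open>c / d\<close> brings it down to zero at distance \<open>d\<close>, hence on
    \<open>A\<close>; the extra slope \<open>n\<close> makes it shrink to the apex.\<close>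
  define h where "h n x = max 0 (c - (real n + c / d) * dist q x)" for n x
  have L: "h n \<in> Lip A" for n
  proof -
    let ?C = "real n + c / d"
    have C: "?C \<ge> 0" using d assms by simp
    have "\<bar>h n x - h n y\<bar> \<le> ?C * dist x y" for x y
    proof -
      have "\<bar>?C * dist q x - ?C * dist q y\<bar> \<le> ?C * dist x y"
        using C abs_dist_diff_le[of x q y] by (simp add: right_diff_distrib[symmetric] abs_mult mult_left_mono dist_commute)
      then show ?thesis by (auto simp: h_def max_def)
    qed
    moreover have "h n a = 0" if "a \<in> A" for a
    proof -
      have "c = c / d * d" using d by simp
      also have "\<dots> \<le> ?C * dist q a"
        using d assms(3) infdist_le[OF that, of q] by (intro mult_mono) (auto simp: d_def)
      finally show ?thesis by (simp add: h_def)
    qed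
    ultimately show ?thesis using C unfolding Lip_iff by blast
  qed
  have dec: "decseq h"
  proof (rule decseq_SucI, rule le_funI)
    fix n x
    have "(real n + c / d) * dist q x \<le> (real (Suc n) + c / d) * dist q x" by (intro mult_right_mono) auto
    then show "h (Suc n) x \<le> h n x" by (auto simp: h_def)
  qed
  have "is_infimum_in (Lip A) (range h) (\<lambda>_. 0)"
    unfolding is_infimum_in_def
  proof (intro conjI ballI impI)
    show "(\<lambda>_. 0) \<in> Lip A" by (rule Lip_zero)
    show "(\<lambda>_. 0) \<le> f" if "f \<in> range h" for f using that by (auto simp: h_def le_fun_def)
  next
    fix g assume g: "g \<in> Lip A" "\<forall>f\<in>range h. g \<le> f"
    have off_q: "g x \<le> 0" if "x \<noteq> q" for x
    proof -
      have dx: "dist q x > 0" using that by simp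
      obtain n :: nat where "c / dist q x < n" using reals_Archimedean2 by blast
      then have "c < n * dist q x" using dx by (simp add: field_simps)
      also have "\<dots> \<le> (n + c / d) * dist q x" using d assms(3) by (intro mult_right_mono) auto
      finally have "h n x = 0" by (simp add: h_def)
      then show ?thesis using g(2) by (metis le_funD rangeI)
    qed
    show "g \<le> (\<lambda>_. 0)"
    proof (rule le_funI, rule Lip_nonpos_if_dense[OF g(1)])
      fix x and r :: real assume r: "r > 0"
      \<comment> \<open>As \<open>q\<close> is not isolated, every ball around it contains another
        point, where \<open>g\<close> is already known to be nonpositive.\<close>
      have "\<not> ball q r \<subseteq> {q}" using q(2) r centre_in_ball[of q r]
        by (metis insert_absorb open_ball subset_singletonD empty_iff)
      then obtain y where "y \<noteq> q" "dist q y < r" by (auto simp: subset_eq)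
      then show "\<exists>y. dist x y < r \<and> g y \<le> 0"
        using off_q r by (cases "x = q") (auto intro: exI[of _ x])
    qed
  qed
  from modulus_null[OF L dec this] have "\<forall>\<^sub>F n in sequentially. modulus (h n) < e"
    using assms(4) by (rule order_tendstoD(2))
  then obtain n where "modulus (h n) < e" by (meson eventually_happens' sequentially_bot)
  then show ?thesis using L assms(3) by (intro that[of "h n"]) (auto simp: h_def)
qed

text \<open>Adding bumps of small modulus at the non-isolated points of a dense sequence to the
  restrictions of \<open>f\<close> yields functions \<open>\<phi> n\<close> with \<open>f - \<phi> n\<close> decreasing to \<open>0\<close> in \<open>Lip A\<close>.\<close>

lemma dual_lim_nonneg:
  assumes dense: "\<And>U. open U \<Longrightarrow> U \<noteq> {} \<Longrightarrow> \<exists>k. q k \<in> U"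
    and f: "f \<in> Lip A" "\<And>x. 0 \<le> f x"
  shows "(\<lambda>n. T (restr (isolated_off A \<inter> q ` {..<n}) f)) \<longlonglongrightarrow> T f"
proof (rule LIMSEQ_I)
  fix r :: real assume "r > 0"
  define e where "e = r / 2"
  have e: "e > 0" using \<open>r > 0\<close> by (simp add: e_def)
  define F where "F n = isolated_off A \<inter> q ` {..<n}" for n :: nat
  have F: "finite (F n)" "F n \<subseteq> isolated_off A" for n by (auto simp: F_def)
  \<comment> \<open>At indices that need no bump the zero function serves. The bounds on the moduli
    sum to at most \<open>e\<close>, half of \<open>r\<close>; the other half is kept for the limit
    of \<open>T (g n)\<close>.\<close>
  have "\<exists>h\<in>Lip A. (\<forall>x. 0 \<le> h x) \<and> (q k \<notin> A \<and> \<not> open {q k} \<longrightarrow> f (q k) \<le> h (q k)) \<and> modulus h \<le> e * (1 / 2) ^ Suc k" for k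
  proof (cases "q k \<notin> A \<and> \<not> open {q k}")
    case True
    then obtain h where "h \<in> Lip A" "\<And>x. 0 \<le> h x" "f (q k) \<le> h (q k)" "modulus h \<le> e * (1 / 2) ^ Suc k"
      using small_bump[of "q k" "f (q k)" "e * (1 / 2) ^ Suc k"] f e by auto
    then show ?thesis by blast
  next
    case False
    have "modulus (\<lambda>_. 0) \<le> 0" using modulus_sum[of "{}"] by simp
    also have "\<dots> \<le> e * (1 / 2) ^ Suc k" using e by simp
    finally have "modulus (\<lambda>_. 0) \<le> e * (1 / 2) ^ Suc k" .
    with False show ?thesis by (intro bexI[OF _ Lip_zero]) auto
  qed
  then obtain h where h: "\<And>k. h k \<in> Lip A" "\<And>k x. 0 \<le> h k x"
    "\<And>k. q k \<notin> A \<Longrightarrow> \<not> open {q k} \<Longrightarrow> f (q k) \<le> h k (q k)" "\<And>k. modulus (h k) \<le> e * (1 / 2) ^ Suc k"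
    by metis
  define H where "H n x = (\<Sum>k<n. h k x)" for n x
  have H: "H n \<in> Lip A" "0 \<le> H n x" for n x
    using h unfolding H_def by (auto intro: Lip_sum sum_nonneg)
  have R: "restr (F n) f \<in> Lip A" "0 \<le> restr (F n) f x" "restr (F n) f x \<le> f x" for n x
    using Lip_restr[OF F, of n f] f(2)[of x] by (simp_all add: restr_def)
  \<comment> \<open>Truncation at \<open>f\<close> keeps \<open>f - \<phi> n\<close> nonnegative
    even where the bumps exceed \<open>f\<close>.\<close>
  define \<phi> where "\<phi> n x = min (f x) (restr (F n) f x + H n x)" for n x
  have \<phi>: "\<phi> n \<in> Lip A" for n unfolding \<phi>_def by (intro Lip_min Lip_add f R H)
  define g where "g n x = f x - \<phi> n x" for n x
  have g: "g n \<in> Lip A" for n unfolding g_def by (intro Lip_diff f \<phi>)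
  have g0: "0 \<le> g n x" for n x by (simp add: g_def \<phi>_def)
  have "decseq g"
  proof (rule decseq_SucI, rule le_funI)
    fix n x
    have "F n \<subseteq> F (Suc n)" by (auto simp: F_def)
    then have "restr (F n) f x \<le> restr (F (Suc n)) f x" using f(2) by (auto simp: restr_def)
    moreover have "H n x \<le> H (Suc n) x" using h(2) by (simp add: H_def)
    ultimately show "g (Suc n) x \<le> g n x" by (auto simp: g_def \<phi>_def)
  qed
  moreover have "is_infimum_in (Lip A) (range g) (\<lambda>_. 0)"
    unfolding is_infimum_in_def
  proof (intro conjI ballI impI)
    show "(\<lambda>_. 0) \<in> Lip A" by (rule Lip_zero)
    show "(\<lambda>_. 0) \<le> k" if "k \<in> range g" for k using that g0 by (auto simp: le_fun_def)
  next
    fix u assume u: "u \<in> Lip A" "\<forall>k\<in>range g. u \<le> k"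
    \<comment> \<open>Stage \<open>n\<close> involves the indices below \<open>n\<close>, so the
      point \<open>q k\<close> is settled at stage \<open>Suc k\<close>: an isolated point is caught
      by \<open>F\<close>, a non-isolated one by its bump. On \<open>A\<close> every element of
      \<open>Lip A\<close> is zero.\<close>
    have uq: "u (q k) \<le> 0" for k
    proof (cases "q k \<in> A")
      case True
      then show ?thesis using Lip_zero_on[OF u(1)] by simp
    next
      case False
      have "f (q k) \<le> restr (F (Suc k)) f (q k) + H (Suc k) (q k)"
      proof (cases "open {q k}")
        case True
        then have "q k \<in> F (Suc k)" using False by (auto simp: F_def isolated_off_def)
        then show ?thesis using H(2)[of "Suc k" "q k"] by (simp add: restr_def)
      next
        case no: False
        have "f (q k) \<le> h k (q k)" using h(3) False no by blast
        also have "\<dots> \<le> H (Suc k) (q k)" using h(2) by (simp add: H_def sum_nonneg)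
        finally show ?thesis using R(2)[of "Suc k" "q k"] by simp
      qed
      then have "g (Suc k) (q k) = 0" by (simp add: g_def \<phi>_def)
      moreover have "u (q k) \<le> g (Suc k) (q k)" using u(2) by (meson le_funD rangeI)
      ultimately show ?thesis by simp
    qed
    show "u \<le> (\<lambda>_. 0)"
    proof (rule le_funI, rule Lip_nonpos_if_dense[OF u(1)])
      fix x and s :: real assume "s > 0"
      then obtain k where "q k \<in> ball x s" using dense[of "ball x s"] by auto
      then show "\<exists>y. dist x y < s \<and> u y \<le> 0" using uq by auto
    qed
  qed
  ultimately have "order_null_seq (Lip A) g"
    unfolding order_null_seq_def using g g0 by (auto simp: le_fun_def intro!: exI[of _ g])
  then have "(\<lambda>n. T (g n)) \<longlonglongrightarrow> 0"
    using T by (auto simp: seq_order_continuous_dual_def)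
  then obtain N where N: "\<And>n. n \<ge> N \<Longrightarrow> \<bar>T (g n)\<bar> < e"
    using LIMSEQ_D[of "\<lambda>n. T (g n)" 0 e] e by auto
  have "\<bar>T (restr (F n) f) - T f\<bar> < r" if "n \<ge> N" for n
  proof -
    \<comment> \<open>As \<open>restr (F n) f \<le> f\<close>, truncation leaves a value between
      \<open>restr (F n) f x\<close> and that value plus \<open>H n x\<close>. This domination is
      what the modulus converts into a bound for \<open>T\<close>.\<close>
    have "\<bar>\<phi> n x - restr (F n) f x\<bar> \<le> H n x" for x
      using H(2)[of n x] R(3)[of n x] by (auto simp: \<phi>_def min_def)
    then have "\<bar>T (\<lambda>x. \<phi> n x - restr (F n) f x)\<bar> \<le> modulus (H n)"
      by (intro modulus_ge H Lip_diff \<phi> R)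
    also have "\<dots> \<le> (\<Sum>k<n. modulus (h k))" unfolding H_def using h by (intro modulus_sum) auto
    also have "\<dots> \<le> (\<Sum>k<n. e * (1 / 2) ^ Suc k)" using h by (intro sum_mono)
    also have "\<dots> = e * (1 - (1 / 2) ^ n)"
      by (induction n) (auto simp: algebra_simps)
    also have "\<dots> \<le> e" using e by (simp add: mult_left_le)
    finally have "\<bar>T (\<phi> n) - T (restr (F n) f)\<bar> \<le> e" by (simp add: dual_diff \<phi> R)
    moreover have "T (g n) = T f - T (\<phi> n)" unfolding g_def by (simp add: dual_diff f \<phi>)
    ultimately show ?thesis using N[OF that] unfolding e_def by linarith
  qed
  then show "\<exists>N. \<forall>n\<ge>N. norm (T (restr (isolated_off A \<inter> q ` {..<n}) f) - T f) < r"
    unfolding F_def by auto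
qed

text \<open>The monotone approximation was built for nonnegative \<open>f\<close>; the general case
  follows by splitting into positive and negative parts.\<close>

lemma dual_lim:
  assumes dense: "\<And>U. open U \<Longrightarrow> U \<noteq> {} \<Longrightarrow> \<exists>k. q k \<in> U" and f: "f \<in> Lip A"
  shows "(\<lambda>n. T (restr (isolated_off A \<inter> q ` {..<n}) f)) \<longlonglongrightarrow> T f"
proof -
  define F where "F n = isolated_off A \<inter> q ` {..<n}" for n :: nat
  have F: "finite (F n)" "F n \<subseteq> isolated_off A" for n by (auto simp: F_def)
  define p where "p x = max 0 (f x)" for x
  define m where "m x = max 0 (- f x)" for x
  have L: "p \<in> Lip A" "m \<in> Lip A"
    unfolding p_def m_def by (intro Lip_max Lip_zero Lip_uminus f)+
  have "T (restr (F n) f) = T (restr (F n) p) - T (restr (F n) m)" for n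
  proof -
    have "restr (F n) f = (\<lambda>x. restr (F n) p x - restr (F n) m x)"
      by (auto simp: restr_def p_def m_def fun_eq_iff)
    then show ?thesis by (simp add: dual_diff Lip_restr F)
  qed
  moreover have "f = (\<lambda>x. p x - m x)" by (auto simp: p_def m_def)
  then have "T f = T p - T m" using dual_diff[OF L] by simp
  moreover have "(\<lambda>n. T (restr (F n) p) - T (restr (F n) m)) \<longlonglongrightarrow> T p - T m"
    unfolding F_def by (intro tendsto_diff dual_lim_nonneg dense L) (auto simp: p_def m_def)
  ultimately show ?thesis by (simp add: F_def)
qed

text \<open>Tests \<open>T\<close> on the signs of the weights times \<open>infdist\<close>. The
  Lipschitz constant of this function may grow with \<open>F\<close>, but its order bound does not,
  and the modulus sees only the latter.\<close>

lemma dual_weights_bounded: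
  assumes "finite F" "F \<subseteq> isolated_off A"
  shows "(\<Sum>z\<in>F. \<bar>T (indicator {z})\<bar> * infdist z A) \<le> modulus (\<lambda>x. infdist x A)"
proof -
  define g where "g = restr F (\<lambda>z. sgn (T (indicator {z})) * infdist z A)"
  have "T g = (\<Sum>z\<in>F. \<bar>T (indicator {z})\<bar> * infdist z A)"
    unfolding g_def dual_restr[OF assms] by (intro sum.cong) (auto simp: sgn_if)
  moreover have "\<bar>T g\<bar> \<le> modulus (\<lambda>x. infdist x A)"
  proof (rule modulus_ge[OF Lip_infdist])
    show "g \<in> Lip A" unfolding g_def by (rule Lip_restr[OF assms])
    show "\<bar>g x\<bar> \<le> infdist x A" for x
      by (auto simp: g_def restr_def sgn_if infdist_nonneg)
  qed
  ultimately show ?thesis by simp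
qed

end

section \<open>Discrete measures and couplings\<close>

text \<open>The image under the identity only exchanges the power set for the Borel sigma-algebra.
  Negative weights are turned into zero by \<open>ennreal\<close>.\<close>

definition discrete_measure :: "('b::topological_space \<Rightarrow> real) \<Rightarrow> 'b measure" where
  "discrete_measure w = distr (density (count_space UNIV) (\<lambda>x. ennreal (w x))) borel (\<lambda>x. x)"

lemma discrete_measure_borel [simp]: "discrete_measure w \<in> borel_measures"
  by (simp add: mem_borel_measures discrete_measure_def)

lemma nn_integral_discrete_measure:
  assumes "f \<in> borel_measurable borel"
  shows "(\<integral>\<^sup>+x. f x \<partial>discrete_measure w) = (\<integral>\<^sup>+x. ennreal (w x) * f x \<partial>count_space UNIV)"
proof -
  have "(\<integral>\<^sup>+x. f x \<partial>discrete_measure w) = (\<integral>\<^sup>+x. f x \<partial>density (count_space UNIV) (\<lambda>x. ennreal (w x)))"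
    unfolding discrete_measure_def using assms by (intro nn_integral_distr) auto
  also have "\<dots> = (\<integral>\<^sup>+x. ennreal (w x) * f x \<partial>count_space UNIV)"
    by (intro nn_integral_density) auto
  finally show ?thesis .
qed

lemma emeasure_discrete_measure:
  assumes "E \<in> sets borel"
  shows "emeasure (discrete_measure w) E = (\<integral>\<^sup>+x. ennreal (w x) * indicator E x \<partial>count_space UNIV)"
  using nn_integral_discrete_measure[of "indicator E" w] assms by (simp add: discrete_measure_def)

lemma integral_discrete_measure:
  fixes f :: "'b::topological_space \<Rightarrow> real"
  assumes "f \<in> borel_measurable borel" "\<And>x. 0 \<le> w x"
  shows "(\<integral>x. f x \<partial>discrete_measure w) = (\<integral>x. w x * f x \<partial>count_space UNIV)"
proof -
  have "(\<integral>x. f x \<partial>discrete_measure w) = (\<integral>x. f x \<partial>density (count_space UNIV) (\<lambda>x. ennreal (w x)))"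
    unfolding discrete_measure_def using assms by (intro integral_distr) auto
  also have "\<dots> = (\<integral>x. w x *\<^sub>R f x \<partial>count_space UNIV)"
    using assms by (intro integral_density) auto
  finally show ?thesis by simp
qed

text \<open>Monotone convergence along an exhaustion of the support; it serves both the total of the
  weight series and its tails.\<close>

lemma nn_integral_count_space_le:
  fixes f :: "'b \<Rightarrow> ennreal"
  assumes "incseq F" "\<And>n. finite (F n)" "\<And>x. (\<And>n. x \<notin> F n) \<Longrightarrow> f x = 0" "\<And>n. sum f (F n) \<le> b"
  shows "(\<integral>\<^sup>+x. f x \<partial>count_space UNIV) \<le> b"
proof -
  have "f x = (SUP n. f x * indicator (F n) x)" for x
  proof (cases "\<exists>n. x \<in> F n")
    case True
    then obtain n where n: "x \<in> F n" by blast
    show ?thesis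
    proof (rule antisym)
      show "f x \<le> (SUP n. f x * indicator (F n) x)"
        using n by (intro SUP_upper2[of n]) auto
    qed (auto intro!: SUP_least split: split_indicator)
  next
    case False
    then show ?thesis using assms(3)[of x] by simp
  qed
  then have "(\<integral>\<^sup>+x. f x \<partial>count_space UNIV) = (\<integral>\<^sup>+x. (SUP n. f x * indicator (F n) x) \<partial>count_space UNIV)"
    by (rule nn_integral_cong)
  also have "\<dots> = (SUP n. \<integral>\<^sup>+x. f x * indicator (F n) x \<partial>count_space UNIV)"
    using assms(1) by (intro nn_integral_monotone_convergence_SUP)
      (auto simp: incseq_def le_fun_def subset_eq split: split_indicator)
  also have "\<dots> \<le> b"
  proof (rule SUP_least)
    fix n
    have "(\<integral>\<^sup>+x. f x * indicator (F n) x \<partial>count_space UNIV) = (\<Sum>x\<in>F n. f x * indicator (F n) x)"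
      using assms(2) by (intro nn_integral_count_space') auto
    also have "\<dots> = sum f (F n)" by (intro sum.cong) auto
    finally show "(\<integral>\<^sup>+x. f x * indicator (F n) x \<partial>count_space UNIV) \<le> b" using assms(4) by simp
  qed
  finally show ?thesis .
qed

section \<open>Lipschitz bounds, the quotient pseudometric and finite transport\<close>

lemma Lip_borel_measurable: "f \<in> Lip A \<Longrightarrow> f \<in> borel_measurable borel"
  unfolding Lip_def using lipschitz_on_continuous_on borel_measurable_continuous_onI by blast

lemma lip_number_le_one_iff:
  fixes f :: "'a::metric_space \<Rightarrow> real"
  assumes "f \<in> Lip A"
  shows "lip_number f \<le> 1 \<longleftrightarrow> (\<forall>x y. \<bar>f x - f y\<bar> \<le> dist x y)"
proof
  let ?S = "{C. C-lipschitz_on UNIV f}"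
  have ne: "?S \<noteq> {}" using assms by (auto simp: Lip_def)
  {
    assume le: "lip_number f \<le> 1"
    show "\<forall>x y. \<bar>f x - f y\<bar> \<le> dist x y"
    proof (intro allI, rule field_le_epsilon)
      fix x y :: 'a and e :: real assume e: "e > 0"
      \<comment> \<open>The summand \<open>1\<close> keeps the denominator positive for
        \<open>x = y\<close>; the loss \<open>r * dist x y\<close> stays below
        \<open>e\<close>.\<close>
      define r where "r = e / (dist x y + 1)"
      have r: "r > 0" using e by (simp add: r_def add_nonneg_pos)
      obtain C where C: "C-lipschitz_on UNIV f" "C < 1 + r"
        using cInf_lessD[OF ne, of "1 + r"] le r by (auto simp: lip_number_def)
      have "\<bar>f x - f y\<bar> \<le> C * dist x y"
        using C(1) by (auto simp: lipschitz_on_def dist_real_def)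
      also have "\<dots> \<le> (1 + r) * dist x y" using C(2) by (intro mult_right_mono) auto
      also have "\<dots> \<le> dist x y + r * (dist x y + 1)" using r by (simp add: algebra_simps)
      also have "r * (dist x y + 1) = e"
      proof -
        have "dist x y + 1 \<noteq> 0" using zero_le_dist[of x y] by linarith
        then show ?thesis by (simp add: r_def)
      qed
      finally show "\<bar>f x - f y\<bar> \<le> dist x y + e" .
    qed
  next
    assume "\<forall>x y. \<bar>f x - f y\<bar> \<le> dist x y"
    then have "1 \<in> ?S" by (auto simp: lipschitz_on_def dist_real_def)
    moreover have "bdd_below ?S" by (rule bdd_belowI[of _ 0]) (auto simp: lipschitz_on_def)
    ultimately show "lip_number f \<le> 1" unfolding lip_number_def by (rule cInf_lower)
  }
qed

lemma quot_dist_refl: "quot_dist A x x = 0"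
  and quot_dist_commute: "quot_dist A x y = quot_dist A y x"
  and quot_dist_nonneg: "0 \<le> quot_dist A x y"
  and quot_dist_le_dist: "quot_dist A x y \<le> dist x y"
  by (auto simp: quot_dist_def infdist_nonneg dist_commute add.commute)

lemma quot_dist_triangle: "quot_dist A x z \<le> quot_dist A x y + quot_dist A y z"
  using dist_triangle[of x z y] infdist_triangle[of x A y] infdist_triangle[of z A y]
    infdist_nonneg[of y A]
  unfolding quot_dist_def min_def by (auto simp: dist_commute)

lemma quot_dist_to_base: "a \<in> A \<Longrightarrow> quot_dist A x a = infdist x A"
  using infdist_le[of a A x] by (auto simp: quot_dist_def)

lemma quot_dist_on_base: "a \<in> A \<Longrightarrow> b \<in> A \<Longrightarrow> quot_dist A a b = 0"
  by (simp add: quot_dist_to_base)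

lemma quot_dist_borel_measurable:
  "(\<lambda>(x, y). quot_dist A x y) \<in> borel_measurable (borel :: ('a::polish_space \<times> 'a) measure)"
  unfolding quot_dist_def case_prod_unfold
  by (intro borel_measurable_continuous_onI continuous_intros)

text \<open>The second term of \<open>quot_dist\<close> comes from \<open>\<bar>f x - f y\<bar>
  \<le> \<bar>f x\<bar> + \<bar>f y\<bar>\<close>, each summand being at most the distance to
  \<open>A\<close>.\<close>

lemma Lip_one_le_quot_dist:
  assumes "A \<noteq> {}" "f \<in> Lip A" "\<And>x y. \<bar>f x - f y\<bar> \<le> dist x y"
  shows "\<bar>f x - f y\<bar> \<le> quot_dist A x y" "\<bar>f x\<bar> \<le> infdist x A"
proof -
  obtain a where a: "a \<in> A" using assms by blast
  have *: "\<bar>f x\<bar> \<le> infdist x A" for x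
    using Lip_le_infdist[OF assms(1) a, of f 1 x] assms(3) Lip_zero_on[OF assms(2)] a by simp
  show "\<bar>f x\<bar> \<le> infdist x A" by (rule *)
  show "\<bar>f x - f y\<bar> \<le> quot_dist A x y"
    using assms(3)[of x y] *[of x] *[of y] by (auto simp: quot_dist_def)
qed

text \<open>Marginals are prescribed on \<open>F\<close> only, and \<open>a0\<close> supplies or
  absorbs what is missing, so that finite duality applies. A dual pair is improved to a single
  function by the c-transform, which is \<open>1\<close>-Lipschitz for \<open>quot_dist\<close> and
  hence constant on \<open>A\<close>.\<close>

lemma finite_transport:
  fixes A :: "'a::metric_space set"
  assumes F: "finite F" "a0 \<in> A" "F \<inter> A = {}"
    and W: "\<And>f. f \<in> Lip A \<Longrightarrow> (\<And>x y. \<bar>f x - f y\<bar> \<le> dist x y) \<Longrightarrow> (\<Sum>x\<in>F. c x * f x) \<le> W"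
  obtains \<pi> where
    "\<And>x y. x \<in> insert a0 F \<Longrightarrow> y \<in> insert a0 F \<Longrightarrow> 0 \<le> \<pi> (x, y)"
    "\<And>x. x \<in> F \<Longrightarrow> (\<Sum>y\<in>insert a0 F. \<pi> (x, y)) = max 0 (c x)"
    "\<And>y. y \<in> F \<Longrightarrow> (\<Sum>x\<in>insert a0 F. \<pi> (x, y)) = max 0 (- c y)"
    "(\<Sum>z\<in>insert a0 F \<times> insert a0 F. quot_dist A (fst z) (snd z) * \<pi> z) \<le> W"
proof -
  define V where "V = insert a0 F"
  have V: "finite V" "V \<noteq> {}" "a0 \<notin> F" using F by (auto simp: V_def)
  \<comment> \<open>Placing the total of the opposite sign at \<open>a0\<close> balances the two
    marginals.\<close>
  define \<mu> where "\<mu> x = (if x = a0 then \<Sum>x\<in>F. max 0 (- c x) else max 0 (c x))" for x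
  define \<nu> where "\<nu> x = (if x = a0 then \<Sum>x\<in>F. max 0 (c x) else max 0 (- c x))" for x
  have sumV: "sum g V = g a0 + sum g F" for g :: "'a \<Rightarrow> real"
    using V F by (simp add: V_def)
  have on_F: "\<mu> x = max 0 (c x)" "\<nu> x = max 0 (- c x)" if "x \<in> F" for x
    using that V by (auto simp: \<mu>_def \<nu>_def)
  have total: "sum \<mu> V = sum \<nu> V"
    unfolding sumV using on_F by (simp add: \<mu>_def[of a0] \<nu>_def[of a0])
  have nonneg: "0 \<le> \<mu> x" "0 \<le> \<nu> x" for x by (auto simp: \<mu>_def \<nu>_def sum_nonneg)
  have dual: "(\<Sum>x\<in>V. \<phi> x * \<mu> x) + (\<Sum>y\<in>V. \<psi> y * \<nu> y) \<le> W"
    if *: "\<And>x y. x \<in> V \<Longrightarrow> y \<in> V \<Longrightarrow> \<phi> x + \<psi> y \<le> quot_dist A (fst (x, y)) (snd (x, y))" for \<phi> \<psi>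
  proof -
    \<comment> \<open>The c-transform of \<open>\<psi>\<close>: its largest admissible partner,
      defined on the whole space and not only on \<open>V\<close>.\<close>
    define g where "g x = Min ((\<lambda>y. quot_dist A x y - \<psi> y) ` V)" for x
    have g_le: "g x \<le> quot_dist A x y - \<psi> y" if "y \<in> V" for x y
      unfolding g_def using that V by (intro Min_le) auto
    have g_ge: "r \<le> g x" if "\<And>y. y \<in> V \<Longrightarrow> r \<le> quot_dist A x y - \<psi> y" for r x
      unfolding g_def using that V by (subst Min_ge_iff) auto
    have g1: "g x - g x' \<le> quot_dist A x x'" for x x'
    proof -
      have "g x - quot_dist A x x' \<le> g x'"
      proof (rule g_ge)
        fix y assume "y \<in> V"
        then show "g x - quot_dist A x x' \<le> quot_dist A x' y - \<psi> y"
          using g_le[of y x] quot_dist_triangle[of A x y x'] by linarith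
      qed
      then show ?thesis by simp
    qed
    define f where "f x = g x - g a0" for x
    have f1: "\<bar>f x - f y\<bar> \<le> quot_dist A x y" for x y
      using g1[of x y] g1[of y x] by (simp add: f_def abs_le_iff quot_dist_commute)
    then have f2: "\<bar>f x - f y\<bar> \<le> dist x y" for x y
      using quot_dist_le_dist order_trans by blast
    have "f a = 0" if "a \<in> A" for a
      using f1[of a a0] quot_dist_on_base[OF that F(2)] by (simp add: f_def)
    then have f: "f \<in> Lip A" using f2 by (auto simp: Lip_iff intro!: exI[of _ 1])
    have "(\<Sum>x\<in>V. \<phi> x * \<mu> x) + (\<Sum>y\<in>V. \<psi> y * \<nu> y) \<le> (\<Sum>x\<in>V. g x * \<mu> x) + (\<Sum>y\<in>V. - g y * \<nu> y)"
    proof (intro add_mono sum_mono mult_right_mono nonneg)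
      fix x assume x: "x \<in> V"
      show "\<phi> x \<le> g x" using *[OF x] by (intro g_ge) (simp add: algebra_simps)
      \<comment> \<open>The cost vanishes on the diagonal, so \<open>- g\<close> dominates
        \<open>\<psi>\<close> and one function replaces the pair.\<close>
      show "\<psi> x \<le> - g x" using g_le[OF x, of x] by (simp add: quot_dist_refl)
    qed
    also have "\<dots> = (\<Sum>x\<in>V. g x * (\<mu> x - \<nu> x))"
      by (simp add: sum.distrib[symmetric] algebra_simps)
    \<comment> \<open>Normalising at \<open>a0\<close> subtracts a constant, which integrates to
      zero because the marginals have equal totals; the term at \<open>a0\<close> then drops
      out.\<close>
    also have "\<dots> = (\<Sum>x\<in>V. f x * (\<mu> x - \<nu> x)) + g a0 * (\<Sum>x\<in>V. \<mu> x - \<nu> x)"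
      by (simp add: f_def sum_distrib_left sum.distrib[symmetric] left_diff_distrib)
    also have "(\<Sum>x\<in>V. \<mu> x - \<nu> x) = 0" using total by (simp add: sum_subtractf)
    also have "(\<Sum>x\<in>V. f x * (\<mu> x - \<nu> x)) = (\<Sum>x\<in>F. c x * f x)"
      unfolding sumV using on_F by (auto simp: f_def[of a0] max_def intro!: sum.cong)
    finally show ?thesis using W[OF f f2] by simp
  qed
  show ?thesis
  proof (rule finite_kantorovich_duality[OF V(1) V(1) nonneg(1) nonneg(2) total, of "\<lambda>z. quot_dist A (fst z) (snd z)" W])
    fix \<pi> assume \<pi>: "\<And>x y. x \<in> V \<Longrightarrow> y \<in> V \<Longrightarrow> 0 \<le> \<pi> (x, y)"
      "\<And>x. x \<in> V \<Longrightarrow> (\<Sum>y\<in>V. \<pi> (x, y)) = \<mu> x" "\<And>y. y \<in> V \<Longrightarrow> (\<Sum>x\<in>V. \<pi> (x, y)) = \<nu> y"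
      "(\<Sum>z\<in>V \<times> V. quot_dist A (fst z) (snd z) * \<pi> z) \<le> W"
    show thesis
    proof (rule that[of \<pi>])
      show "(\<Sum>y\<in>insert a0 F. \<pi> (x, y)) = max 0 (c x)" if "x \<in> F" for x
        using \<pi>(2)[of x] on_F(1)[OF that] that by (simp add: V_def)
      show "(\<Sum>x\<in>insert a0 F. \<pi> (x, y)) = max 0 (- c y)" if "y \<in> F" for y
        using \<pi>(3)[of y] on_F(2)[OF that] that by (simp add: V_def)
    qed (use \<pi>(1,4) in \<open>auto simp: V_def\<close>)
  qed (rule dual)
qed

section \<open>Bounding the transport cost from below and from above\<close>

lemma nn_integral_push_cong:
  fixes g :: "'a::topological_space \<Rightarrow> 'b::topological_space"
  assumes "closed A" "closed B" "g \<in> borel_measurable borel" "g ` A \<subseteq> B" "\<mu> \<in> borel_measures" "\<nu> \<in> borel_measures"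
    and "rel_push B g (rel_class A \<mu>) = rel_class B \<nu>"
    and f: "f \<in> borel_measurable borel" "\<And>x. x \<in> B \<Longrightarrow> f x = 0"
  shows "(\<integral>\<^sup>+x. f (g x) \<partial>\<mu>) = (\<integral>\<^sup>+x. f x \<partial>\<nu>)"
proof -
  have m: "g \<in> measurable \<mu> borel"
    using assms(3,5) measurable_cong_sets[of \<mu> borel] by (simp add: mem_borel_measures)
  have "(\<integral>\<^sup>+x. f (g x) \<partial>\<mu>) = (\<integral>\<^sup>+x. f x \<partial>distr \<mu> borel g)"
    using m f by (simp add: nn_integral_distr)
  also have "\<dots> = rel_nn_integral (rel_class B (distr \<mu> borel g)) f"
    using assms by (intro rel_nn_integral_class[symmetric]) (auto simp: mem_borel_measures)
  also have "rel_class B (distr \<mu> borel g) = rel_class B \<nu>"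
    using assms by (simp add: rel_push_class)
  also have "rel_nn_integral (rel_class B \<nu>) f = (\<integral>\<^sup>+x. f x \<partial>\<nu>)"
    using assms by (intro rel_nn_integral_class)
  finally show ?thesis .
qed

lemma integral_push_cong:
  fixes g :: "'a::topological_space \<Rightarrow> 'b::topological_space" and f :: "'b \<Rightarrow> real"
  assumes "closed A" "closed B" "g \<in> borel_measurable borel" "g ` A \<subseteq> B" "\<mu> \<in> borel_measures" "\<nu> \<in> borel_measures"
    and "rel_push B g (rel_class A \<mu>) = rel_class B \<nu>"
    and f: "f \<in> borel_measurable borel" "\<And>x. x \<in> B \<Longrightarrow> f x = 0"
  shows "(\<integral>x. f (g x) \<partial>\<mu>) = (\<integral>x. f x \<partial>\<nu>)"
proof -
  have m: "g \<in> measurable \<mu> borel"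
    using assms(3,5) measurable_cong_sets[of \<mu> borel] by (simp add: mem_borel_measures)
  have "(\<integral>x. f (g x) \<partial>\<mu>) = (\<integral>x. f x \<partial>distr \<mu> borel g)"
    using m f by (simp add: integral_distr)
  also have "\<dots> = rel_integral (rel_class B (distr \<mu> borel g)) f"
    using assms by (intro rel_integral_class[symmetric]) (auto simp: mem_borel_measures)
  also have "rel_class B (distr \<mu> borel g) = rel_class B \<nu>"
    using assms by (simp add: rel_push_class)
  also have "rel_integral (rel_class B \<nu>) f = (\<integral>x. f x \<partial>\<nu>)"
    using assms by (intro rel_integral_class)
  finally show ?thesis .
qed

lemma fst_snd_borel:
  "(fst :: 'a::topological_space \<times> 'b::topological_space \<Rightarrow> 'a) \<in> borel_measurable borel"
  "(snd :: 'a \<times> 'b \<Rightarrow> 'b) \<in> borel_measurable borel"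
  by (intro borel_measurable_continuous_onI continuous_intros)+

text \<open>The easy half of duality: \<open>f (fst z) - f (snd z)\<close> is integrated against a
  coupling. The projections are known only as classes, which suffices because \<open>f\<close>
  vanishes on \<open>A\<close>.\<close>

lemma Lip_integral_diff_le_W1:
  fixes A :: "'a::polish_space set"
  assumes A: "closed A" "A \<noteq> {}"
    and m: "\<mu> \<in> borel_measures" "\<nu> \<in> borel_measures" "moment A \<mu> < \<infinity>" "moment A \<nu> < \<infinity>"
    and f: "f \<in> Lip A" "\<And>x y. \<bar>f x - f y\<bar> \<le> dist x y"
  shows "ennreal \<bar>(\<integral>x. f x \<partial>\<mu>) - (\<integral>x. f x \<partial>\<nu>)\<bar> \<le> W1 A (rel_class A \<mu>) (rel_class A \<nu>)"
  unfolding W1_def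
proof (rule INF_greatest)
  fix P assume "P \<in> couplings A (rel_class A \<mu>) (rel_class A \<nu>)"
  then have P: "P \<in> rel_measures (A \<times> A)" "rel_push A fst P = rel_class A \<mu>" "rel_push A snd P = rel_class A \<nu>"
    by (auto simp: couplings_def)
  obtain \<pi> where \<pi>: "\<pi> \<in> borel_measures" "P = rel_class (A \<times> A) \<pi>" using rel_measures_cases[OF P(1)] by blast
  note [measurable_cong] = \<pi>(1)[unfolded mem_borel_measures]
  have AA: "closed (A \<times> A)" using A by (intro closed_Times)
  have fm [measurable]: "f \<in> borel_measurable borel" by (rule Lip_borel_measurable[OF f(1)])
  note [measurable] = fst_snd_borel
  have f0: "f x = 0" if "x \<in> A" for x using Lip_zero_on[OF f(1) that] .
  have bound: "(\<integral>\<^sup>+x. ennreal \<bar>f x\<bar> \<partial>\<sigma>) < \<infinity>" if "moment A \<sigma> < \<infinity>" for \<sigma>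
  proof -
    have "(\<integral>\<^sup>+x. ennreal \<bar>f x\<bar> \<partial>\<sigma>) \<le> moment A \<sigma>"
      using Lip_one_le_quot_dist(2)[OF A(2) f] by (intro nn_integral_mono ennreal_leI) auto
    then show ?thesis using that by auto
  qed
  have push: "(\<integral>x. f (fst x) \<partial>\<pi>) = (\<integral>x. f x \<partial>\<mu>)" "(\<integral>x. f (snd x) \<partial>\<pi>) = (\<integral>x. f x \<partial>\<nu>)"
    by (rule integral_push_cong[OF AA A(1) fst_snd_borel(1) _ \<pi>(1) m(1) P(2)[unfolded \<pi>(2)] fm f0]
        integral_push_cong[OF AA A(1) fst_snd_borel(2) _ \<pi>(1) m(2) P(3)[unfolded \<pi>(2)] fm f0]; auto)+
  have "(\<integral>\<^sup>+x. ennreal \<bar>f (fst x)\<bar> \<partial>\<pi>) = (\<integral>\<^sup>+x. ennreal \<bar>f x\<bar> \<partial>\<mu>)"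
    "(\<integral>\<^sup>+x. ennreal \<bar>f (snd x)\<bar> \<partial>\<pi>) = (\<integral>\<^sup>+x. ennreal \<bar>f x\<bar> \<partial>\<nu>)"
    by (rule nn_integral_push_cong[OF AA A(1) fst_snd_borel(1) _ \<pi>(1) m(1) P(2)[unfolded \<pi>(2)]]
        nn_integral_push_cong[OF AA A(1) fst_snd_borel(2) _ \<pi>(1) m(2) P(3)[unfolded \<pi>(2)]]; auto simp: f0)+
  \<comment> \<open>A representative of the coupling may have infinite mass. Integrability comes
    from the marginals, where \<open>\<bar>f\<bar>\<close> is dominated by \<open>infdist\<close>
    and the moments are finite.\<close>
  then have int: "integrable \<pi> (\<lambda>z. f (fst z))" "integrable \<pi> (\<lambda>z. f (snd z))"
    using bound[OF m(3)] bound[OF m(4)] by (auto intro!: integrableI_bounded)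
  have "(\<integral>x. f x \<partial>\<mu>) - (\<integral>x. f x \<partial>\<nu>) = (\<integral>z. f (fst z) - f (snd z) \<partial>\<pi>)"
    using int by (simp add: push)
  then have "ennreal \<bar>(\<integral>x. f x \<partial>\<mu>) - (\<integral>x. f x \<partial>\<nu>)\<bar> \<le> (\<integral>\<^sup>+z. ennreal \<bar>f (fst z) - f (snd z)\<bar> \<partial>\<pi>)"
    using integral_norm_bound_ennreal[OF Bochner_Integration.integrable_diff[OF int]] by simp
  also have "\<dots> \<le> (\<integral>\<^sup>+z. ennreal (quot_dist A (fst z) (snd z)) \<partial>\<pi>)"
    by (intro nn_integral_mono ennreal_leI Lip_one_le_quot_dist(1)[OF A(2) f])
  also have "\<dots> = rel_nn_integral P (\<lambda>(x, y). ennreal (quot_dist A x y))"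
    unfolding \<pi>(2) using AA \<pi>(1) quot_dist_borel_measurable[of A]
    by (subst rel_nn_integral_class) (auto simp: case_prod_unfold quot_dist_on_base)
  finally show "ennreal \<bar>(\<integral>x. f x \<partial>\<mu>) - (\<integral>x. f x \<partial>\<nu>)\<bar> \<le> rel_nn_integral P (\<lambda>(x, y). ennreal (quot_dist A x y))" .
qed

text \<open>The plan is optimal on \<open>F\<close> together with \<open>a0\<close>; all other mass
  is sent to or fetched from \<open>a0\<close> at the price \<open>infdist\<close>. The tail
  \<open>t\<close> enters twice, once for the positive and once for the negative part of
  \<open>c\<close>.\<close>

lemma W1_discrete_le:
  fixes A :: "'a::polish_space set" and c :: "'a \<Rightarrow> real"
  assumes A: "closed A" "A \<noteq> {}" and F: "finite F" "F \<inter> A = {}"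
    and W: "\<And>f. f \<in> Lip A \<Longrightarrow> (\<And>x y. \<bar>f x - f y\<bar> \<le> dist x y) \<Longrightarrow> (\<Sum>x\<in>F. c x * f x) \<le> W"
    and tail: "(\<integral>\<^sup>+x. ennreal (\<bar>c x\<bar> * infdist x A) * indicator (- F) x \<partial>count_space UNIV) \<le> ennreal t" "0 \<le> t"
  shows "W1 A (rel_class A (discrete_measure (\<lambda>x. max 0 (c x)))) (rel_class A (discrete_measure (\<lambda>x. max 0 (- c x)))) \<le> ennreal (W + 2 * t)"
proof -
  obtain a0 where a0: "a0 \<in> A" using A by blast
  obtain \<pi> where \<pi>: "\<And>x y. x \<in> insert a0 F \<Longrightarrow> y \<in> insert a0 F \<Longrightarrow> 0 \<le> \<pi> (x, y)"
    "\<And>x. x \<in> F \<Longrightarrow> (\<Sum>y\<in>insert a0 F. \<pi> (x, y)) = max 0 (c x)"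
    "\<And>y. y \<in> F \<Longrightarrow> (\<Sum>x\<in>insert a0 F. \<pi> (x, y)) = max 0 (- c y)"
    "(\<Sum>z\<in>insert a0 F \<times> insert a0 F. quot_dist A (fst z) (snd z) * \<pi> z) \<le> W"
    using finite_transport[OF F(1) a0 F(2) W] by blast
  define V where "V = insert a0 F"
  have V: "finite V" using F by (simp add: V_def)
  define p where "p z = (if z \<in> V \<times> V then \<pi> z else 0)" for z
  define u where "u x = (if x \<in> V then 0 else max 0 (c x))" for x
  define v where "v x = (if x \<in> V then 0 else max 0 (- c x))" for x
  \<comment> \<open>The leftover positive part leaves for \<open>a0\<close>, and the leftover
    negative part arrives from \<open>a0\<close>.\<close>
  define w where "w z = p z + (if snd z = a0 then u (fst z) else 0) + (if fst z = a0 then v (snd z) else 0)" for z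
  have p0: "0 \<le> p z" for z using \<pi>(1)[of "fst z" "snd z"] by (auto simp: p_def V_def)
  have uv0: "0 \<le> u x" "0 \<le> v x" for x by (auto simp: u_def v_def)
  \<comment> \<open>Rows over points of \<open>A\<close>, in particular the row of
    \<open>a0\<close>, carry no constraint because marginals are compared as classes.\<close>
  have row: "(\<integral>\<^sup>+y. ennreal (w (x, y)) \<partial>count_space UNIV) = ennreal (max 0 (c x))" if "x \<notin> A" for x
  proof (cases "x \<in> F")
    case True
    then have x: "x \<in> V" "x \<noteq> a0" using that a0 by (auto simp: V_def)
    then have "(\<integral>\<^sup>+y. ennreal (w (x, y)) \<partial>count_space UNIV) = (\<Sum>y\<in>V. ennreal (w (x, y)))"
      using V by (intro nn_integral_count_space') (auto simp: w_def p_def u_def)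
    also have "\<dots> = (\<Sum>y\<in>V. ennreal (\<pi> (x, y)))"
      using x by (intro sum.cong) (auto simp: w_def p_def u_def)
    also have "\<dots> = ennreal (\<Sum>y\<in>V. \<pi> (x, y))"
      using \<pi>(1) x by (intro sum_ennreal) (auto simp: V_def)
    finally show ?thesis using \<pi>(2)[OF True] by (simp add: V_def)
  next
    case False
    then have x: "x \<notin> V" "x \<noteq> a0" using that a0 by (auto simp: V_def)
    then have "(\<integral>\<^sup>+y. ennreal (w (x, y)) \<partial>count_space UNIV) = (\<Sum>y\<in>{a0}. ennreal (w (x, y)))"
      by (intro nn_integral_count_space') (auto simp: w_def p_def)
    then show ?thesis using x by (simp add: w_def p_def u_def)
  qed
  have col: "(\<integral>\<^sup>+x. ennreal (w (x, y)) \<partial>count_space UNIV) = ennreal (max 0 (- c y))" if "y \<notin> A" for y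
  proof (cases "y \<in> F")
    case True
    then have y: "y \<in> V" "y \<noteq> a0" using that a0 by (auto simp: V_def)
    then have "(\<integral>\<^sup>+x. ennreal (w (x, y)) \<partial>count_space UNIV) = (\<Sum>x\<in>V. ennreal (w (x, y)))"
      using V by (intro nn_integral_count_space') (auto simp: w_def p_def v_def)
    also have "\<dots> = (\<Sum>x\<in>V. ennreal (\<pi> (x, y)))"
      using y by (intro sum.cong) (auto simp: w_def p_def v_def)
    also have "\<dots> = ennreal (\<Sum>x\<in>V. \<pi> (x, y))"
      using \<pi>(1) y by (intro sum_ennreal) (auto simp: V_def)
    finally show ?thesis using \<pi>(3)[OF True] by (simp add: V_def)
  next
    case False
    then have y: "y \<notin> V" "y \<noteq> a0" using that a0 by (auto simp: V_def)
    then have "(\<integral>\<^sup>+x. ennreal (w (x, y)) \<partial>count_space UNIV) = (\<Sum>x\<in>{a0}. ennreal (w (x, y)))"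
      by (intro nn_integral_count_space') (auto simp: w_def p_def)
    then show ?thesis using y by (simp add: w_def p_def v_def)
  qed
  have AA: "closed (A \<times> A)" using A by (intro closed_Times)
  define P where "P = rel_class (A \<times> A) (discrete_measure w)"
  have meas: "fst \<in> measurable (discrete_measure w) borel" "snd \<in> measurable (discrete_measure w) borel"
    using fst_snd_borel measurable_cong_sets[of "discrete_measure w" borel] discrete_measure_borel[of w]
    by (auto simp: mem_borel_measures)
  have sp: "space (discrete_measure w) = UNIV" by (rule space_borel_measures) simp
  have fst_image: "fst ` (A \<times> A) \<subseteq> A" and snd_image: "snd ` (A \<times> A) \<subseteq> A" by auto
  have "rel_push A fst P = rel_class A (discrete_measure (\<lambda>x. max 0 (c x)))"
  proof -
    have "emeasure (distr (discrete_measure w) borel fst) E = emeasure (discrete_measure (\<lambda>x. max 0 (c x))) E"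
      if E: "E \<in> sets borel" "E \<subseteq> - A" for E
    proof -
      have "emeasure (distr (discrete_measure w) borel fst) E = emeasure (discrete_measure w) (fst -` E)"
        using meas E by (simp add: emeasure_distr sp)
      also have "\<dots> = (\<integral>\<^sup>+z. ennreal (w z) * indicator (fst -` E) z \<partial>count_space UNIV)"
        using measurable_sets[OF fst_snd_borel(1) E(1)] by (intro emeasure_discrete_measure) simp
      also have "\<dots> = (\<integral>\<^sup>+x. \<integral>\<^sup>+y. ennreal (w (x, y)) * indicator E x \<partial>count_space UNIV \<partial>count_space UNIV)"
        by (subst nn_integral_fst_count_space[symmetric]) (simp add: indicator_def)
      also have "\<dots> = (\<integral>\<^sup>+x. ennreal (max 0 (c x)) * indicator E x \<partial>count_space UNIV)"
        using E(2) by (intro nn_integral_cong) (auto simp: row nn_integral_multc split: split_indicator)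
      also have "\<dots> = emeasure (discrete_measure (\<lambda>x. max 0 (c x))) E" using E by (simp add: emeasure_discrete_measure)
      finally show ?thesis .
    qed
    then show ?thesis
      unfolding P_def rel_push_class[OF AA A(1) discrete_measure_borel fst_snd_borel(1) fst_image]
      using A by (subst rel_class_eq_iff) auto
  qed
  moreover have "rel_push A snd P = rel_class A (discrete_measure (\<lambda>x. max 0 (- c x)))"
  proof -
    have "emeasure (distr (discrete_measure w) borel snd) E = emeasure (discrete_measure (\<lambda>x. max 0 (- c x))) E"
      if E: "E \<in> sets borel" "E \<subseteq> - A" for E
    proof -
      have "emeasure (distr (discrete_measure w) borel snd) E = emeasure (discrete_measure w) (snd -` E)"
        using meas E by (simp add: emeasure_distr sp)
      also have "\<dots> = (\<integral>\<^sup>+z. ennreal (w z) * indicator (snd -` E) z \<partial>count_space UNIV)"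
        using measurable_sets[OF fst_snd_borel(2) E(1)] by (intro emeasure_discrete_measure) simp
      also have "\<dots> = (\<integral>\<^sup>+y. \<integral>\<^sup>+x. ennreal (w (x, y)) * indicator E y \<partial>count_space UNIV \<partial>count_space UNIV)"
        by (subst nn_integral_snd_count_space[symmetric]) (simp add: indicator_def)
      also have "\<dots> = (\<integral>\<^sup>+x. ennreal (max 0 (- c x)) * indicator E x \<partial>count_space UNIV)"
        using E(2) by (intro nn_integral_cong) (auto simp: col nn_integral_multc split: split_indicator)
      also have "\<dots> = emeasure (discrete_measure (\<lambda>x. max 0 (- c x))) E" using E by (simp add: emeasure_discrete_measure)
      finally show ?thesis .
    qed
    then show ?thesis
      unfolding P_def rel_push_class[OF AA A(1) discrete_measure_borel fst_snd_borel(2) snd_image]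
      using A by (subst rel_class_eq_iff) auto
  qed
  ultimately have "P \<in> couplings A (rel_class A (discrete_measure (\<lambda>x. max 0 (c x)))) (rel_class A (discrete_measure (\<lambda>x. max 0 (- c x))))"
    by (simp add: couplings_def P_def rel_class_in_rel_measures)
  then have "W1 A (rel_class A (discrete_measure (\<lambda>x. max 0 (c x)))) (rel_class A (discrete_measure (\<lambda>x. max 0 (- c x))))
      \<le> rel_nn_integral P (\<lambda>(x, y). ennreal (quot_dist A x y))"
    unfolding W1_def by (rule INF_lower)
  also have "\<dots> = (\<integral>\<^sup>+z. ennreal (quot_dist A (fst z) (snd z)) \<partial>discrete_measure w)"
    unfolding P_def using AA quot_dist_borel_measurable[of A]
    by (subst rel_nn_integral_class) (auto simp: case_prod_unfold quot_dist_on_base)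
  also have "\<dots> = (\<integral>\<^sup>+z. ennreal (w z) * ennreal (quot_dist A (fst z) (snd z)) \<partial>count_space UNIV)"
    using quot_dist_borel_measurable[of A] by (intro nn_integral_discrete_measure) (auto simp: case_prod_unfold)
  \<comment> \<open>Between any point and \<open>a0\<close> the cost \<open>quot_dist\<close> is the
    distance to \<open>A\<close>, so the total cost splits into that of the finite plan and two
    tails.\<close>
  also have "\<dots> = (\<integral>\<^sup>+z. ennreal (quot_dist A (fst z) (snd z) * p z)
      + (if snd z = a0 then ennreal (u (fst z) * infdist (fst z) A) else 0)
      + (if fst z = a0 then ennreal (v (snd z) * infdist (snd z) A) else 0) \<partial>count_space UNIV)"
  proof (intro nn_integral_cong)
    fix z :: "'a \<times> 'a"
    let ?q = "quot_dist A (fst z) (snd z)"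
    have "w z * ?q = ?q * p z + (if snd z = a0 then u (fst z) * infdist (fst z) A else 0)
      + (if fst z = a0 then v (snd z) * infdist (snd z) A else 0)"
      using quot_dist_to_base[OF a0] quot_dist_commute[of A a0]
      by (auto simp: w_def algebra_simps)
    moreover have "ennreal (w z) * ennreal ?q = ennreal (w z * ?q)"
      using quot_dist_nonneg p0 uv0 by (intro ennreal_mult[symmetric]) (auto simp: w_def)
    moreover have "0 \<le> ?q * p z" using quot_dist_nonneg p0 by (intro mult_nonneg_nonneg)
    ultimately show "ennreal (w z) * ennreal ?q = ennreal (?q * p z)
      + (if snd z = a0 then ennreal (u (fst z) * infdist (fst z) A) else 0)
      + (if fst z = a0 then ennreal (v (snd z) * infdist (snd z) A) else 0)"
      using uv0[of "fst z"] uv0[of "snd z"] infdist_nonneg[of _ A] by auto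
  qed
  also have "\<dots> = (\<integral>\<^sup>+z. ennreal (quot_dist A (fst z) (snd z) * p z) \<partial>count_space UNIV)
      + (\<integral>\<^sup>+z. (if snd z = a0 then ennreal (u (fst z) * infdist (fst z) A) else 0) \<partial>count_space UNIV)
      + (\<integral>\<^sup>+z. (if fst z = a0 then ennreal (v (snd z) * infdist (snd z) A) else 0) \<partial>count_space UNIV)"
    by (subst nn_integral_add; simp)+
  also have "(\<integral>\<^sup>+z. (if snd z = a0 then ennreal (u (fst z) * infdist (fst z) A) else 0) \<partial>count_space UNIV) \<le> ennreal t"
  proof -
    have "(\<integral>\<^sup>+z. (if snd z = a0 then ennreal (u (fst z) * infdist (fst z) A) else 0) \<partial>count_space UNIV)
      = (\<integral>\<^sup>+x. \<integral>\<^sup>+y. (if y = a0 then ennreal (u x * infdist x A) else 0) \<partial>count_space UNIV \<partial>count_space UNIV)"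
      by (subst nn_integral_fst_count_space[symmetric]) (simp cong: if_cong)
    also have "\<dots> = (\<integral>\<^sup>+x. ennreal (u x * infdist x A) \<partial>count_space UNIV)"
      by (intro nn_integral_cong) (subst nn_integral_count_space'[of "{a0}"], auto)
    also have "\<dots> \<le> (\<integral>\<^sup>+x. ennreal (\<bar>c x\<bar> * infdist x A) * indicator (- F) x \<partial>count_space UNIV)"
      by (intro nn_integral_mono)
        (auto simp: u_def V_def infdist_nonneg split: split_indicator intro!: ennreal_leI mult_right_mono)
    finally show ?thesis using tail by simp
  qed
  also have "(\<integral>\<^sup>+z. (if fst z = a0 then ennreal (v (snd z) * infdist (snd z) A) else 0) \<partial>count_space UNIV) \<le> ennreal t"
  proof -
    have "(\<integral>\<^sup>+z. (if fst z = a0 then ennreal (v (snd z) * infdist (snd z) A) else 0) \<partial>count_space UNIV)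
      = (\<integral>\<^sup>+y. \<integral>\<^sup>+x. (if x = a0 then ennreal (v y * infdist y A) else 0) \<partial>count_space UNIV \<partial>count_space UNIV)"
      by (subst nn_integral_snd_count_space[symmetric]) (simp cong: if_cong)
    also have "\<dots> = (\<integral>\<^sup>+x. ennreal (v x * infdist x A) \<partial>count_space UNIV)"
      by (intro nn_integral_cong) (subst nn_integral_count_space'[of "{a0}"], auto)
    also have "\<dots> \<le> (\<integral>\<^sup>+x. ennreal (\<bar>c x\<bar> * infdist x A) * indicator (- F) x \<partial>count_space UNIV)"
      by (intro nn_integral_mono)
        (auto simp: v_def V_def infdist_nonneg split: split_indicator intro!: ennreal_leI mult_right_mono)
    finally show ?thesis using tail by simp
  qed
  also have "(\<integral>\<^sup>+z. ennreal (quot_dist A (fst z) (snd z) * p z) \<partial>count_space UNIV) \<le> ennreal W"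
  proof -
    have "(\<integral>\<^sup>+z. ennreal (quot_dist A (fst z) (snd z) * p z) \<partial>count_space UNIV)
      = (\<Sum>z\<in>V \<times> V. ennreal (quot_dist A (fst z) (snd z) * p z))"
      using V by (intro nn_integral_count_space') (auto simp: p_def)
    also have "\<dots> = ennreal (\<Sum>z\<in>V \<times> V. quot_dist A (fst z) (snd z) * p z)"
      using p0 quot_dist_nonneg by (intro sum_ennreal mult_nonneg_nonneg)
    also have "(\<Sum>z\<in>V \<times> V. quot_dist A (fst z) (snd z) * p z) = (\<Sum>z\<in>V \<times> V. quot_dist A (fst z) (snd z) * \<pi> z)"
      by (intro sum.cong) (auto simp: p_def)
    finally show ?thesis using \<pi>(4) by (simp add: V_def ennreal_leI)
  qed
  \<comment> \<open>Testing with the zero function shows that \<open>W\<close> is nonnegative, so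
    \<open>ennreal\<close> respects the sum.\<close>
  also have "ennreal W + ennreal t + ennreal t = ennreal (W + 2 * t)"
    using W[OF Lip_zero] tail(2) by (simp add: ennreal_plus[symmetric] del: ennreal_plus)
  finally show ?thesis by (simp add: add_mono)
qed

section \<open>Representation by discrete measures and the norm identity\<close>

theorem theorem1p10:
  fixes A :: "'a::polish_space set" and T :: "('a \<Rightarrow> real) \<Rightarrow> real"
  assumes "closed A" and "A \<noteq> {}"
    and boundedly_compact: "\<And>S :: 'a set. closed S \<Longrightarrow> bounded S \<Longrightarrow> compact S"
    and "T \<in> seq_order_continuous_dual (Lip A)"
  shows "\<exists>\<mu>\<in>M1 A. \<exists>\<mu>p \<mu>n. is_decomposition A \<mu> \<mu>p \<mu>n \<and>
    (\<forall>f\<in>Lip A. T f = rel_integral \<mu>p f - rel_integral \<mu>n f) \<and>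
    op_norm A T = W1 A \<mu>p \<mu>n"
proof -
  note A = assms(1,2) and T = assms(4)
  obtain Q :: "'a set" where Q: "countable Q" "\<And>U. open U \<Longrightarrow> U \<noteq> {} \<Longrightarrow> \<exists>d\<in>Q. d \<in> U"
    using countable_dense_exists[where 'a = 'a] by blast
  define q where "q = from_nat_into Q"
  have dense: "\<exists>k. q k \<in> U" if "open U" "U \<noteq> {}" for U
    using Q(2)[OF that] from_nat_into_surj[OF Q(1)] unfolding q_def by metis
  define F where "F n = isolated_off A \<inter> q ` {..<n}" for n :: nat
  have F: "finite (F n)" "F n \<subseteq> isolated_off A" "F n \<inter> A = {}" for n
    by (auto simp: F_def isolated_off_def)
  have F_mono: "m \<le> n \<Longrightarrow> F m \<subseteq> F n" for m n by (auto simp: F_def)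
  then have incF: "incseq F" by (simp add: incseq_def)
  \<comment> \<open>The dense sequence meets the open set \<open>{x}\<close>, so every isolated
    point occurs in it.\<close>
  have F_ex: "\<exists>n. x \<in> F n" if "x \<in> isolated_off A" for x
  proof -
    have "open {x}" using that by (simp add: isolated_off_def)
    then obtain k where "q k = x" using dense[of "{x}"] by auto
    then show ?thesis using that by (intro exI[of _ "Suc k"]) (auto simp: F_def)
  qed
  define c where "c x = (if x \<in> isolated_off A then T (indicator {x}) else 0)" for x
  have c0: "c x = 0" if "\<And>n. x \<notin> F n" for x using F_ex that by (auto simp: c_def)
  have T_restr: "T (restr (F n) f) = (\<Sum>x\<in>F n. c x * f x)" for n f
    unfolding dual_restr[OF A T F(1,2)] using F(2) by (intro sum.cong) (auto simp: c_def)
  have T_lim: "(\<lambda>n. \<Sum>x\<in>F n. c x * f x) \<longlonglongrightarrow> T f" if "f \<in> Lip A" for f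
    using dual_lim[OF A T dense that] by (simp add: F_def[symmetric] T_restr)
  define g where "g x = \<bar>c x\<bar> * infdist x A" for x
  have g0: "0 \<le> g x" for x by (simp add: g_def infdist_nonneg)
  define s where "s n = sum g (F n)" for n
  define B where "B = modulus A T (\<lambda>x. infdist x A)"
  have sB: "s n \<le> B" for n
  proof -
    have "s n = (\<Sum>z\<in>F n. \<bar>T (indicator {z})\<bar> * infdist z A)"
      unfolding s_def using F(2) by (intro sum.cong) (auto simp: g_def c_def)
    then show ?thesis using dual_weights_bounded[OF A T F(1,2)] by (simp add: B_def)
  qed
  \<comment> \<open>The modulus of \<open>infdist\<close> bounds all partial sums, so the weights
    have a finite total \<open>L\<close> and the tails \<open>L - s n\<close> tend to zero.\<close>
  have "incseq s" unfolding s_def by (intro incseq_SucI sum_mono2 F(1) F_mono g0) simp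
  then obtain L where L: "s \<longlonglongrightarrow> L" "\<And>n. s n \<le> L"
    using incseq_convergent[of s B] sB by blast
  \<comment> \<open>Comparison at stage \<open>max m n\<close> also covers \<open>m < n\<close>,
    where the left side is an empty sum.\<close>
  have diff: "sum g (F m - F n) \<le> L - s n" for m n
  proof -
    have "sum g (F m - F n) \<le> sum g (F (max m n) - F n)"
      using F F_mono[of m "max m n"] g0 by (intro sum_mono2) auto
    also have "\<dots> = s (max m n) - s n"
      unfolding s_def using F F_mono[of n "max m n"] by (intro sum_diff) auto
    finally show ?thesis using L(2)[of "max m n"] by simp
  qed
  have total: "(\<integral>\<^sup>+x. ennreal (g x) \<partial>count_space UNIV) \<le> ennreal L"
  proof (rule nn_integral_count_space_le[OF incF F(1)])
    show "(\<Sum>x\<in>F n. ennreal (g x)) \<le> ennreal L" for n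
      using L(2)[of n] g0 by (simp add: sum_ennreal s_def ennreal_leI)
  qed (use c0 in \<open>auto simp: g_def\<close>)
  have tail: "(\<integral>\<^sup>+x. ennreal (\<bar>c x\<bar> * infdist x A) * indicator (- F n) x \<partial>count_space UNIV) \<le> ennreal (L - s n)" for n
  proof (rule nn_integral_count_space_le[OF incF F(1)])
    fix m
    have "(\<Sum>x\<in>F m. ennreal (\<bar>c x\<bar> * infdist x A) * indicator (- F n) x) = (\<Sum>x\<in>F m - F n. ennreal (g x))"
      using F(1) by (intro sum.mono_neutral_cong_right) (auto simp: g_def)
    also have "\<dots> = ennreal (sum g (F m - F n))" using g0 by (intro sum_ennreal)
    finally show "(\<Sum>x\<in>F m. ennreal (\<bar>c x\<bar> * infdist x A) * indicator (- F n) x) \<le> ennreal (L - s n)"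
      using diff by (simp add: ennreal_leI)
  qed (use c0 in auto)
  define \<mu> where "\<mu> = discrete_measure (\<lambda>x. max 0 (c x))"
  define \<nu> where "\<nu> = discrete_measure (\<lambda>x. max 0 (- c x))"
  have b: "\<mu> \<in> borel_measures" "\<nu> \<in> borel_measures" by (auto simp: \<mu>_def \<nu>_def)
  have mom: "moment A (discrete_measure w) < \<infinity>" if "\<And>x. 0 \<le> w x" "\<And>x. w x \<le> \<bar>c x\<bar>" for w
  proof -
    have "moment A (discrete_measure w) = (\<integral>\<^sup>+x. ennreal (w x * infdist x A) \<partial>count_space UNIV)"
      using that by (subst nn_integral_discrete_measure) (auto simp: ennreal_mult infdist_nonneg)
    also have "\<dots> \<le> (\<integral>\<^sup>+x. ennreal (g x) \<partial>count_space UNIV)"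
      using that by (intro nn_integral_mono ennreal_leI) (auto simp: g_def infdist_nonneg intro: mult_right_mono)
    finally show ?thesis using total by (auto simp: less_top[symmetric] top_unique)
  qed
  have moments: "moment A \<mu> < \<infinity>" "moment A \<nu> < \<infinity>"
    unfolding \<mu>_def \<nu>_def by (rule mom; simp)+
  have lim: "(\<lambda>n. \<Sum>x\<in>F n. w x * f x) \<longlonglongrightarrow> (\<integral>x. f x \<partial>discrete_measure w)"
    if f: "f \<in> Lip A" and w: "\<And>x. 0 \<le> w x" "\<And>x. w x \<le> \<bar>c x\<bar>" for f w
  proof -
    obtain C where C: "C \<ge> 0" "\<And>x. \<bar>f x\<bar> \<le> C * infdist x A" using Lip_dominated[OF A(2) f] by blast
    \<comment> \<open>Dominated convergence with the majorant \<open>C * g\<close>, which is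
      integrable because the weights have a finite total.\<close>
    have "(\<lambda>n. \<integral>x. w x * restr (F n) f x \<partial>count_space UNIV) \<longlonglongrightarrow> (\<integral>x. w x * f x \<partial>count_space UNIV)"
    proof (rule integral_dominated_convergence[where w = "\<lambda>x. C * g x"])
      show "integrable (count_space UNIV) (\<lambda>x. C * g x)"
        using total g0 by (intro integrable_mult_right integrableI_nonneg) (auto simp: less_top[symmetric] top_unique)
      show "AE x in count_space UNIV. (\<lambda>n. w x * restr (F n) f x) \<longlonglongrightarrow> w x * f x"
      proof (rule AE_I2)
        fix x
        show "(\<lambda>n. w x * restr (F n) f x) \<longlonglongrightarrow> w x * f x"
        proof (cases "\<exists>n. x \<in> F n")
          case True
          then obtain N where "x \<in> F N" by blast
          then have "\<forall>n\<ge>N. w x * restr (F n) f x = w x * f x" using F_mono by (auto simp: restr_def)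
          then show ?thesis by (intro tendsto_eventually) (auto simp: eventually_sequentially)
        next
          case False
          then show ?thesis using c0[of x] w(1)[of x] w(2)[of x] by simp
        qed
      qed
      have wf: "w x * \<bar>f x\<bar> \<le> C * g x" for x
      proof -
        have "w x * \<bar>f x\<bar> \<le> \<bar>c x\<bar> * (C * infdist x A)" using w C by (intro mult_mono) auto
        then show ?thesis by (simp add: g_def mult_ac)
      qed
      show "AE x in count_space UNIV. norm (w x * restr (F n) f x) \<le> C * g x" for n
      proof (rule AE_I2)
        fix x
        show "norm (w x * restr (F n) f x) \<le> C * g x"
          using wf[of x] w(1)[of x] C(1) g0[of x] by (auto simp: restr_def abs_mult)
      qed
    qed auto
    moreover have "(\<integral>x. w x * restr (F n) f x \<partial>count_space UNIV) = (\<Sum>x\<in>F n. w x * f x)" for n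
    proof -
      have fin: "finite {x. w x * restr (F n) f x \<noteq> 0}"
        by (rule finite_subset[OF _ F(1)[of n]]) (auto simp: restr_def)
      then have "(\<integral>x. w x * restr (F n) f x \<partial>count_space UNIV) = (\<Sum>x | x \<in> UNIV \<and> w x * restr (F n) f x \<noteq> 0. w x * restr (F n) f x)"
        by (intro lebesgue_integral_count_space_finite_support) simp
      also have "\<dots> = (\<Sum>x\<in>F n. w x * f x)"
        using F(1)[of n] by (intro sum.mono_neutral_cong_left) (auto simp: restr_def)
      finally show ?thesis .
    qed
    ultimately show ?thesis using integral_discrete_measure[OF Lip_borel_measurable[OF f] w(1)] by simp
  qed
  have rep: "T f = (\<integral>x. f x \<partial>\<mu>) - (\<integral>x. f x \<partial>\<nu>)" if f: "f \<in> Lip A" for f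
  proof (rule LIMSEQ_unique[OF T_lim[OF f]])
    have "(\<lambda>n. (\<Sum>x\<in>F n. max 0 (c x) * f x) - (\<Sum>x\<in>F n. max 0 (- c x) * f x))
        \<longlonglongrightarrow> (\<integral>x. f x \<partial>\<mu>) - (\<integral>x. f x \<partial>\<nu>)"
      unfolding \<mu>_def \<nu>_def by (intro tendsto_diff lim f) auto
    moreover have "(\<Sum>x\<in>F n. max 0 (c x) * f x) - (\<Sum>x\<in>F n. max 0 (- c x) * f x) = (\<Sum>x\<in>F n. c x * f x)" for n
      unfolding sum_subtractf[symmetric] by (intro sum.cong) (auto simp: max_def)
    ultimately show "(\<lambda>n. \<Sum>x\<in>F n. c x * f x) \<longlonglongrightarrow> (\<integral>x. f x \<partial>\<mu>) - (\<integral>x. f x \<partial>\<nu>)" by simp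
  qed
  have rel_rep: "rel_integral (rel_class A \<sigma>) f = (\<integral>x. f x \<partial>\<sigma>)" if "f \<in> Lip A" "\<sigma> \<in> borel_measures" for f \<sigma>
    using rel_integral_class[OF A(1) that(2) Lip_borel_measurable[OF that(1)] Lip_zero_on[OF that(1)]] .
  \<comment> \<open>The set that carries the positive part. As a union of open singletons it is
    Borel, and it shows that the two measures are mutually singular.\<close>
  define S where "S = {x. 0 < c x}"
  have "S = (\<Union>x\<in>S. {x})" by blast
  moreover have "open {x}" if "x \<in> S" for x
    using that by (auto simp: S_def c_def isolated_off_def split: if_splits)
  ultimately have "open S" by (metis open_UN)
  then have S: "S \<in> sets borel" "- S \<in> sets borel" by auto
  have null: "emeasure \<mu> (- S) = 0" "emeasure \<nu> S = 0"
    unfolding \<mu>_def \<nu>_def emeasure_discrete_measure[OF S(2)] emeasure_discrete_measure[OF S(1)]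
    by (subst nn_integral_0_iff_AE; auto simp: S_def split: split_indicator)+
  have dec: "is_decomposition A (M1_diff A (rel_class A \<mu>) (rel_class A \<nu>)) (rel_class A \<mu>) (rel_class A \<nu>)"
    using is_decomposition_singular[OF A b moments S(1) null] .
  have le: "op_norm A T \<le> W1 A (rel_class A \<mu>) (rel_class A \<nu>)"
    unfolding op_norm_def
  proof (rule SUP_least)
    fix f assume "f \<in> {f \<in> Lip A. lip_number f \<le> 1}"
    then have f: "f \<in> Lip A" "\<And>x y. \<bar>f x - f y\<bar> \<le> dist x y" using lip_number_le_one_iff by auto
    then show "ennreal \<bar>T f\<bar> \<le> W1 A (rel_class A \<mu>) (rel_class A \<nu>)"
      unfolding rep[OF f(1)] by (intro Lip_integral_diff_le_W1 A b moments)
  qed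
  \<comment> \<open>All competitors are dominated by \<open>infdist\<close>, so the modulus bounds
    the norm. Finiteness allows the real number \<open>N\<close> to stand for it in the dual
    bound.\<close>
  have "op_norm A T \<le> ennreal B"
    unfolding op_norm_def
  proof (rule SUP_least)
    fix f assume "f \<in> {f \<in> Lip A. lip_number f \<le> 1}"
    then have f: "f \<in> Lip A" "\<And>x y. \<bar>f x - f y\<bar> \<le> dist x y" using lip_number_le_one_iff by auto
    then show "ennreal \<bar>T f\<bar> \<le> ennreal B"
      unfolding B_def by (intro ennreal_leI modulus_ge[OF A T Lip_infdist] Lip_one_le_quot_dist(2)[OF A(2)])
  qed
  then have fin: "op_norm A T < \<infinity>" by (auto simp: less_top[symmetric] top_unique)
  define N where "N = enn2real (op_norm A T)"
  have N: "op_norm A T = ennreal N" using fin by (simp add: N_def less_top[symmetric])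
  have TN: "T f \<le> N" if f: "f \<in> Lip A" "\<And>x y. \<bar>f x - f y\<bar> \<le> dist x y" for f
  proof -
    have "ennreal \<bar>T f\<bar> \<le> ennreal N"
      unfolding N[symmetric] op_norm_def using f lip_number_le_one_iff[OF f(1)] by (intro SUP_upper) auto
    then show ?thesis by (simp add: N_def)
  qed
  have "W1 A (rel_class A \<mu>) (rel_class A \<nu>) \<le> op_norm A T"
  proof (rule ennreal_le_epsilon)
    fix e :: real assume e: "e > 0"
    \<comment> \<open>The share \<open>e / 3\<close> is chosen because cutting the series at
      \<open>F n\<close> loses \<open>t\<close> in the dual bound and the plan costs another
      \<open>2 * t\<close>.\<close>
    have "\<forall>\<^sub>F n in sequentially. L - e / 3 < s n"
      using e by (intro order_tendstoD(1)[OF L(1)]) simp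
    then obtain n where "L - e / 3 < s n" by (auto simp: eventually_sequentially)
    then have n: "L - s n < e / 3" by simp
    define t where "t = L - s n"
    have t: "0 \<le> t" "t < e / 3" using L(2)[of n] n by (auto simp: t_def)
    have sum_le: "(\<Sum>x\<in>F n. c x * f x) \<le> N + t"
      if f: "f \<in> Lip A" "\<And>x y. \<bar>f x - f y\<bar> \<le> dist x y" for f
    proof -
      \<comment> \<open>All later partial sums stay within the tail \<open>t\<close> of the one at
        stage \<open>n\<close>, and they converge to \<open>T f\<close>.\<close>
      have "(\<Sum>x\<in>F n. c x * f x) - t \<le> T f"
      proof (rule LIMSEQ_le_const[OF T_lim[OF f(1)]], intro exI[of _ n] allI impI)
        fix m assume m: "n \<le> m"
        have "(\<Sum>x\<in>F m. c x * f x) = (\<Sum>x\<in>F n. c x * f x) + (\<Sum>x\<in>F m - F n. c x * f x)"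
          using F(1) F_mono[OF m] by (metis sum.subset_diff add.commute)
        moreover have "- (\<Sum>x\<in>F m - F n. c x * f x) \<le> sum g (F m - F n)"
          unfolding sum_negf[symmetric]
        proof (rule sum_mono)
          fix x
          have "- (c x * f x) \<le> \<bar>c x\<bar> * \<bar>f x\<bar>" by (simp add: abs_mult[symmetric])
          also have "\<dots> \<le> g x"
            unfolding g_def using Lip_one_le_quot_dist(2)[OF A(2) f] by (intro mult_left_mono) auto
          finally show "- (c x * f x) \<le> g x" .
        qed
        ultimately show "(\<Sum>x\<in>F n. c x * f x) - t \<le> (\<Sum>x\<in>F m. c x * f x)"
          using diff[of m n] by (simp add: t_def)
      qed
      then show ?thesis using TN[OF f] by simp
    qed
    have "W1 A (rel_class A \<mu>) (rel_class A \<nu>) \<le> ennreal (N + t + 2 * t)"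
      unfolding \<mu>_def \<nu>_def by (rule W1_discrete_le[OF A F(1,3) sum_le tail[of n, folded t_def] t(1)])
    also have "\<dots> \<le> ennreal (N + e)" using t by (intro ennreal_leI) simp
    also have "\<dots> = op_norm A T + ennreal e"
      unfolding N using e by (intro ennreal_plus) (auto simp: N_def)
    finally show "W1 A (rel_class A \<mu>) (rel_class A \<nu>) \<le> op_norm A T + ennreal e" .
  qed
  with le have "op_norm A T = W1 A (rel_class A \<mu>) (rel_class A \<nu>)" by simp
  moreover have "M1_diff A (rel_class A \<mu>) (rel_class A \<nu>) \<in> M1 A"
    using A b moments by (intro M1_diff_in_M1) (auto simp: M1plus_class_iff)
  moreover have "\<forall>f\<in>Lip A. T f = rel_integral (rel_class A \<mu>) f - rel_integral (rel_class A \<nu>) f"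
    using rep rel_rep[OF _ b(1)] rel_rep[OF _ b(2)] by simp
  ultimately show ?thesis
    using dec by blast
qed

end
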